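(* Let $G$ be a connected finite graph of genus $g\ge2$, let $\alpha\in H_1(G,\mathbb Z)$ and $\underline\alpha=\alpha+\Lambda\in Q_\Lambda$. (a) $\pi(\underline\alpha,l)=\pi_c(\underline\alpha,l)=N(\underline\alpha,l)=0$ if one of the following holds: (i) $\nu_G\nmid l$; (ii) $\theta\in\widehat{Q_\Lambda}$, $\chi_\theta(\underline\alpha)=1$ and $l$ is odd; (iii) $\theta\in\widehat{Q_\Lambda}$, $\chi_\theta(\underline\alpha)=-1$ and $l$ is even. (b) As $l\to\infty$, $\pi(\underline\alpha,l)\sim\pi_c(\underline\alpha,l)\sim\frac{N(\underline\alpha,l)}{l}\sim\frac{\nu_G\rho_G^l}{l|Q_\Lambda|}$ if one of the following holds: (i) $\nu_G\mid l$ and $\theta\notin\widehat{Q_\Lambda}$; (ii) $G$ is bipartite, $\nu_G\mid l$, and no nonzero element of $\widehat{Q_\Lambda}$ is a $2$-torsion element of $\mathcal X$; (iii) $G$ is regular and bipartite, and $\nu_G\mid l$. (c) As $l\to\infty$, $\pi(\underline\alpha,l)\sim\pi_c(\underline\alpha,l)\sim\frac{N(\underline\alpha,l)}{l}\sim\frac{2\nu_G\rho_G^l}{l|Q_\Lambda|}$ if one of the following holds: (i) $G$ is not bipartite, $\nu_G\mid l$, $\theta\in\widehat{Q_\Lambda}$, $\chi_\theta(\underline\alpha)=1$ and $l$ is even; (ii) $G$ is not bipartite, $\nu_G\mid l$, $\theta\in\widehat{Q_\Lambda}$, $\chi_\theta(\underline\alpha)=-1$ and $l$ is odd.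
   Context: $G$: connected finite graph (multiple edges, loops allowed), $n$ vertices, $m$ edges, genus $g=m-n+1$; $\mathbf E(G)$ its $2m$ oriented edges, $\mathbf a(0),\mathbf a(1)$ initial/terminal vertex, $\mathbf a^{-1}$ inverse; positively oriented edges $\mathbf e_1,\dots,\mathbf e_m$. $\mathcal T(G)$ = real span of the $\mathbf e_i$ ($\mathbf e_i^{-1}=-\mathbf e_i$), $\Omega(G)$ its dual, with orthonormal dual basis $d\mathbf e_i$. $H_1(G,\mathbb Z)$ = integer combinations of the $\mathbf e_i$ with zero boundary. $\mathcal H^1(G)$ = harmonic $1$-forms; $\phi_1(\omega)$ the harmonic part of $\omega$ in the orthogonal decomposition harmonic $\oplus$ exact. $H_1(G,\mathbb Z)^\vee=\{\eta\in\mathcal H^1(G):\eta(H_1(G,\mathbb Z))\subseteq\mathbb Z\}$, $\mathcal X=\mathcal H^1(G)/H_1(G,\mathbb Z)^\vee$, $\underline\omega=\phi_1(\omega)+H_1(G,\mathbb Z)^\vee$, $\chi_\omega(\alpha)=\exp(2\pi\sqrt{-1}\omega(\alpha))$. The canonical character is $\theta=\underline{\omega_O}$ with $\omega_O=\frac12\sum_i d\mathbf e_i$. $\Lambda\subseteq H_1(G,\mathbb Z)$ is a subgroup of finite index, $Q_\Lambda=H_1(G,\mathbb Z)/\Lambda$, $\Lambda^\vee=\{\eta\in\mathcal H^1(G):\eta(\Lambda)\subseteq\mathbb Z\}$, $\widehat{Q_\Lambda}=\Lambda^\vee/H_1(G,\mathbb Z)^\vee\subseteq\mathcal X$; for $\underline\omega\in\widehat{Q_\Lambda}$,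 $\chi_{\underline\omega}(\underline\alpha):=\chi_\omega(\alpha)$. Edge adjacency matrix $W_1$: $2m\times2m$, $(W_1)_{\mathbf a\mathbf b}=1$ if $\mathbf a(1)=\mathbf b(0)$ and $\mathbf b\ne\mathbf a^{-1}$, else $0$; $\rho_G$ its spectral radius, $\nu_G$ the number of distinct eigenvalues of $W_1$ of modulus $\rho_G$. Walks are sequences $\mathbf a_1\cdots\mathbf a_N$ with $\mathbf a_{i+1}(0)=\mathbf a_i(1)$, length $N$; a circuit is a closed walk with no backtrack ($\mathbf a_{i+1}=\mathbf a_i^{-1}$) and no tail ($\mathbf a_N=\mathbf a_1^{-1}$); a prime circuit is one not of the form $D^r$ ($D$ a circuit, $r>1$); circuits differing only by the starting point are equivalent, and equivalence classes are cycles (prime cycles if of prime circuits). $C^{ab}=\sum\mathbf a_i\in H_1(G,\mathbb Z)$. $N(\underline\alpha,l)$ = number of circuits of length $l$ with $C^{ab}\in\underline\alpha$; $\pi(\underline\alpha,l)$ = number of prime cycles $[P]$ of length $l$ with $P^{ab}\in\underline\alpha$; $\pi_c(\underline\alpha,l)$ = number of cycles $[C]$ of length $l$ with $C^{ab}\in\underline\alpha$. *)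

theory Defs
  imports
    "HOL-Library.Landau_Symbols"
    "HOL-Algebra.Coset"
    "Graph_Theory.Digraph_Component"
    "Jordan_Normal_Form.Spectral_Radius"
begin

text \<open>
  A finite undirected multigraph, loops allowed, is given together with a reference orientation
  as a finite digraph \<open>G\<close>: the arcs of \<open>G\<close> are the positively oriented edges
  \<open>e\<^sub>1, \<dots>, e\<^sub>m\<close>. Connectedness of the undirected graph is \<^const>\<open>Digraph_Component.connected\<close>,
  which passes to the symmetric closure.

  The \<open>2m\<close> oriented edges are pairs: \<open>(e, True)\<close> is the positively oriented edge \<open>e\<close> and
  \<open>(e, False)\<close> is its inverse. In particular the two orientations of a loop are different.
\<close>

definition genus :: "('v, 'e) pre_digraph \<Rightarrow> int" where
  "genus G = int (card (arcs G)) - int (card (verts G)) + 1"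

definition oriented_edges :: "('v, 'e) pre_digraph \<Rightarrow> ('e \<times> bool) set" where
  "oriented_edges G = arcs G \<times> UNIV"

definition initial_vertex :: "('v, 'e) pre_digraph \<Rightarrow> 'e \<times> bool \<Rightarrow> 'v" where
  "initial_vertex G a = (if snd a then tail G (fst a) else head G (fst a))"

definition terminal_vertex :: "('v, 'e) pre_digraph \<Rightarrow> 'e \<times> bool \<Rightarrow> 'v" where
  "terminal_vertex G a = (if snd a then head G (fst a) else tail G (fst a))"

definition edge_inv :: "'e \<times> bool \<Rightarrow> 'e \<times> bool" where
  "edge_inv a = (fst a, \<not> snd a)"

definition bipartite :: "('v, 'e) pre_digraph \<Rightarrow> bool" where
  "bipartite G \<longleftrightarrow> (\<exists>A B. verts G = A \<union> B \<and> A \<inter> B = {} \<and>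
     (\<forall>a \<in> oriented_edges G. initial_vertex G a \<in> A \<longleftrightarrow> terminal_vertex G a \<in> B))"

text \<open>A loop contributes 2 to the degree of its vertex.\<close>

definition degree_at :: "('v, 'e) pre_digraph \<Rightarrow> 'v \<Rightarrow> nat" where
  "degree_at G v = card {a \<in> oriented_edges G. initial_vertex G a = v}"

definition regular_graph :: "('v, 'e) pre_digraph \<Rightarrow> bool" where
  "regular_graph G \<longleftrightarrow> (\<exists>d. \<forall>v \<in> verts G. degree_at G v = d)"


subsection \<open>Chains, forms and characters\<close>

text \<open>
  An element of the real span of the positively oriented edges is the function of its
  coefficients, extended by 0 outside \<open>arcs G\<close>. A 1-form is the function of its coordinates with
  respect to the dual basis, extended by 0 in the same way.
\<close>

definition chains :: "('v, 'e) pre_digraph \<Rightarrow> ('e \<Rightarrow> real) set" where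
  "chains G = {c. \<forall>e. e \<notin> arcs G \<longrightarrow> c e = 0}"

definition forms :: "('v, 'e) pre_digraph \<Rightarrow> ('e \<Rightarrow> real) set" where
  "forms G = {\<omega>. \<forall>e. e \<notin> arcs G \<longrightarrow> \<omega> e = 0}"

definition form_eval :: "('v, 'e) pre_digraph \<Rightarrow> ('e \<Rightarrow> real) \<Rightarrow> ('e \<Rightarrow> real) \<Rightarrow> real" where
  "form_eval G \<omega> c = (\<Sum>e \<in> arcs G. \<omega> e * c e)"

definition edge_chain :: "'e \<times> bool \<Rightarrow> 'e \<Rightarrow> real" where
  "edge_chain a = (\<lambda>e. if e = fst a then (if snd a then 1 else - 1) else 0)"

definition boundary :: "('v, 'e) pre_digraph \<Rightarrow> ('e \<Rightarrow> real) \<Rightarrow> 'v \<Rightarrow> real" where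
  "boundary G c v = (\<Sum>e \<in> arcs G. c e * (of_bool (head G e = v) - of_bool (tail G e = v)))"

definition H1_int :: "('v, 'e) pre_digraph \<Rightarrow> ('e \<Rightarrow> real) set" where
  "H1_int G = {c \<in> chains G. (\<forall>e. c e \<in> \<int>) \<and> (\<forall>v. boundary G c v = 0)}"

definition differential :: "('v, 'e) pre_digraph \<Rightarrow> ('v \<Rightarrow> real) \<Rightarrow> 'e \<Rightarrow> real" where
  "differential G f = (\<lambda>e. if e \<in> arcs G then f (head G e) - f (tail G e) else 0)"

definition exact_forms :: "('v, 'e) pre_digraph \<Rightarrow> ('e \<Rightarrow> real) set" where
  "exact_forms G = range (differential G)"

definition harmonic_forms :: "('v, 'e) pre_digraph \<Rightarrow> ('e \<Rightarrow> real) set" where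
  "harmonic_forms G = {\<omega> \<in> forms G. \<forall>v \<in> verts G.
     (\<Sum>a | a \<in> oriented_edges G \<and> initial_vertex G a = v. form_eval G \<omega> (edge_chain a)) = 0}"

definition harmonic_part :: "('v, 'e) pre_digraph \<Rightarrow> ('e \<Rightarrow> real) \<Rightarrow> 'e \<Rightarrow> real" where
  "harmonic_part G \<omega> = (THE \<eta>. \<eta> \<in> harmonic_forms G \<and> (\<lambda>e. \<omega> e - \<eta> e) \<in> exact_forms G)"

definition dual_lattice :: "('v, 'e) pre_digraph \<Rightarrow> ('e \<Rightarrow> real) set \<Rightarrow> ('e \<Rightarrow> real) set" where
  "dual_lattice G L = {\<eta> \<in> harmonic_forms G. \<forall>\<alpha> \<in> L. form_eval G \<eta> \<alpha> \<in> \<int>}"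

definition pointwise_add_group :: "('e \<Rightarrow> real) set \<Rightarrow> ('e \<Rightarrow> real) monoid" where
  "pointwise_add_group S = \<lparr>carrier = S, monoid.mult = (\<lambda>f g x. f x + g x), one = (\<lambda>x. 0)\<rparr>"

definition homology_group :: "('v, 'e) pre_digraph \<Rightarrow> ('e \<Rightarrow> real) monoid" where
  "homology_group G = pointwise_add_group (H1_int G)"

definition quotient_group ::
    "('v, 'e) pre_digraph \<Rightarrow> ('e \<Rightarrow> real) set \<Rightarrow> ('e \<Rightarrow> real) set monoid" where
  "quotient_group G \<Lambda> = homology_group G Mod \<Lambda>"

definition homology_coset ::
    "('v, 'e) pre_digraph \<Rightarrow> ('e \<Rightarrow> real) set \<Rightarrow> ('e \<Rightarrow> real) \<Rightarrow> ('e \<Rightarrow> real) set" where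
  "homology_coset G \<Lambda> \<alpha> = \<Lambda> #>\<^bsub>homology_group G\<^esub> \<alpha>"

definition character_group :: "('v, 'e) pre_digraph \<Rightarrow> ('e \<Rightarrow> real) set monoid" where
  "character_group G = pointwise_add_group (harmonic_forms G) Mod dual_lattice G (H1_int G)"

definition harmonic_coset :: "('v, 'e) pre_digraph \<Rightarrow> ('e \<Rightarrow> real) \<Rightarrow> ('e \<Rightarrow> real) set" where
  "harmonic_coset G \<eta> =
     dual_lattice G (H1_int G) #>\<^bsub>pointwise_add_group (harmonic_forms G)\<^esub> \<eta>"

definition character_of :: "('v, 'e) pre_digraph \<Rightarrow> ('e \<Rightarrow> real) \<Rightarrow> ('e \<Rightarrow> real) set" where
  "character_of G \<omega> = harmonic_coset G (harmonic_part G \<omega>)"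

definition quotient_characters ::
    "('v, 'e) pre_digraph \<Rightarrow> ('e \<Rightarrow> real) set \<Rightarrow> ('e \<Rightarrow> real) set set" where
  "quotient_characters G \<Lambda> = harmonic_coset G ` dual_lattice G \<Lambda>"

definition chi :: "('v, 'e) pre_digraph \<Rightarrow> ('e \<Rightarrow> real) \<Rightarrow> ('e \<Rightarrow> real) \<Rightarrow> complex" where
  "chi G \<omega> \<alpha> = exp (2 * of_real pi * \<i> * of_real (form_eval G \<omega> \<alpha>))"

text \<open>
  For \<open>x \<in> quotient_characters G \<Lambda>\<close> and \<open>A\<close> a coset of \<open>\<Lambda>\<close>, the value does not depend on the
  representatives; for other arguments it carries no meaning.
\<close>

definition chi_coset ::
    "('v, 'e) pre_digraph \<Rightarrow> ('e \<Rightarrow> real) set \<Rightarrow> ('e \<Rightarrow> real) set \<Rightarrow> complex" where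
  "chi_coset G x A = (THE z. \<exists>\<omega> \<in> x. \<exists>\<alpha> \<in> A. z = chi G \<omega> \<alpha>)"

definition orientation_form :: "('v, 'e) pre_digraph \<Rightarrow> 'e \<Rightarrow> real" where
  "orientation_form G = (\<lambda>e. if e \<in> arcs G then 1 / 2 else 0)"

definition canonical_character :: "('v, 'e) pre_digraph \<Rightarrow> ('e \<Rightarrow> real) set" where
  "canonical_character G = character_of G (orientation_form G)"


subsection \<open>The edge adjacency matrix\<close>

text \<open>
  Matrices are indexed by natural numbers, so the oriented edges are enumerated. Another
  enumeration conjugates the matrix by a permutation matrix and leaves the spectrum unchanged.
\<close>

definition oriented_edge_list :: "('v, 'e) pre_digraph \<Rightarrow> ('e \<times> bool) list" where
  "oriented_edge_list G = (SOME es. distinct es \<and> set es = oriented_edges G)"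

definition edge_adjacency_matrix :: "('v, 'e) pre_digraph \<Rightarrow> complex mat" where
  "edge_adjacency_matrix G =
     (let es = oriented_edge_list G in
      mat (length es) (length es) (\<lambda>(i, j).
        if terminal_vertex G (es ! i) = initial_vertex G (es ! j) \<and> es ! j \<noteq> edge_inv (es ! i)
        then 1 else 0))"

definition rho :: "('v, 'e) pre_digraph \<Rightarrow> real" where
  "rho G = spectral_radius (edge_adjacency_matrix G)"

definition nu :: "('v, 'e) pre_digraph \<Rightarrow> nat" where
  "nu G = card {z \<in> spectrum (edge_adjacency_matrix G). cmod z = rho G}"


subsection \<open>Circuits and cycles\<close>

definition walk :: "('v, 'e) pre_digraph \<Rightarrow> ('e \<times> bool) list \<Rightarrow> bool" where
  "walk G p \<longleftrightarrow> p \<noteq> [] \<and> set p \<subseteq> oriented_edges G \<and>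
     (\<forall>i. Suc i < length p \<longrightarrow> initial_vertex G (p ! Suc i) = terminal_vertex G (p ! i))"

definition circuit :: "('v, 'e) pre_digraph \<Rightarrow> ('e \<times> bool) list \<Rightarrow> bool" where
  "circuit G p \<longleftrightarrow> walk G p \<and> terminal_vertex G (last p) = initial_vertex G (hd p) \<and>
     (\<forall>i. Suc i < length p \<longrightarrow> p ! Suc i \<noteq> edge_inv (p ! i)) \<and> last p \<noteq> edge_inv (hd p)"

definition prime_circuit :: "('v, 'e) pre_digraph \<Rightarrow> ('e \<times> bool) list \<Rightarrow> bool" where
  "prime_circuit G p \<longleftrightarrow> circuit G p \<and>
     \<not> (\<exists>q r. circuit G q \<and> r > 1 \<and> p = concat (replicate r q))"

definition circuit_equiv ::
    "('v, 'e) pre_digraph \<Rightarrow> (('e \<times> bool) list \<times> ('e \<times> bool) list) set" where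
  "circuit_equiv G = {(p, q). circuit G p \<and> circuit G q \<and> (\<exists>k. q = rotate k p)}"

definition cycles :: "('v, 'e) pre_digraph \<Rightarrow> ('e \<times> bool) list set set" where
  "cycles G = {p. circuit G p} // circuit_equiv G"

definition prime_cycles :: "('v, 'e) pre_digraph \<Rightarrow> ('e \<times> bool) list set set" where
  "prime_cycles G = {p. prime_circuit G p} // circuit_equiv G"

definition abelianization :: "('e \<times> bool) list \<Rightarrow> 'e \<Rightarrow> real" where
  "abelianization p = (\<lambda>e. \<Sum>a\<leftarrow>p. edge_chain a e)"

text \<open>
  Length and abelianization are constant on a cycle, so in the two cycle counts it does not matter
  which representative is used.
\<close>

definition circuit_count :: "('v, 'e) pre_digraph \<Rightarrow> ('e \<Rightarrow> real) set \<Rightarrow> nat \<Rightarrow> nat" where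
  "circuit_count G A l = card {p. circuit G p \<and> length p = l \<and> abelianization p \<in> A}"

definition cycle_count :: "('v, 'e) pre_digraph \<Rightarrow> ('e \<Rightarrow> real) set \<Rightarrow> nat \<Rightarrow> nat" where
  "cycle_count G A l =
     card {C \<in> cycles G. \<exists>p \<in> C. length p = l \<and> abelianization p \<in> A}"

definition prime_cycle_count :: "('v, 'e) pre_digraph \<Rightarrow> ('e \<Rightarrow> real) set \<Rightarrow> nat \<Rightarrow> nat" where
  "prime_cycle_count G A l =
     card {C \<in> prime_cycles G. \<exists>p \<in> C. length p = l \<and> abelianization p \<in> A}"

text \<open>
  The chain of asymptotic equivalences between the three counts and \<open>c * \<rho> ^ l / (l |Q|)\<close>, as
  \<open>l\<close> tends to infinity through the set \<open>S\<close>.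
\<close>

definition counts_asymptotic ::
    "('v, 'e) pre_digraph \<Rightarrow> ('e \<Rightarrow> real) set \<Rightarrow> ('e \<Rightarrow> real) \<Rightarrow> nat set \<Rightarrow> real \<Rightarrow> bool" where
  "counts_asymptotic G \<Lambda> \<alpha> S c \<longleftrightarrow>
     (let F = inf sequentially (principal S); A = homology_coset G \<Lambda> \<alpha> in
      (\<lambda>l. real (prime_cycle_count G A l)) \<sim>[F] (\<lambda>l. real (cycle_count G A l)) \<and>
      (\<lambda>l. real (cycle_count G A l)) \<sim>[F] (\<lambda>l. real (circuit_count G A l) / real l) \<and>
      (\<lambda>l. real (circuit_count G A l) / real l) \<sim>[F]
        (\<lambda>l. c * rho G ^ l / (real l * real (card (carrier (quotient_group G \<Lambda>))))))"

end

theory Submission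
  imports
    Defs
    "HOL-Number_Theory.Cong"
    "HOL-Algebra.Multiplicative_Group"
    "HOL-Analysis.Function_Topology"
begin

text \<open>
  Circuits are closed walks of the non-backtracking relation on oriented edges. For genus at least 2
  the edges that lie on circuits (the core) form a single strongly connected class: otherwise some
  edge would not reach its inverse, and the edges reachable from it would orient the graph with
  exactly one incoming edge at each vertex. A Perron eigenvector of the core turns walk counts into
  powers of a stochastic matrix, and the eigenvalues of modulus \<open>rho\<close> are those of a cyclic matrix
  whose order is the period of the core, the greatest common divisor of the lengths of circuits.

  Circuits in a class of \<open>Q = H\<^sub>1 / \<Lambda>\<close> are walks in the abelian cover with group \<open>Q\<close>, whose connectedness
  says that circuits generate \<open>H\<^sub>1\<close>. The limit theorem for periodic Markov chains, together with the
  invariance under the deck group, gives \<open>D * rho ^ l / |Q|\<close> circuits, where \<open>D\<close> is the period of the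
  cover. Reversing circuits shows that \<open>D\<close> is \<open>nu\<close> or \<open>2 * nu\<close>, and the hypotheses on the canonical
  character, on 2-torsion or on regularity decide which. Circuits that are proper powers are
  negligible, so all three counts agree asymptotically.
\<close>

section \<open>Nonnegative kernels on finite sets\<close>

text \<open>Two obstacles shape the construction. The edge adjacency matrix is in general reducible,
  because edges leading to or from a leaf lie on no circuit; so Perron-Frobenius theory is applied
  to the core alone, and since the remaining edges carry no cycle, every nonzero eigenvalue comes
  from the core. Moreover only closed walks have a homology class. To let a class grow step by step,
  each vertex \<open>v\<close> receives an integral chain \<open>s v\<close> from a base vertex,
  which turns every edge into a cycle; along a closed walk these chains cancel. The Perron vector of
  the core, pulled back to the cover, turns the cover into a Markov chain with the same growth rate,
  so the characters of \<open>Q\<close> enter only through the period D of the cover. Within one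
  class of \<open>Q\<close> all circuit lengths agree modulo D. This is the reason why in (c), where
  D is twice the odd number \<open>nu G\<close>, the parity of \<open>l\<close> has to match the
  value of \<theta> on the class, and why the circuits present there are twice as frequent.\<close>

lemma add_closed_contains_multiples_of_Gcd:
  fixes S :: "nat set"
  assumes add: "\<And>m n. m \<in> S \<Longrightarrow> n \<in> S \<Longrightarrow> m + n \<in> S"
    and s0: "s0 \<in> S" "s0 > 0"
  shows "\<exists>N. \<forall>n\<ge>N. Gcd S dvd n \<longrightarrow> n \<in> S"
proof -
  have mult: "k * s \<in> S" if "s \<in> S" "k > 0" for k s
    using that(2)
  proof (induction k rule: nat_induct_non_zero)
    case 1
    then show ?case using that by simp
  next
    case (Suc k)
    then show ?case using add[OF that(1)] by simp
  qed
  \<comment> \<open>The gcd is obtained as the least positive difference of two elements of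
    \<open>S\<close>. If \<open>s = q * d + r\<close> with \<open>0 < r < d\<close>, then
    \<open>q * (t + d)\<close> and \<open>q * t + s\<close> would be two elements at the smaller
    distance \<open>r\<close>.\<close>
  define Pd where "Pd = (\<lambda>e. e > 0 \<and> (\<exists>s\<in>S. s + e \<in> S))"
  define d where "d = (LEAST e. Pd e)"
  have PdI: "Pd s" if "s \<in> S" "s > 0" for s
    unfolding Pd_def using that add by blast
  have "Pd d" unfolding d_def by (rule LeastI[of Pd, OF PdI[OF s0]])
  then obtain t0 where "t0 \<in> S" "t0 + d \<in> S" and d: "d > 0" by (auto simp: Pd_def)
  then have "t0 + s0 \<in> S" "(t0 + s0) + d \<in> S" "t0 + s0 > 0"
    using add[of "t0 + d" s0] add[of t0 s0] s0 by (auto simp: ac_simps)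
  then obtain t where t: "t \<in> S" "t + d \<in> S" "t > 0" by blast
  have least: "d \<le> e" if "Pd e" for e unfolding d_def by (rule Least_le[of Pd, OF that])
  have dvd: "d dvd s" if "s \<in> S" for s
  proof (rule ccontr)
    assume nd: "\<not> d dvd s"
    define q r where "q = s div d" and "r = s mod d"
    have r: "0 < r" "r < d" and s: "s = q * d + r"
      using nd d by (auto simp: q_def r_def dvd_eq_mod_eq_0)
    show False
    proof (cases "q = 0")
      case True
      then have "Pd s" using PdI that s r by simp
      then show False using least[of s] True s r by simp
    next
      case False
      then have "q * (t + d) \<in> S" "q * t + s \<in> S"
        using mult t that add by auto
      moreover have "q * (t + d) + r = q * t + s" using s by (simp add: algebra_simps)
      ultimately have "Pd r" using r unfolding Pd_def by metis
      then show False using least[of r] r by simp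
    qed
  qed
  have "Gcd S dvd d"
    using Gcd_dvd[OF t(1)] Gcd_dvd[OF t(2)] by (metis dvd_add_right_iff)
  moreover have "d dvd Gcd S" using dvd by (auto intro: Gcd_greatest)
  ultimately have D: "Gcd S = d" by (simp add: dvd_antisym)
  obtain k where k: "t = d * k" using dvd[OF t(1)] by blast
  \<comment> \<open>With \<open>t = d * k\<close> and \<open>n = d * (q * k + r)\<close>,
    \<open>r < k\<close>, one has \<open>n = (q - r) * t + r * (t + d)\<close>. The threshold
    \<open>t * k\<close> forces \<open>q \<ge> k > r\<close>, so that \<open>q - r\<close> is
    positive.\<close>
  have "n \<in> S" if n: "n \<ge> t * k" "d dvd n" for n
  proof -
    obtain m where m: "n = d * m" using n by blast
    have kpos: "k > 0" using k t by (cases k) auto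
    have mk: "m \<ge> k * k" using n(1) d unfolding m k by (simp add: mult.assoc)
    define q r where "q = m div k" and "r = m mod k"
    have qr: "m = q * k + r" "r < k" using kpos by (auto simp: q_def r_def)
    have "q \<ge> k" unfolding q_def using mk kpos
      by (metis div_le_mono nonzero_mult_div_cancel_right not_gr_zero)
    then obtain c where c: "q = r + c" "c > 0" using qr(2)
      by (metis less_imp_add_positive less_le_trans)
    have eq: "n = c * t + r * (t + d)" unfolding m qr k c by (simp add: algebra_simps)
    show ?thesis
    proof (cases "r = 0")
      case True then show ?thesis using eq mult[OF t(1) c(2)] by simp
    next
      case False then show ?thesis using eq mult[OF t(1) c(2)] mult[OF t(2), of r] add by simp
    qed
  qed
  then show ?thesis unfolding D by blast
qed

section \<open>Perron eigenvectors of irreducible relations\<close>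

lemma predecessor_closed_eq:
  assumes irred: "\<And>x y. x \<in> X \<Longrightarrow> y \<in> X \<Longrightarrow> (x, y) \<in> {(a, b). a \<in> X \<and> b \<in> X \<and> S a b}\<^sup>+"
    and A: "A \<subseteq> X" "A \<noteq> {}"
    and closed: "\<And>x y. x \<in> X \<Longrightarrow> y \<in> A \<Longrightarrow> S x y \<Longrightarrow> x \<in> A"
  shows "A = X"
proof -
  obtain y where y: "y \<in> A" using A by blast
  have "x \<in> A" if "x \<in> X" for x
  proof -
    have "(x, y) \<in> {(a, b). a \<in> X \<and> b \<in> X \<and> S a b}\<^sup>+" using irred that y A by blast
    then show "x \<in> A"
      by (induction rule: converse_trancl_induct) (use y closed in auto)
  qed
  then show ?thesis using A by blast
qed

text \<open>Pinning the coordinates outside \<open>X\<close> to 0 makes the simplex a closed subset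
  of a product of compact intervals, so Tychonoff's theorem applies in the function space.\<close>

lemma compact_nonneg_simplex:
  assumes "finite (X :: 'a set)"
  shows "compact {f :: 'a \<Rightarrow> real. (\<forall>x\<in>X. 0 \<le> f x) \<and> (\<forall>x. x \<notin> X \<longrightarrow> f x = 0) \<and> sum f X = 1}"
proof -
  let ?T = "\<lambda>x. if x \<in> X then {0..1::real} else {0}"
  have "compactin (product_topology (\<lambda>_. euclidean) UNIV) (PiE UNIV ?T)"
    by (subst compactin_PiE) auto
  then have c: "compact (PiE UNIV ?T)" by (simp add: euclidean_product_topology)
  have "closed {f :: 'a \<Rightarrow> real. sum f X = 1}"
    by (intro closed_Collect_eq continuous_on_sum continuous_on_const) auto
  then have "compact (PiE UNIV ?T \<inter> {f. sum f X = 1})"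
    by (rule compact_Int_closed[OF c])
  also have "PiE UNIV ?T \<inter> {f. sum f X = 1} =
     {f. (\<forall>x\<in>X. 0 \<le> f x) \<and> (\<forall>x. x \<notin> X \<longrightarrow> f x = 0) \<and> sum f X = 1}" (is "?A = ?B")
  proof
    show "?A \<subseteq> ?B" by (force simp: PiE_def Pi_def split: if_splits)
    show "?B \<subseteq> ?A"
    proof
      fix f assume f: "f \<in> ?B"
      then have "f x \<le> 1" if "x \<in> X" for x
        using member_le_sum[of x X f] that assms by auto
      then show "f \<in> ?A" using f by (auto simp: PiE_def Pi_def)
    qed
  qed
  finally show ?thesis .
qed

text \<open>Collatz-Wielandt argument: \<open>R\<close> is the largest number such that
  \<open>R * f \<le> W f\<close> for some nonzero nonnegative \<open>f\<close>. A strict inequality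
  anywhere could be spread to all of \<open>X\<close> by irreducibility, and then \<open>R\<close>
  could be raised; so the maximizer is an eigenvector.\<close>

theorem perron_eigenvector:
  fixes X :: "'a set" and S :: "'a \<Rightarrow> 'a \<Rightarrow> bool"
  assumes fin: "finite X" and ne: "X \<noteq> {}"
    and irred: "\<And>x y. x \<in> X \<Longrightarrow> y \<in> X \<Longrightarrow> (x, y) \<in> {(a, b). a \<in> X \<and> b \<in> X \<and> S a b}\<^sup>+"
  shows "\<exists>(r::real) u. r > 0 \<and> (\<forall>x\<in>X. u x > 0) \<and> (\<forall>x\<in>X. r * u x = (\<Sum>y\<in>{y\<in>X. S x y}. u y))"
proof -
  define W :: "('a \<Rightarrow> real) \<Rightarrow> 'a \<Rightarrow> real" where "W = (\<lambda>f x. \<Sum>y\<in>{y\<in>X. S x y}. f y)"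
  let ?U = "{f :: 'a \<Rightarrow> real. (\<forall>x\<in>X. 0 \<le> f x) \<and> (\<forall>x. x \<notin> X \<longrightarrow> f x = 0) \<and> sum f X = 1}"
  \<comment> \<open>The interval for \<open>r\<close> is large enough: summing
    \<open>r * f x \<le> W f x\<close> over \<open>X\<close>, with \<open>f\<close> of total mass 1,
    gives \<open>r \<le> card X\<close>. This is checked in \<open>max\<close>.\<close>
  let ?Z = "({0..real (card X)} \<times> ?U) \<inter> (\<Inter>x\<in>X. {z. fst z * snd z x \<le> W (snd z) x})"
  have coord: "continuous_on UNIV (\<lambda>z :: real \<times> ('a \<Rightarrow> real). snd z x)" for x
    by (rule continuous_on_product_then_coordinatewise) (intro continuous_intros)
  have "compact ?Z"
  proof (rule compact_Int_closed)
    show "compact ({0..real (card X)} \<times> ?U)"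
      by (intro compact_Times compact_nonneg_simplex fin) auto
    show "closed (\<Inter>x\<in>X. {z :: real \<times> ('a \<Rightarrow> real). fst z * snd z x \<le> W (snd z) x})"
      unfolding W_def
      by (intro closed_INT ballI closed_Collect_le continuous_on_sum continuous_on_mult coord
          continuous_on_fst continuous_on_id)
  qed
  have W_nonneg: "W f x \<ge> 0" if "\<forall>x\<in>X. 0 \<le> f x" for f x
    unfolding W_def using that by (auto intro: sum_nonneg)
  have "?Z \<noteq> {}"
  proof -
    obtain a where a: "a \<in> X" using ne by blast
    let ?f = "\<lambda>x. if x = a then 1 else 0 :: real"
    have "?f \<in> ?U" using a fin by simp
    moreover have "0 \<le> W ?f x" for x by (rule W_nonneg) simp
    ultimately have mem: "(0, ?f) \<in> ?Z" by simp
    show ?thesis by (rule notI, erule equals0D[THEN notE], rule mem)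
  qed
  then obtain z where z: "z \<in> ?Z" and zmax: "\<And>z'. z' \<in> ?Z \<Longrightarrow> fst z' \<le> fst z"
    by (rule bexE[OF continuous_attains_sup[OF \<open>compact ?Z\<close> _ continuous_on_fst[OF continuous_on_id]]]) simp_all
  define R f0 where "R = fst z" and "f0 = snd z"
  have R0: "R \<ge> 0" and f0: "f0 \<in> ?U" and Rf0: "\<And>x. x \<in> X \<Longrightarrow> R * f0 x \<le> W f0 x"
    using z unfolding R_def f0_def by (simp_all add: mem_Times_iff)
  have max: "r \<le> R"
    if f: "\<And>x. x \<in> X \<Longrightarrow> 0 \<le> f x" "\<exists>x\<in>X. f x \<noteq> 0" and le: "\<And>x. x \<in> X \<Longrightarrow> r * f x \<le> W f x" for f r
  proof (cases "r \<ge> 0")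
    case True
    define s where "s = sum f X"
    have s: "s > 0" unfolding s_def
      using f fin by (metis less_eq_real_def sum_nonneg sum_nonneg_eq_0_iff)
    define g where "g = (\<lambda>x. if x \<in> X then f x / s else 0)"
    have g: "g \<in> ?U" using f s by (auto simp: g_def s_def sum_divide_distrib[symmetric])
    have Wg: "W g x = W f x / s" for x
      unfolding W_def g_def sum_divide_distrib by (rule sum.cong) auto
    have leg: "r * g x \<le> W g x" if "x \<in> X" for x
      using le[OF that] s that unfolding Wg by (simp add: g_def divide_right_mono)
    have "r = (\<Sum>x\<in>X. r * g x)" using g by (simp add: sum_distrib_left[symmetric])
    also have "\<dots> \<le> (\<Sum>x\<in>X. W g x)" using leg by (rule sum_mono)
    also have "\<dots> \<le> (\<Sum>x\<in>X. 1)"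
    proof (rule sum_mono)
      fix x
      have "W g x \<le> sum g X" unfolding W_def by (rule sum_mono2[OF fin]) (use g in auto)
      then show "W g x \<le> 1" using g by simp
    qed
    finally have "(r, g) \<in> {0..real (card X)} \<times> ?U" using True g by simp
    then have "(r, g) \<in> ?Z" using leg by simp
    from zmax[OF this] show ?thesis unfolding R_def by simp
  next
    case False then show ?thesis using R0 by simp
  qed
  define g where "g = (\<lambda>f x. W f x - R * f x)"
  have no_gap: "g f x = 0" if f: "\<And>x. x \<in> X \<Longrightarrow> 0 \<le> f x" and le: "\<And>x. x \<in> X \<Longrightarrow> 0 \<le> g f x"
    and x: "x \<in> X" for f x
  proof (rule ccontr)
    assume nz: "g f x \<noteq> 0"
    define Good where "Good = (\<lambda>f. (\<forall>x\<in>X. 0 \<le> f x) \<and> (\<forall>x\<in>X. 0 \<le> g f x) \<and> (\<exists>x\<in>X. g f x \<noteq> 0))"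
    define pos where "pos = (\<lambda>f. {x \<in> X. g f x > 0})"
    have "Good f" using f le x nz by (auto simp: Good_def)
    moreover have "\<forall>f. Good f \<longrightarrow> card (pos f) \<le> card X"
      using fin by (auto simp: pos_def intro!: card_mono)
    ultimately obtain h where h: "Good h" and hmax: "\<And>f. Good f \<Longrightarrow> card (pos f) \<le> card (pos h)"
      using ex_has_greatest_nat[of Good f "\<lambda>f. card (pos f)" "Suc (card X)"]
      by (auto simp: less_Suc_eq_le)
    \<comment> \<open>Applying the identity plus \<open>W\<close> commutes with \<open>g\<close>, so
      the gap of \<open>h'\<close> is the gap of \<open>h\<close> plus its image under
      \<open>W\<close>. Its support can only grow; as it is already maximal, it is closed under
      predecessors.\<close>
    define h' where "h' = (\<lambda>x. h x + W h x)"
    have Wh': "W h' x = W h x + W (W h) x" for x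
      unfolding h'_def W_def by (simp add: sum.distrib)
    have gh': "g h' x = g h x + W (g h) x" for x
      unfolding g_def Wh' by (simp add: h'_def W_def sum_subtractf sum_distrib_left algebra_simps)
    have hh: "\<And>x. x \<in> X \<Longrightarrow> 0 \<le> h x" "\<And>x. x \<in> X \<Longrightarrow> 0 \<le> g h x" "\<exists>x\<in>X. g h x > 0"
      using h unfolding Good_def by force+
    have Wgh: "W (g h) x \<ge> 0" for x by (rule W_nonneg) (use hh in auto)
    have "Good h'" unfolding Good_def gh'
    proof (intro conjI ballI)
      show "0 \<le> h' x" if "x \<in> X" for x
        using hh(1)[OF that] W_nonneg[of h x] hh(1) by (simp add: h'_def)
      show "0 \<le> g h x + W (g h) x" if "x \<in> X" for x using hh(2)[OF that] Wgh[of x] by simp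
      obtain x where "x \<in> X" "g h x > 0" using hh(3) by blast
      then show "\<exists>x\<in>X. g h x + W (g h) x \<noteq> 0" using Wgh[of x] by (intro bexI[of _ x]) auto
    qed
    then have "card (pos h') \<le> card (pos h)" by (rule hmax)
    moreover have "pos h \<subseteq> pos h'" unfolding pos_def gh' using Wgh by (auto simp: add_pos_nonneg)
    ultimately have eq: "pos h' = pos h"
      using card_seteq[of "pos h'" "pos h"] fin by (simp add: pos_def)
    have "pos h = X"
    proof (rule predecessor_closed_eq[OF irred])
      fix x y assume xy: "x \<in> X" "y \<in> pos h" "S x y"
      have "g h y \<le> W (g h) x" unfolding W_def
        by (rule member_le_sum) (use xy hh fin in \<open>auto simp: pos_def\<close>)
      then have "x \<in> pos h'" using xy hh(2)[of x] by (auto simp: pos_def gh')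
      then show "x \<in> pos h" using eq by simp
    qed (use hh in \<open>auto simp: pos_def\<close>)
    then have gpos: "g h x > 0" if "x \<in> X" for x using that by (auto simp: pos_def)
    \<comment> \<open>Every value of \<open>h\<close> is at most \<open>1 + sum h X\<close>, so
      \<open>e * h\<close> stays below the smallest gap; the summand 1 keeps the denominator
      positive.\<close>
    define e where "e = Min (g h ` X) / (1 + sum h X)"
    have sh: "sum h X \<ge> 0" using hh by (auto intro: sum_nonneg)
    have Mn: "Min (g h ` X) > 0" using fin ne gpos by (subst Min_gr_iff) auto
    have e: "e > 0" unfolding e_def using Mn sh by simp
    have "(R + e) * h x \<le> W h x" if "x \<in> X" for x
    proof -
      have hx: "h x \<le> 1 + sum h X" using member_le_sum[of x X h] that fin hh by fastforce
      have "e * h x \<le> e * (1 + sum h X)" using e hx by (intro mult_left_mono) auto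
      also have "\<dots> = Min (g h ` X)" unfolding e_def using sh by (simp add: add_nonneg_eq_0_iff)
      also have "\<dots> \<le> g h x" using that fin by auto
      finally show ?thesis unfolding g_def by (simp add: algebra_simps)
    qed
    moreover have "\<exists>x\<in>X. h x \<noteq> 0"
    proof (rule ccontr)
      assume "\<not> ?thesis"
      then have "g h x = 0" if "x \<in> X" for x using that by (auto simp: g_def W_def intro!: sum.neutral)
      then show False using hh(3) by auto
    qed
    ultimately have "R + e \<le> R" using max[of h "R + e"] hh(1) by blast
    then show False using e by simp
  qed
  have eig: "R * f0 x = W f0 x" if "x \<in> X" for x
    using no_gap[of f0 x] f0 Rf0 that by (auto simp: g_def)
  have f0n: "\<And>x. x \<in> X \<Longrightarrow> f0 x \<ge> 0" using f0 by auto
  obtain y where y: "y \<in> X" "f0 y > 0"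
  proof -
    have "\<exists>y\<in>X. f0 y \<noteq> 0" using f0 by (metis (mono_tags, lifting) mem_Collect_eq sum.neutral zero_neq_one)
    then show ?thesis using f0n that by (metis less_eq_real_def)
  qed
  have step: "R * f0 x \<ge> f0 y" if "x \<in> X" "y \<in> X" "S x y" for x y
    unfolding eig[OF that(1)] W_def by (rule member_le_sum) (use that f0n fin in auto)
  obtain x where x: "x \<in> X" "S x y"
    using irred[OF y(1) y(1)] by (cases rule: tranclE) auto
  have "R * f0 x > 0" using step[OF x(1) y(1) x(2)] y by simp
  then have Rpos: "R > 0" using f0n[OF x(1)] R0 by (metis less_eq_real_def mult_zero_left)
  have "{x\<in>X. f0 x > 0} = X"
  proof (rule predecessor_closed_eq[OF irred])
    fix x y assume xy: "x \<in> X" "y \<in> {x\<in>X. f0 x > 0}" "S x y"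
    then have "R * f0 x > 0" using step[of x y] by simp
    then show "x \<in> {x\<in>X. f0 x > 0}" using xy Rpos by (simp add: zero_less_mult_iff)
  qed (use y in auto)
  then show ?thesis using Rpos eig unfolding W_def by blast
qed

section \<open>Convergence of powers of finite stochastic kernels\<close>

fun kpow :: "'a set \<Rightarrow> ('a \<Rightarrow> 'a \<Rightarrow> real) \<Rightarrow> nat \<Rightarrow> 'a \<Rightarrow> 'a \<Rightarrow> real" where
  "kpow X P 0 x y = of_bool (x = y)"
| "kpow X P (Suc n) x y = (\<Sum>z\<in>X. P x z * kpow X P n z y)"

lemma weighted_average_bounds:
  fixes w g :: "'a \<Rightarrow> real"
  assumes "\<And>z. z \<in> C \<Longrightarrow> 0 \<le> w z" "sum w C = 1" "\<And>z. z \<in> C \<Longrightarrow> lo \<le> g z" "\<And>z. z \<in> C \<Longrightarrow> g z \<le> hi"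
  shows "lo \<le> (\<Sum>z\<in>C. w z * g z)" "(\<Sum>z\<in>C. w z * g z) \<le> hi"
proof -
  have "lo = (\<Sum>z\<in>C. w z * lo)" "hi = (\<Sum>z\<in>C. w z * hi)"
    using assms(2) by (simp_all add: sum_distrib_right[symmetric])
  moreover have "(\<Sum>z\<in>C. w z * lo) \<le> (\<Sum>z\<in>C. w z * g z)" "(\<Sum>z\<in>C. w z * g z) \<le> (\<Sum>z\<in>C. w z * hi)"
    using assms by (auto intro!: sum_mono mult_left_mono)
  ultimately show "lo \<le> (\<Sum>z\<in>C. w z * g z)" "(\<Sum>z\<in>C. w z * g z) \<le> hi" by simp_all
qed

text \<open>A point of weight at least \<delta> pulls the average below \<open>hi\<close> by that
  fraction of its own deficit. This is what makes oscillations contract.\<close>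

lemma weighted_average_le_mix:
  fixes w g :: "'a \<Rightarrow> real"
  assumes fin: "finite C" and w: "\<And>z. z \<in> C \<Longrightarrow> 0 \<le> w z" "sum w C = 1"
    and g: "\<And>z. z \<in> C \<Longrightarrow> g z \<le> hi" and z0: "z0 \<in> C" "w z0 \<ge> \<delta>"
  shows "(\<Sum>z\<in>C. w z * g z) \<le> hi - \<delta> * (hi - g z0)"
proof -
  have "(\<Sum>z\<in>C. w z * g z) \<le> (\<Sum>z\<in>C. w z * (hi - of_bool (z = z0) * (hi - g z0)))"
    using w g by (intro sum_mono mult_left_mono) (auto simp: of_bool_def)
  also have "\<dots> = hi - w z0 * (hi - g z0)"
  proof -
    have "(\<Sum>z\<in>C. w z * (hi - of_bool (z = z0) * (hi - g z0))) =
       (\<Sum>z\<in>C. w z * hi) - (\<Sum>z\<in>C. if z = z0 then w z0 * (hi - g z0) else 0)"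
      unfolding sum_subtractf[symmetric] by (rule sum.cong) (auto simp: algebra_simps)
    also have "\<dots> = hi - w z0 * (hi - g z0)"
      using fin z0 w(2) by (simp add: sum_distrib_right[symmetric])
    finally show ?thesis .
  qed
  also have "\<dots> \<le> hi - \<delta> * (hi - g z0)"
    using z0 g by (auto intro!: mult_right_mono)
  finally show ?thesis .
qed

locale finite_markov =
  fixes X :: "'a set" and P :: "'a \<Rightarrow> 'a \<Rightarrow> real"
  assumes fin: "finite X"
    and nonneg: "\<And>x y. 0 \<le> P x y"
    and stoch: "\<And>x. x \<in> X \<Longrightarrow> (\<Sum>y\<in>X. P x y) = 1"
    and irred: "\<And>x y. x \<in> X \<Longrightarrow> y \<in> X \<Longrightarrow> \<exists>n. kpow X P n x y > 0"
begin

abbreviation p :: "nat \<Rightarrow> 'a \<Rightarrow> 'a \<Rightarrow> real" where "p \<equiv> kpow X P"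

lemma p_nonneg: "0 \<le> p n x y"
  by (induction n arbitrary: x) (auto intro!: sum_nonneg mult_nonneg_nonneg nonneg)

lemma p_add: "x \<in> X \<Longrightarrow> p (m + n) x y = (\<Sum>z\<in>X. p m x z * p n z y)"
proof (induction m arbitrary: x)
  case 0
  have "(\<Sum>z\<in>X. of_bool (x = z) * p n z y) = (\<Sum>z\<in>X. if x = z then p n x y else 0)"
    by (rule sum.cong) auto
  then show ?case using 0 fin by simp
next
  case (Suc m)
  have "p (Suc m + n) x y = (\<Sum>w\<in>X. P x w * (\<Sum>z\<in>X. p m w z * p n z y))"
    using Suc by simp
  also have "\<dots> = (\<Sum>w\<in>X. \<Sum>z\<in>X. P x w * p m w z * p n z y)"
    by (simp add: sum_distrib_left mult.assoc)
  also have "\<dots> = (\<Sum>z\<in>X. \<Sum>w\<in>X. P x w * p m w z * p n z y)" by (rule sum.swap)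
  finally show ?case by (simp add: sum_distrib_right)
qed

lemma p_sum: "x \<in> X \<Longrightarrow> (\<Sum>y\<in>X. p n x y) = 1"
proof (induction n arbitrary: x)
  case 0
  then show ?case using fin by (simp add: of_bool_def)
next
  case (Suc n)
  have "(\<Sum>y\<in>X. p (Suc n) x y) = (\<Sum>z\<in>X. \<Sum>y\<in>X. P x z * p n z y)" by (simp, rule sum.swap)
  also have "\<dots> = (\<Sum>z\<in>X. P x z)" using Suc by (simp add: sum_distrib_left[symmetric])
  finally show ?case using stoch[OF Suc.prems] by simp
qed

lemma p_le_1: "x \<in> X \<Longrightarrow> y \<in> X \<Longrightarrow> p n x y \<le> 1"
  using member_le_sum[of y X "p n x"] p_sum[of x n] p_nonneg fin by auto

lemma p_pos_add: "x \<in> X \<Longrightarrow> z \<in> X \<Longrightarrow> p m x z > 0 \<Longrightarrow> p n z y > 0 \<Longrightarrow> p (m + n) x y > 0"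
  unfolding p_add using fin
  by (intro sum_pos2[of X z]) (auto intro: mult_nonneg_nonneg p_nonneg)

definition return_times :: "'a \<Rightarrow> nat set" where
  "return_times x = {n. p n x x > 0}"

text \<open>A round trip from \<open>x\<close> through \<open>y\<close> can be made with and without
  the return of length \<open>n\<close> at \<open>y\<close>; both totals are return times of
  \<open>x\<close>, and they differ by \<open>n\<close>.\<close>

lemma Gcd_return_times_dvd:
  assumes "x \<in> X" "y \<in> X" "n \<in> return_times y"
  shows "Gcd (return_times x) dvd n"
proof -
  obtain i j where "p i x y > 0" "p j y x > 0" using irred assms by meson
  moreover from this have "p (n + j) y x > 0"
    using assms p_pos_add[of y y n j x] by (auto simp: return_times_def)
  ultimately have "i + j \<in> return_times x" "i + (n + j) \<in> return_times x"
    using p_pos_add assms unfolding return_times_def by blast+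
  then have "Gcd (return_times x) dvd i + j" "Gcd (return_times x) dvd (i + j) + n"
    by (auto intro!: Gcd_dvd simp: ac_simps)
  then show ?thesis by (metis dvd_add_right_iff)
qed

lemma Gcd_return_times_eq:
  assumes "x \<in> X" "y \<in> X"
  shows "Gcd (return_times x) = Gcd (return_times y)"
  by (intro dvd_antisym Gcd_greatest Gcd_return_times_dvd) (use assms in auto)

text \<open>\<open>irred\<close> admits \<open>n = 0\<close> and so says nothing for equal points. A
  first step of positive probability exists because rows sum to 1, and the way back from it gives a
  positive time.\<close>

lemma return_times_positive:
  assumes "x \<in> X"
  shows "\<exists>n\<in>return_times x. n > 0"
proof -
  obtain y where y: "y \<in> X" "P x y > 0"
    using stoch[OF assms] nonneg
    by (metis less_eq_real_def sum.neutral zero_neq_one)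
  obtain n where n: "p n y x > 0" using irred y assms by blast
  have "p (Suc n) x x > 0"
    using fin y n by (auto intro!: sum_pos2[of X y] mult_nonneg_nonneg nonneg p_nonneg)
  then show ?thesis unfolding return_times_def by blast
qed

lemma Gcd_return_times_pos: "x \<in> X \<Longrightarrow> Gcd (return_times x) > 0"
  using return_times_positive[of x] by (metis Gcd_0_iff bot_nat_0.not_eq_extremum insert_absorb insert_subset singletonD subset_singletonD)

text \<open>Closing both paths by one common way back from \<open>y\<close> to \<open>x\<close>
  produces two return times with the same difference.\<close>

lemma p_pos_cong:
  assumes "x \<in> X" "y \<in> X" "p m x y > 0" "p n x y > 0" "x0 \<in> X"
  shows "m mod Gcd (return_times x0) = n mod Gcd (return_times x0)"
proof -
  obtain j where j: "p j y x > 0" using irred assms by blast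
  then have "m + j \<in> return_times x" "n + j \<in> return_times x"
    using p_pos_add assms unfolding return_times_def by blast+
  then have "Gcd (return_times x0) dvd m + j" "Gcd (return_times x0) dvd n + j"
    using Gcd_return_times_dvd assms by blast+
  then have "(m + j) mod Gcd (return_times x0) = (n + j) mod Gcd (return_times x0)"
    by simp
  then show ?thesis by (metis cong_add_rcancel_nat cong_def)
qed

lemma p_eventually_pos:
  assumes "x \<in> X" "y \<in> X" "p k x y > 0" "Gcd (return_times x) dvd k"
  shows "\<exists>N. \<forall>n\<ge>N. Gcd (return_times x) dvd n \<longrightarrow> p n x y > 0"
proof -
  obtain N where N: "\<And>n. n \<ge> N \<Longrightarrow> Gcd (return_times x) dvd n \<Longrightarrow> n \<in> return_times x"
    using add_closed_contains_multiples_of_Gcd[of "return_times x"] return_times_positive[OF assms(1)]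
      p_pos_add[of x x _ _ x] assms(1) unfolding return_times_def by blast
  have "p n x y > 0" if "n \<ge> N + k" "Gcd (return_times x) dvd n" for n
  proof -
    have "n - k \<in> return_times x" using that assms by (intro N) (auto intro: dvd_diff_nat)
    then have "p (n - k + k) x y > 0" using p_pos_add[of x x "n - k" k y] assms
      by (auto simp: return_times_def)
    then show ?thesis using that by simp
  qed
  then show ?thesis by blast
qed

text \<open>
  On a cyclic class, the oscillation of \<open>x \<mapsto> p (n * D) x y\<close> is nonincreasing in \<open>n\<close> and shrinks by
  a fixed factor over a number of steps after which the class is fully connected.
\<close>

lemma p_limit_on_class:
  assumes y: "y \<in> X"
  defines "D \<equiv> Gcd (return_times y)"
  shows "\<exists>L. \<forall>x\<in>X. (\<exists>k. p k x y > 0 \<and> D dvd k) \<longrightarrow> (\<lambda>n. p (n * D) x y) \<longlonglongrightarrow> L"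
proof -
  define C where "C = {x\<in>X. \<exists>k. p k x y > 0 \<and> D dvd k}"
  have CX: "C \<subseteq> X" and finC: "finite C" using fin by (auto simp: C_def)
  have D: "Gcd (return_times x) = D" if "x \<in> X" for x
    unfolding D_def using Gcd_return_times_eq that y by blast
  have yC: "y \<in> C" unfolding C_def using y by (auto intro: exI[of _ 0])
  \<comment> \<open>A transition to \<open>z\<close> in a multiple of \<open>D\<close> steps can be
    continued to \<open>y\<close>, and the total length must be divisible by \<open>D\<close>; hence
    \<open>z\<close> belongs to the class. The class is therefore stochastic in itself at such
    times.\<close>
  have out: "p k x z = 0" if A: "x \<in> C" "z \<in> X" "z \<notin> C" "D dvd k" for x z k
  proof (rule ccontr)
    assume "p k x z \<noteq> 0"
    then have pk: "p k x z > 0" using p_nonneg[of k x z] by simp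
    obtain i where i: "p i z y > 0" using irred A y by blast
    obtain j where j: "p j x y > 0" "D dvd j" using A by (auto simp: C_def)
    have "p (k + i) x y > 0" using p_pos_add[of x z] pk i A CX by blast
    then have "(k + i) mod D = j mod D" using p_pos_cong[of x y _ j y] j A CX y D_def by blast
    then have "D dvd k + i" using j(2) by (simp add: dvd_eq_mod_eq_0)
    then have "D dvd i" using A(4) by (simp add: dvd_add_right_iff)
    then show False using i A by (auto simp: C_def)
  qed
  have sumC: "(\<Sum>z\<in>C. p k x z * f z) = (\<Sum>z\<in>X. p k x z * f z)" if "x \<in> C" "D dvd k" for x k f
    by (rule sum.mono_neutral_left) (use fin CX out that in auto)
  have sum1: "(\<Sum>z\<in>C. p k x z) = 1" if "x \<in> C" "D dvd k" for x k
    using sumC[OF that, of "\<lambda>_. 1"] p_sum[of x k] that CX by auto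
  have pos: "\<exists>N. \<forall>n\<ge>N. D dvd n \<longrightarrow> p n x z > 0" if A: "x \<in> C" "z \<in> C" for x z
  proof -
    obtain k where k: "p k x z > 0" using irred A CX by blast
    obtain i j where i: "p i x y > 0" "D dvd i" and j: "p j z y > 0" "D dvd j"
      using A by (auto simp: C_def)
    have "p (k + j) x y > 0" using p_pos_add[of x z k j y] k j A CX by blast
    then have "(k + j) mod D = i mod D" using p_pos_cong[of x y _ i y] i A CX y D_def by blast
    then have "D dvd k" using i(2) j(2) by (simp add: dvd_eq_mod_eq_0[symmetric] mod_eq_0_iff_dvd dvd_add_left_iff)
    then show ?thesis using p_eventually_pos[of x z k] k A CX D by auto
  qed
  have "\<exists>N. \<forall>x\<in>C. \<forall>z\<in>C. \<forall>n\<ge>N. D dvd n \<longrightarrow> p n x z > 0"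
  proof -
    have "\<forall>q\<in>C \<times> C. \<exists>N. \<forall>n\<ge>N. D dvd n \<longrightarrow> p n (fst q) (snd q) > 0"
      using pos by auto
    from bchoice[OF this] obtain f
      where f: "\<And>q n. q \<in> C \<times> C \<Longrightarrow> n \<ge> f q \<Longrightarrow> D dvd n \<Longrightarrow> p n (fst q) (snd q) > 0"
      by blast
    have "f q \<le> Max (f ` (C \<times> C))" if "q \<in> C \<times> C" for q
      using that finC by (intro Max_ge) auto
    then have "p n x z > 0" if "x \<in> C" "z \<in> C" "n \<ge> Max (f ` (C \<times> C))" "D dvd n" for x z n
      using f[of "(x, z)" n] that order_trans[OF \<open>\<And>q. q \<in> C \<times> C \<Longrightarrow> f q \<le> Max (f ` (C \<times> C))\<close>[of "(x, z)"]]
      by simp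
    then show ?thesis by blast
  qed
  then obtain N where N: "\<And>x z n. x \<in> C \<Longrightarrow> z \<in> C \<Longrightarrow> n \<ge> N \<Longrightarrow> D dvd n \<Longrightarrow> p n x z > 0" by blast
  have Dpos: "D > 0" unfolding D_def using Gcd_return_times_pos y by blast
  have ND: "N * D \<ge> N" using Dpos by simp
  \<comment> \<open>\<open>N * D\<close> is a multiple of \<open>D\<close> beyond the threshold
    \<open>N\<close>, so after this block of steps all transition probabilities within
    \<open>C\<close> are positive.\<close>
  define \<delta> where "\<delta> = Min ((\<lambda>q. p (N * D) (fst q) (snd q)) ` (C \<times> C))"
  have "\<delta> > 0"
    unfolding \<delta>_def using finC yC N[OF _ _ ND] by (subst Min_gr_iff) auto
  moreover have "p (N * D) x z \<ge> \<delta>" if "x \<in> C" "z \<in> C" for x z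
    unfolding \<delta>_def using that finC by (intro Min_le) (auto intro: image_eqI[where x="(x, z)"])
  ultimately have \<delta>: "\<delta> > 0" "\<And>x z. x \<in> C \<Longrightarrow> z \<in> C \<Longrightarrow> p (N * D) x z \<ge> \<delta>" by blast+
  define g where "g = (\<lambda>n x. p (n * D) x y)"
  define hi lo where "hi = (\<lambda>n. Max (g n ` C))" and "lo = (\<lambda>n. Min (g n ` C))"
  have bd: "lo n \<le> g n x" "g n x \<le> hi n" if "x \<in> C" for n x
    using that finC by (auto simp: hi_def lo_def)
  have att: "\<exists>x\<in>C. g n x = hi n" "\<exists>x\<in>C. g n x = lo n" for n
  proof -
    have "g n ` C \<noteq> {}" "finite (g n ` C)" using finC yC by auto
    then have "hi n \<in> g n ` C" "lo n \<in> g n ` C" unfolding hi_def lo_def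
      by (auto intro!: Max_in Min_in simp del: image_iff)
    then show "\<exists>x\<in>C. g n x = hi n" "\<exists>x\<in>C. g n x = lo n" by (metis imageE)+
  qed
  have rec: "g (m + n) x = (\<Sum>z\<in>C. p (m * D) x z * g n z)" if "x \<in> C" for m n x
    unfolding g_def using p_add[of x "m * D" "n * D" y] sumC[of x "m * D" "\<lambda>z. p (n * D) z y"] that CX
    by (auto simp: algebra_simps)
  have mono: "lo n \<le> g (m + n) x \<and> g (m + n) x \<le> hi n" if "x \<in> C" for m n x
    unfolding rec[OF that]
    by (intro conjI weighted_average_bounds) (use bd p_nonneg sum1 that in auto)
  have hi_dec: "decseq hi" and lo_inc: "incseq lo"
    unfolding decseq_Suc_iff incseq_Suc_iff using att mono[of _ _ 1] by (metis plus_1_eq_Suc)+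
  \<comment> \<open>The row attaining the new maximum gives weight at least \<delta> to a point
    where the old values are minimal.\<close>
  have contr: "hi (N + n) - lo (N + n) \<le> (1 - \<delta>) * (hi n - lo n)" for n
  proof -
    obtain x where x: "x \<in> C" "g (N + n) x = hi (N + n)" using att by blast
    obtain z where z: "z \<in> C" "g n z = lo n" using att by blast
    have "g (N + n) x \<le> hi n - \<delta> * (hi n - g n z)" unfolding rec[OF x(1)]
      by (rule weighted_average_le_mix) (use finC p_nonneg sum1 x z bd \<delta> in auto)
    moreover have "lo n \<le> lo (N + n)" using lo_inc by (simp add: incseqD)
    ultimately show ?thesis using x z by (simp add: algebra_simps)
  qed
  have rng: "0 \<le> g n x" "g n x \<le> 1" if "x \<in> C" for n x
    using that CX p_nonneg p_le_1 y by (auto simp: g_def)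
  have lohi: "lo n \<le> hi n" for n using bd yC order_trans by blast
  obtain h where h: "hi \<longlonglongrightarrow> h"
    using decseq_convergent[OF hi_dec, of 0] att rng by metis
  obtain l where l: "lo \<longlonglongrightarrow> l"
    using incseq_convergent[OF lo_inc, of 1] att rng by metis
  have "(\<lambda>n. hi (N + n) - lo (N + n)) \<longlonglongrightarrow> h - l"
    using h l by (intro tendsto_diff) (auto intro: LIMSEQ_ignore_initial_segment simp: add.commute[of N])
  moreover have "(\<lambda>n. (1 - \<delta>) * (hi n - lo n)) \<longlonglongrightarrow> (1 - \<delta>) * (h - l)"
    using h l by (intro tendsto_intros)
  ultimately have "h - l \<le> (1 - \<delta>) * (h - l)"
    using contr by (intro LIMSEQ_le) auto
  moreover have "l \<le> h" using LIMSEQ_le[OF l h] lohi by blast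
  ultimately have "h = l" using \<delta>(1) by (simp add: algebra_simps mult_le_0_iff)
  have "(\<lambda>n. g n x) \<longlonglongrightarrow> h" if x: "x \<in> C" for x
  proof (rule tendsto_sandwich)
    show "\<forall>\<^sub>F n in sequentially. lo n \<le> g n x" "\<forall>\<^sub>F n in sequentially. g n x \<le> hi n"
      using bd[OF x] by (intro always_eventually allI; simp)+
    show "lo \<longlonglongrightarrow> h" "hi \<longlonglongrightarrow> h" using h l \<open>h = l\<close> by simp_all
  qed
  then show ?thesis unfolding g_def C_def by blast
qed

text \<open>After the first \<open>j\<close> steps only points from which \<open>y\<close> is
  reached in multiples of \<open>D\<close> matter, so the limit at \<open>y\<close> forgets the
  starting point. At times congruent to \<open>j\<close> all mass from \<open>x0\<close> sits in one
  of the \<open>D\<close> cyclic classes; the limits add up to 1 on each class and to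
  \<open>D\<close> in total.\<close>

theorem kpow_limit:
  assumes x0: "x0 \<in> X"
  defines "D \<equiv> Gcd (return_times x0)"
  shows "\<exists>L. (\<forall>x\<in>X. \<forall>y\<in>X. \<forall>j. (\<exists>k. p k x y > 0 \<and> k mod D = j mod D) \<longrightarrow>
           (\<lambda>n. p (n * D + j) x y) \<longlonglongrightarrow> L y) \<and> (\<Sum>y\<in>X. L y) = real D"
proof -
  have D: "Gcd (return_times x) = D" if "x \<in> X" for x
    unfolding D_def using Gcd_return_times_eq that x0 by blast
  have Dpos: "D > 0" unfolding D_def using Gcd_return_times_pos x0 by blast
  have "\<forall>y\<in>X. \<exists>L. \<forall>x\<in>X. (\<exists>k. p k x y > 0 \<and> D dvd k) \<longrightarrow> (\<lambda>n. p (n * D) x y) \<longlonglongrightarrow> L"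
    using p_limit_on_class D by simp
  then obtain L where L: "\<And>x y. y \<in> X \<Longrightarrow> x \<in> X \<Longrightarrow> (\<exists>k. p k x y > 0 \<and> D dvd k) \<Longrightarrow>
      (\<lambda>n. p (n * D) x y) \<longlonglongrightarrow> L y"
    by metis
  have cong: "m mod D = n mod D" if "x \<in> X" "y \<in> X" "p m x y > 0" "p n x y > 0" for x y m n
    unfolding D_def by (rule p_pos_cong) (use that x0 in auto)
  have lim: "(\<lambda>n. p (n * D + j) x y) \<longlonglongrightarrow> L y"
    if x: "x \<in> X" and y: "y \<in> X" and k: "p k x y > 0" "k mod D = j mod D" for x y j k
  proof -
    have t: "(\<lambda>n. p j x z * p (n * D) z y) \<longlonglongrightarrow> p j x z * L y" if z: "z \<in> X" for z
    proof (cases "p j x z = 0")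
      case False
      then have pj: "p j x z > 0" using p_nonneg[of j x z] by simp
      obtain i where i: "p i z y > 0" using irred z y by blast
      have "p (j + i) x y > 0" using p_pos_add[of x z] pj i x z by blast
      then have "(j + i) mod D = (j + 0) mod D" using cong[OF x y _ k(1)] k(2) by simp
      then have "D dvd i" by (metis cong_add_lcancel_nat cong_def cong_0_iff)
      then show ?thesis using L[OF y z] i by (intro tendsto_mult tendsto_const) blast
    qed simp
    have "(\<lambda>n. \<Sum>z\<in>X. p j x z * p (n * D) z y) \<longlonglongrightarrow> (\<Sum>z\<in>X. p j x z * L y)"
      by (intro tendsto_sum t)
    also have "(\<Sum>z\<in>X. p j x z * L y) = L y" using p_sum[OF x] by (simp add: sum_distrib_right[symmetric])
    finally show ?thesis unfolding add.commute[of _ j] p_add[OF x] .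
  qed
  have zero: "p n x y = 0" if "x \<in> X" "y \<in> X" "p k x y > 0" "k mod D \<noteq> n mod D" for x y k n
    using cong[OF that(1,2,3), of n] that(4) p_nonneg[of n x y] by force
  \<comment> \<open>The number of the cyclic class of \<open>y\<close>, counted from
    \<open>x0\<close>; by \<open>cong\<close> it does not depend on the path length that is
    chosen.\<close>
  define c where "c = (\<lambda>y. (SOME k. p k x0 y > 0) mod D)"
  have c: "\<exists>k. p k x0 y > 0 \<and> k mod D = c y" if "y \<in> X" for y
    unfolding c_def using someI_ex[OF irred[OF x0 that]] by blast
  have one: "(\<Sum>y\<in>X. if c y = j then L y else 0) = 1" if j: "j < D" for j
  proof -
    have "(\<lambda>n. \<Sum>y\<in>X. p (n * D + j) x0 y) \<longlonglongrightarrow> (\<Sum>y\<in>X. if c y = j then L y else 0)"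
    proof (rule tendsto_sum)
      fix y assume y: "y \<in> X"
      obtain k where k: "p k x0 y > 0" "k mod D = c y" using c[OF y] by blast
      show "(\<lambda>n. p (n * D + j) x0 y) \<longlonglongrightarrow> (if c y = j then L y else 0)"
      proof (cases "c y = j")
        case True
        then show ?thesis using lim[OF x0 y k(1), of j] k(2) j by simp
      next
        case False
        then have "p (n * D + j) x0 y = 0" for n using zero[OF x0 y k(1)] k(2) j by simp
        then show ?thesis using False by simp
      qed
    qed
    then show ?thesis using p_sum[OF x0] by (simp add: LIMSEQ_const_iff)
  qed
  have "(\<Sum>y\<in>X. L y) = (\<Sum>y\<in>X. \<Sum>j<D. if c y = j then L y else 0)"
  proof (rule sum.cong)
    fix y assume "y \<in> X"
    then have "c y < D" using c Dpos by (metis mod_less_divisor)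
    then show "L y = (\<Sum>j<D. if c y = j then L y else 0)" by simp
  qed simp
  also have "\<dots> = (\<Sum>j<D. \<Sum>y\<in>X. if c y = j then L y else 0)" by (rule sum.swap)
  also have "\<dots> = real D" using one by simp
  finally show ?thesis using lim by blast
qed

end

section \<open>Closed walks with voltages\<close>

text \<open>The list consists of the vertices that the walk leaves, so its length is the number of steps.\<close>

fun walk_via :: "('a \<Rightarrow> 'a \<Rightarrow> bool) \<Rightarrow> 'a \<Rightarrow> 'a list \<Rightarrow> 'a \<Rightarrow> bool" where
  "walk_via S x [] y \<longleftrightarrow> x = y"
| "walk_via S x (a # p) y \<longleftrightarrow> a = x \<and> (\<exists>z. S x z \<and> walk_via S z p y)"

lemma walk_via_append:
  "walk_via S x (p @ q) y \<longleftrightarrow> (\<exists>z. walk_via S x p z \<and> walk_via S z q y)"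
  by (induction p arbitrary: x) auto

lemma walk_via_start: "walk_via S z p y \<Longrightarrow> z = hd (p @ [y])"
  by (cases p) auto

lemma walk_via_iff_successively:
  "p \<noteq> [] \<Longrightarrow> walk_via S x p y \<longleftrightarrow> hd p = x \<and> successively S p \<and> S (last p) y"
proof (induction p arbitrary: x)
  case (Cons a p)
  then show ?case by (cases p) auto
qed simp

lemma walk_via_subset:
  assumes "\<And>x y. S x y \<Longrightarrow> x \<in> X" "walk_via S x p y"
  shows "set p \<subseteq> X"
  using assms(2) by (induction p arbitrary: x) (use assms(1) in auto)

lemma walk_via_trancl:
  "(\<exists>p. p \<noteq> [] \<and> walk_via S x p y) \<longleftrightarrow> S\<^sup>+\<^sup>+ x y"
proof
  assume "\<exists>p. p \<noteq> [] \<and> walk_via S x p y"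
  then obtain p where "p \<noteq> []" "walk_via S x p y" by blast
  then show "S\<^sup>+\<^sup>+ x y"
  proof (induction p arbitrary: x)
    case (Cons a p)
    then obtain z where z: "S x z" "walk_via S z p y" by auto
    then show ?case using Cons.IH[of z] by (cases "p = []") (auto intro: tranclp_into_tranclp2)
  qed simp
next
  assume "S\<^sup>+\<^sup>+ x y"
  then show "\<exists>p. p \<noteq> [] \<and> walk_via S x p y"
  proof (induction rule: converse_tranclp_induct)
    case (base x)
    then show ?case by (intro exI[of _ "[x]"]) auto
  next
    case (step x z)
    then obtain p where "walk_via S z p y" by blast
    then show ?case using step by (intro exI[of _ "x # p"]) auto
  qed
qed

text \<open>A voltage graph in which a step is labelled by the vertex it leaves.
  \<open>transitive\<close> says that the derived cover, with vertex set
  \<open>X \<times> carrier Q\<close>, is strongly connected. The Perron data live on the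
  base.\<close>

locale voltage_digraph = Q: comm_group Q
  for X :: "'a set" and S :: "'a \<Rightarrow> 'a \<Rightarrow> bool" and Q :: "('q, 'm) monoid_scheme" and \<kappa> :: "'a \<Rightarrow> 'q"
    and r :: real and u :: "'a \<Rightarrow> real" +
  assumes finX: "finite X" and S_closed: "\<And>x y. S x y \<Longrightarrow> x \<in> X \<and> y \<in> X"
    and finQ: "finite (carrier Q)" and volt_closed: "\<And>x. x \<in> X \<Longrightarrow> \<kappa> x \<in> carrier Q"
    and r_pos: "r > 0" and u_pos: "\<And>x. x \<in> X \<Longrightarrow> u x > 0"
    and eigen: "\<And>x. x \<in> X \<Longrightarrow> r * u x = (\<Sum>y\<in>{y\<in>X. S x y}. u y)"
    and transitive: "\<And>x y q. x \<in> X \<Longrightarrow> y \<in> X \<Longrightarrow> q \<in> carrier Q \<Longrightarrow>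
       \<exists>p. walk_via S x p y \<and> foldr (\<lambda>a b. \<kappa> a \<otimes>\<^bsub>Q\<^esub> b) p \<one>\<^bsub>Q\<^esub> = q"
begin

definition volt :: "'a list \<Rightarrow> 'q" where
  "volt p = foldr (\<lambda>a b. \<kappa> a \<otimes>\<^bsub>Q\<^esub> b) p \<one>\<^bsub>Q\<^esub>"

lemma volt_simps [simp]: "volt [] = \<one>\<^bsub>Q\<^esub>" "volt (a # p) = \<kappa> a \<otimes>\<^bsub>Q\<^esub> volt p"
  by (simp_all add: volt_def)

lemma volt_in_carrier: "set p \<subseteq> X \<Longrightarrow> volt p \<in> carrier Q"
  by (induction p) (auto intro: volt_closed)

lemma walk_in: "walk_via S x p y \<Longrightarrow> set p \<subseteq> X"
  using walk_via_subset[of S X] S_closed by blast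

definition count_walks :: "nat \<Rightarrow> 'a \<Rightarrow> 'q \<Rightarrow> 'a \<Rightarrow> nat" where
  "count_walks n x q y = card {p. length p = n \<and> walk_via S x p y \<and> volt p = q}"

lemma finite_walks: "finite {p. length p = n \<and> walk_via S x p y \<and> R p}"
  by (rule finite_subset[OF _ finite_lists_length_eq[OF finX, of n]]) (use walk_in in auto)

abbreviation cover :: "('a \<times> 'q) set" where "cover \<equiv> X \<times> carrier Q"

text \<open>The Doob transform of the adjacency relation of the cover by the pulled back Perron
  vector. Along a path the values of \<open>u\<close> telescope, so all walks of length
  \<open>n\<close> from \<open>x\<close> to \<open>y\<close> carry the same weight
  \<open>u y / (r ^ n * u x)\<close>.\<close>

definition kernel :: "'a \<times> 'q \<Rightarrow> 'a \<times> 'q \<Rightarrow> real" where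
  "kernel s t = (if S (fst s) (fst t) \<and> snd t = snd s \<otimes>\<^bsub>Q\<^esub> \<kappa> (fst s)
     then u (fst t) / (r * u (fst s)) else 0)"

lemma sum_kernel:
  assumes "x \<in> X" "q \<in> carrier Q"
  shows "(\<Sum>t\<in>cover. kernel (x, q) t * f t) =
    (\<Sum>z\<in>{z\<in>X. S x z}. u z / (r * u x) * f (z, q \<otimes>\<^bsub>Q\<^esub> \<kappa> x))"
proof -
  have "(\<Sum>t\<in>cover. kernel (x, q) t * f t) = (\<Sum>z\<in>X. \<Sum>s\<in>carrier Q. kernel (x, q) (z, s) * f (z, s))"
    by (simp add: sum.cartesian_product)
  also have "\<dots> = (\<Sum>z\<in>X. if S x z then u z / (r * u x) * f (z, q \<otimes>\<^bsub>Q\<^esub> \<kappa> x) else 0)"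
  proof (rule sum.cong)
    fix z assume "z \<in> X"
    have "(\<Sum>s\<in>carrier Q. kernel (x, q) (z, s) * f (z, s)) =
      (\<Sum>s\<in>carrier Q. if s = q \<otimes>\<^bsub>Q\<^esub> \<kappa> x then (if S x z then u z / (r * u x) * f (z, s) else 0) else 0)"
      by (rule sum.cong) (auto simp: kernel_def)
    then show "(\<Sum>s\<in>carrier Q. kernel (x, q) (z, s) * f (z, s)) =
      (if S x z then u z / (r * u x) * f (z, q \<otimes>\<^bsub>Q\<^esub> \<kappa> x) else 0)"
      using assms volt_closed finQ by (simp add: sum.delta)
  qed simp
  also have "\<dots> = (\<Sum>z\<in>{z\<in>X. S x z}. u z / (r * u x) * f (z, q \<otimes>\<^bsub>Q\<^esub> \<kappa> x))"
    by (rule sum.inter_filter[OF finX, symmetric])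
  finally show ?thesis .
qed

lemma kpow_kernel:
  assumes "x \<in> X" "q \<in> carrier Q"
  shows "kpow cover kernel n (x, q) (y, q') =
    u y / (r ^ n * u x) * real (card {p. length p = n \<and> walk_via S x p y \<and> q \<otimes>\<^bsub>Q\<^esub> volt p = q'})"
  using assms
proof (induction n arbitrary: x q)
  case 0
  have "{p. length p = 0 \<and> walk_via S x p y \<and> q \<otimes>\<^bsub>Q\<^esub> volt p = q'} = (if x = y \<and> q = q' then {[]} else {})"
    using 0 by auto
  then have "card {p. length p = 0 \<and> walk_via S x p y \<and> q \<otimes>\<^bsub>Q\<^esub> volt p = q'} = (if x = y \<and> q = q' then 1 else 0)"
    by (simp only: if_distrib[of card] card.empty card_1_singleton_iff) simp
  moreover have "u x \<noteq> 0" using u_pos[OF 0(1)] by simp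
  ultimately show ?case by (cases "x = y \<and> q = q'") (simp_all only: kpow.simps, auto)
next
  case (Suc n)
  let ?A = "\<lambda>z. {p. length p = n \<and> walk_via S z p y \<and> (q \<otimes>\<^bsub>Q\<^esub> \<kappa> x) \<otimes>\<^bsub>Q\<^esub> volt p = q'}"
  have assoc: "(q \<otimes>\<^bsub>Q\<^esub> \<kappa> x) \<otimes>\<^bsub>Q\<^esub> volt p = q \<otimes>\<^bsub>Q\<^esub> (\<kappa> x \<otimes>\<^bsub>Q\<^esub> volt p)"
    if "walk_via S z p y" for z p
    using Q.m_assoc Suc.prems volt_closed volt_in_carrier walk_in[OF that] by blast
  have "{p. length p = Suc n \<and> walk_via S x p y \<and> q \<otimes>\<^bsub>Q\<^esub> volt p = q'} =
      (\<Union>z\<in>{z\<in>X. S x z}. (#) x ` ?A z)" (is "?L = ?R")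
  proof
    show "?L \<subseteq> ?R"
    proof
      fix p assume "p \<in> ?L"
      then obtain p' z where p: "p = x # p'" "length p' = n" "S x z" "walk_via S z p' y"
        "q \<otimes>\<^bsub>Q\<^esub> (\<kappa> x \<otimes>\<^bsub>Q\<^esub> volt p') = q'"
        by (cases p) auto
      then show "p \<in> ?R" using S_closed[OF p(3)] assoc[OF p(4)] by auto
    qed
    show "?R \<subseteq> ?L" using assoc by auto
  qed
  moreover have "card (\<Union>z\<in>{z\<in>X. S x z}. (#) x ` ?A z) = (\<Sum>z\<in>{z\<in>X. S x z}. card ((#) x ` ?A z))"
  proof (rule card_UN_disjoint)
    show "\<forall>i\<in>{z \<in> X. S x z}. \<forall>j\<in>{z \<in> X. S x z}. i \<noteq> j \<longrightarrow> (#) x ` ?A i \<inter> (#) x ` ?A j = {}"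
    proof (intro ballI impI)
      fix i j :: 'a assume ij: "i \<noteq> j"
      show "(#) x ` ?A i \<inter> (#) x ` ?A j = {}"
      proof (rule ccontr)
        assume "(#) x ` ?A i \<inter> (#) x ` ?A j \<noteq> {}"
        then obtain p where "walk_via S i p y" "walk_via S j p y" by blast
        then show False using ij walk_via_start by metis
      qed
    qed
  qed (use finX finite_walks in auto)
  moreover have "card ((#) x ` ?A z) = card (?A z)" for z
    by (rule card_image) auto
  ultimately have card: "card {p. length p = Suc n \<and> walk_via S x p y \<and> q \<otimes>\<^bsub>Q\<^esub> volt p = q'} =
      (\<Sum>z\<in>{z\<in>X. S x z}. card (?A z))" by simp
  have "kpow cover kernel (Suc n) (x, q) (y, q') =
      (\<Sum>z\<in>{z\<in>X. S x z}. u z / (r * u x) * kpow cover kernel n (z, q \<otimes>\<^bsub>Q\<^esub> \<kappa> x) (y, q'))"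
    using sum_kernel[OF Suc.prems] by simp
  also have "\<dots> = (\<Sum>z\<in>{z\<in>X. S x z}. u y / (r ^ Suc n * u x) * real (card (?A z)))"
  proof (rule sum.cong)
    fix z assume z: "z \<in> {z\<in>X. S x z}"
    then have "u z \<noteq> 0" using u_pos[of z] by auto
    moreover have "kpow cover kernel n (z, q \<otimes>\<^bsub>Q\<^esub> \<kappa> x) (y, q') = u y / (r ^ n * u z) * real (card (?A z))"
      using Suc.IH[of z "q \<otimes>\<^bsub>Q\<^esub> \<kappa> x"] z Suc.prems volt_closed by auto
    ultimately show "u z / (r * u x) * kpow cover kernel n (z, q \<otimes>\<^bsub>Q\<^esub> \<kappa> x) (y, q') =
      u y / (r ^ Suc n * u x) * real (card (?A z))" by (simp add: field_simps)
  qed simp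
  finally show ?case unfolding card by (simp add: sum_distrib_left)
qed

lemma kpow_kernel_count:
  assumes "x \<in> X" "q \<in> carrier Q" "q' \<in> carrier Q"
  shows "kpow cover kernel n (x, q) (y, q \<otimes>\<^bsub>Q\<^esub> q') = u y / (r ^ n * u x) * real (count_walks n x q' y)"
proof -
  have "q \<otimes>\<^bsub>Q\<^esub> volt p = q \<otimes>\<^bsub>Q\<^esub> q' \<longleftrightarrow> volt p = q'" if "walk_via S x p y" for p
    using assms volt_in_carrier[OF walk_in[OF that]] by simp
  then have "{p. length p = n \<and> walk_via S x p y \<and> q \<otimes>\<^bsub>Q\<^esub> volt p = q \<otimes>\<^bsub>Q\<^esub> q'} =
      {p. length p = n \<and> walk_via S x p y \<and> volt p = q'}" by blast
  then show ?thesis using kpow_kernel[OF assms(1,2)] by (simp add: count_walks_def)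
qed

lemma count_walks_pos: "count_walks n x q y > 0 \<longleftrightarrow> (\<exists>p. length p = n \<and> walk_via S x p y \<and> volt p = q)"
  unfolding count_walks_def by (subst card_gt_0_iff) (use finite_walks in auto)

lemma kpow_kernel_pos:
  assumes "x \<in> X" "y \<in> X" "q \<in> carrier Q" "q' \<in> carrier Q"
  shows "kpow cover kernel n (x, q) (y, q \<otimes>\<^bsub>Q\<^esub> q') > 0 \<longleftrightarrow>
    (\<exists>p. length p = n \<and> walk_via S x p y \<and> volt p = q')"
proof -
  have "0 < c * real k \<longleftrightarrow> 0 < k" if "c > 0" for c :: real and k
    using that by (simp add: zero_less_mult_iff)
  moreover have "u y / (r ^ n * u x) > 0" using assms u_pos r_pos by simp
  ultimately show ?thesis unfolding kpow_kernel_count[OF assms(1,3,4)] count_walks_pos[symmetric] .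
qed

sublocale markov: finite_markov cover kernel
proof
  show "finite cover" using finX finQ by blast
  show "0 \<le> kernel s t" for s t
  proof (cases "S (fst s) (fst t)")
    case True
    then have "0 \<le> u (fst t) / (r * u (fst s))" using S_closed u_pos r_pos
      by (intro divide_nonneg_pos mult_pos_pos) (auto intro: less_imp_le)
    then show ?thesis by (simp add: kernel_def)
  qed (simp add: kernel_def)
  show "(\<Sum>t\<in>cover. kernel s t) = 1" if "s \<in> cover" for s
  proof -
    obtain x q where s: "s = (x, q)" "x \<in> X" "q \<in> carrier Q" using \<open>s \<in> cover\<close> by blast
    have "(\<Sum>t\<in>cover. kernel s t) = (\<Sum>z\<in>{z\<in>X. S x z}. u z / (r * u x))"
      using sum_kernel[OF s(2,3), of "\<lambda>_. 1"] s by simp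
    also have "\<dots> = 1"
      unfolding sum_divide_distrib[symmetric] eigen[OF s(2), symmetric] using u_pos[OF s(2)] r_pos by simp
    finally show ?thesis .
  qed
  show "\<exists>n. kpow cover kernel n s t > 0" if st: "s \<in> cover" "t \<in> cover" for s t
  proof -
    obtain x q y q' where s: "s = (x, q)" "x \<in> X" "q \<in> carrier Q" and t: "t = (y, q')" "y \<in> X" "q' \<in> carrier Q"
      using st by blast
    define d where "d = inv\<^bsub>Q\<^esub> q \<otimes>\<^bsub>Q\<^esub> q'"
    have d: "d \<in> carrier Q" "q \<otimes>\<^bsub>Q\<^esub> d = q'"
      using s t by (auto simp: d_def Q.m_assoc[symmetric])
    show ?thesis using kpow_kernel_pos[OF s(2) t(2) s(3) d(1)] transitive[OF s(2) t(2) d(1)] d(2) s(1) t(1)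
      by (auto simp: volt_def)
  qed
qed

definition null_return_times :: "'a \<Rightarrow> nat set" where
  "null_return_times x = {n. \<exists>p. length p = n \<and> walk_via S x p x \<and> volt p = \<one>\<^bsub>Q\<^esub>}"

lemma return_times_eq: "x \<in> X \<Longrightarrow> markov.return_times (x, \<one>\<^bsub>Q\<^esub>) = null_return_times x"
  unfolding markov.return_times_def null_return_times_def
  using kpow_kernel_pos[of x x "\<one>\<^bsub>Q\<^esub>" "\<one>\<^bsub>Q\<^esub>"] by auto

lemma Gcd_null_return_times_pos: "x \<in> X \<Longrightarrow> Gcd (null_return_times x) > 0"
  using markov.Gcd_return_times_pos[of "(x, \<one>\<^bsub>Q\<^esub>)"] return_times_eq by simp

lemma Gcd_null_return_times_dvd:
  assumes "x0 \<in> X" "x \<in> X" "walk_via S x p x" "volt p = \<one>\<^bsub>Q\<^esub>"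
  shows "Gcd (null_return_times x0) dvd length p"
  using markov.Gcd_return_times_dvd[of "(x0, \<one>\<^bsub>Q\<^esub>)" "(x, \<one>\<^bsub>Q\<^esub>)" "length p"] assms
  by (auto simp: return_times_eq null_return_times_def)

lemma walk_lengths_cong:
  assumes "x0 \<in> X" "x \<in> X" "y \<in> X" "walk_via S x p y" "walk_via S x p' y" "volt p = volt p'"
  shows "length p mod Gcd (null_return_times x0) = length p' mod Gcd (null_return_times x0)"
proof -
  have v: "volt p \<in> carrier Q" using volt_in_carrier walk_in assms by blast
  have "kpow cover kernel (length p) (x, \<one>\<^bsub>Q\<^esub>) (y, \<one>\<^bsub>Q\<^esub> \<otimes>\<^bsub>Q\<^esub> volt p) > 0"
    using kpow_kernel_pos[OF assms(2,3) Q.one_closed v] assms(4) by blast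
  moreover have "kpow cover kernel (length p') (x, \<one>\<^bsub>Q\<^esub>) (y, \<one>\<^bsub>Q\<^esub> \<otimes>\<^bsub>Q\<^esub> volt p) > 0"
    using kpow_kernel_pos[OF assms(2,3) Q.one_closed v] assms(5,6) by metis
  moreover have "\<one>\<^bsub>Q\<^esub> \<otimes>\<^bsub>Q\<^esub> volt p = volt p" using v by (rule Q.l_one)
  ultimately have pos: "kpow cover kernel (length p) (x, \<one>\<^bsub>Q\<^esub>) (y, volt p) > 0"
    "kpow cover kernel (length p') (x, \<one>\<^bsub>Q\<^esub>) (y, volt p) > 0" by simp_all
  have "(x, \<one>\<^bsub>Q\<^esub>) \<in> cover" "(y, volt p) \<in> cover" "(x0, \<one>\<^bsub>Q\<^esub>) \<in> cover" using assms(1-3) v by simp_all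
  from markov.p_pos_cong[OF this(1,2) pos this(3)] show ?thesis
    unfolding return_times_eq[OF assms(1)] .
qed

text \<open>For closed walks the values of \<open>u\<close> cancel: the count divided by
  \<open>r ^ n\<close> is exactly the transition probability from \<open>(x, \<one>)\<close> to
  \<open>(x, \<alpha>)\<close>. The assumption \<open>cls\<close> places every such pair in the
  phase \<open>j\<close>, so the limit theorem applies to all of them at once.\<close>

theorem closed_walk_count_limit:
  assumes x0: "x0 \<in> X" and \<alpha>: "\<alpha> \<in> carrier Q"
  defines "D \<equiv> Gcd (null_return_times x0)"
  assumes cls: "\<And>x. x \<in> X \<Longrightarrow> \<exists>p. walk_via S x p x \<and> volt p = \<alpha> \<and> length p mod D = j mod D"
  shows "(\<lambda>n. (\<Sum>x\<in>X. real (count_walks (n * D + j) x \<alpha> x)) / r ^ (n * D + j))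
    \<longlonglongrightarrow> real D / real (card (carrier Q))"
proof -
  have x01: "(x0, \<one>\<^bsub>Q\<^esub>) \<in> cover" using x0 by simp
  obtain L where L: "\<And>s t j k. s \<in> cover \<Longrightarrow> t \<in> cover \<Longrightarrow> kpow cover kernel k s t > 0 \<Longrightarrow> k mod D = j mod D \<Longrightarrow>
      (\<lambda>n. kpow cover kernel (n * D + j) s t) \<longlonglongrightarrow> L t" and sumL: "(\<Sum>t\<in>cover. L t) = real D"
    using markov.kpow_limit[OF x01] return_times_eq[OF x0] unfolding D_def by metis
  have kp: "kpow cover kernel n (x, q) (x, q \<otimes>\<^bsub>Q\<^esub> q') = real (count_walks n x q' x) / r ^ n"
    if "x \<in> X" "q \<in> carrier Q" "q' \<in> carrier Q" for x q q' n
    using kpow_kernel_count[OF that, of n x] u_pos[OF that(1)] by simp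
  \<comment> \<open>Invariance under the deck group: the return probability to \<open>(x, q)\<close>
    counts closed walks of trivial voltage at \<open>x\<close>, whatever \<open>q\<close>
    is.\<close>
  have L_eq: "L (x, q) = L (x, \<one>\<^bsub>Q\<^esub>)" if x: "x \<in> X" and q: "q \<in> carrier Q" for x q
  proof -
    have *: "(\<lambda>n. real (count_walks (n * D) x \<one>\<^bsub>Q\<^esub> x) / r ^ (n * D)) \<longlonglongrightarrow> L (x, q)"
      if q: "q \<in> carrier Q" for q
      using L[of "(x, q)" "(x, q)" 0 0] kp[OF x q, of "\<one>\<^bsub>Q\<^esub>"] x q by simp
    show ?thesis using LIMSEQ_unique *[OF q] *[of "\<one>\<^bsub>Q\<^esub>"] by blast
  qed
  have "(\<lambda>n. \<Sum>x\<in>X. real (count_walks (n * D + j) x \<alpha> x) / r ^ (n * D + j)) \<longlonglongrightarrow> (\<Sum>x\<in>X. L (x, \<alpha>))"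
  proof (rule tendsto_sum)
    fix x assume x: "x \<in> X"
    obtain p where p: "walk_via S x p x" "volt p = \<alpha>" "length p mod D = j mod D" using cls[OF x] by blast
    have one: "\<one>\<^bsub>Q\<^esub> \<otimes>\<^bsub>Q\<^esub> \<alpha> = \<alpha>" using \<alpha> by (rule Q.l_one)
    have "kpow cover kernel (length p) (x, \<one>\<^bsub>Q\<^esub>) (x, \<alpha>) > 0"
      using kpow_kernel_pos[OF x x Q.one_closed \<alpha>] p unfolding one by blast
    from L[OF _ _ this p(3)] x \<alpha>
    show "(\<lambda>n. real (count_walks (n * D + j) x \<alpha> x) / r ^ (n * D + j)) \<longlonglongrightarrow> L (x, \<alpha>)"
      using kp[OF x Q.one_closed \<alpha>] unfolding one by simp
  qed
  also have "(\<Sum>x\<in>X. L (x, \<alpha>)) = real D / real (card (carrier Q))"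
  proof -
    have "real D = (\<Sum>x\<in>X. \<Sum>q\<in>carrier Q. L (x, q))" using sumL by (simp add: sum.cartesian_product)
    also have "\<dots> = (\<Sum>x\<in>X. real (card (carrier Q)) * L (x, \<alpha>))"
    proof (rule sum.cong)
      fix x assume x: "x \<in> X"
      have "(\<Sum>q\<in>carrier Q. L (x, q)) = (\<Sum>q\<in>carrier Q. L (x, \<alpha>))"
        by (rule sum.cong) (simp_all only: L_eq[OF x] L_eq[OF x \<alpha>])
      then show "(\<Sum>q\<in>carrier Q. L (x, q)) = real (card (carrier Q)) * L (x, \<alpha>)" by simp
    qed simp
    finally have "real D = real (card (carrier Q)) * (\<Sum>x\<in>X. L (x, \<alpha>))" by (simp add: sum_distrib_left)
    moreover have "card (carrier Q) \<noteq> 0" using finQ Q.one_closed by auto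
    ultimately show ?thesis by simp
  qed
  finally show ?thesis by (simp add: sum_divide_distrib)
qed

end

section \<open>Eigenvalues of maximal modulus\<close>

text \<open>Without a cycle the converse relation would be well-founded, giving an element without
  successor. Later this finds cycles in supports of eigenfunctions, in reachable sets and in
  supports of flows.\<close>

lemma serial_on_finite_has_cycle:
  assumes "finite A" "A \<noteq> {}" "\<And>a. a \<in> A \<Longrightarrow> \<exists>b\<in>A. S a b"
  shows "\<exists>a\<in>A. S\<^sup>+\<^sup>+ a a"
proof (rule ccontr)
  assume no: "\<not> ?thesis"
  define R where "R = {(a, b). a \<in> A \<and> b \<in> A \<and> S a b}"
  have tr: "(a, b) \<in> R\<^sup>+ \<Longrightarrow> a \<in> A \<and> S\<^sup>+\<^sup>+ a b" for a b
    by (induction rule: trancl_induct) (auto simp: R_def intro: tranclp.trancl_into_trancl)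
  then have "acyclic R" using no by (auto simp: acyclic_def)
  moreover have "finite R" by (rule finite_subset[of _ "A \<times> A"]) (use assms in \<open>auto simp: R_def\<close>)
  ultimately have wfR: "wf (R\<inverse>)" by (rule finite_acyclic_wf_converse[rotated])
  obtain a0 where a0: "a0 \<in> A" using assms(2) by blast
  have "\<exists>a\<in>A. \<forall>b. (b, a) \<in> R\<inverse> \<longrightarrow> b \<notin> A"
    by (rule wfE_min[OF wfR a0], rule bexI) simp_all
  then obtain a where a: "a \<in> A" "\<forall>b. (b, a) \<in> R\<inverse> \<longrightarrow> b \<notin> A" ..
  obtain b where b: "b \<in> A" "S a b" using assms(3)[OF a(1)] ..
  then have "(b, a) \<in> R\<inverse>" unfolding R_def using a(1) by blast
  then show False using a(2) b(1) by iprover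
qed

text \<open>Equality case of the triangle inequality: after multiplication by \<open>cnj m\<close> a
  weighted mean of points of real part at most 1 equals 1, so each of them is 1.\<close>

lemma weighted_sum_unit_disc_extremal:
  fixes w :: "'a \<Rightarrow> complex" and t :: "'a \<Rightarrow> real"
  assumes fin: "finite B" and t: "\<And>b. b \<in> B \<Longrightarrow> t b > 0" and w: "\<And>b. b \<in> B \<Longrightarrow> cmod (w b) \<le> 1"
    and m: "cmod m = 1" and eq: "(\<Sum>b\<in>B. of_real (t b) * w b) = of_real (sum t B) * m" and b: "b \<in> B"
  shows "w b = m"
proof -
  define z where "z = (\<lambda>b. cnj m * w b)"
  have mm: "m * cnj m = 1" using m complex_norm_square[of m] by simp
  have cz: "cmod (z b) \<le> 1" if "b \<in> B" for b using w[OF that] m by (simp add: z_def norm_mult)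
  have Re_le: "Re (z b) \<le> 1" if "b \<in> B" for b
    using cz[OF that] complex_Re_le_cmod[of "z b"] by linarith
  have "(\<Sum>b\<in>B. of_real (t b) * z b) = cnj m * (\<Sum>b\<in>B. of_real (t b) * w b)"
    by (simp add: z_def sum_distrib_left algebra_simps)
  also have "\<dots> = of_real (sum t B)" unfolding eq using mm by (simp add: algebra_simps)
  finally have "Re (\<Sum>b\<in>B. of_real (t b) * z b) = sum t B" by simp
  then have "(\<Sum>b\<in>B. t b * (1 - Re (z b))) = 0" by (simp add: algebra_simps sum_subtractf)
  then have "t b * (1 - Re (z b)) = 0"
    using fin b t Re_le by (subst (asm) sum_nonneg_eq_0_iff) (auto intro!: mult_nonneg_nonneg simp: less_imp_le)
  then have "Re (z b) = 1" using t[OF b] by simp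
  moreover from this have "Im (z b) = 0"
    using cz[OF b] cmod_power2[of "z b"] power_mono[of "cmod (z b)" 1 2] by simp
  ultimately have "z b = 1" by (simp add: complex_eq_iff)
  then have "m * (cnj m * w b) = m" by (simp add: z_def)
  then show ?thesis using mm by (simp add: mult.assoc[symmetric])
qed

text \<open>\<open>cyc\<close> makes \<open>K\<close> the only recurrent class: outside
  \<open>K\<close> the relation is acyclic, so the matrix of \<open>S\<close> on \<open>E\<close> is
  block triangular with a nilpotent part off \<open>K\<close>.\<close>

locale recurrent_class =
  fixes E K :: "'a set" and S :: "'a \<Rightarrow> 'a \<Rightarrow> bool" and r :: real and u :: "'a \<Rightarrow> real"
  assumes finE: "finite E" and KE: "K \<subseteq> E" and S_E: "\<And>a b. S a b \<Longrightarrow> a \<in> E \<and> b \<in> E"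
    and cyc: "\<And>a. S\<^sup>+\<^sup>+ a a \<Longrightarrow> a \<in> K"
    and irred: "\<And>a b. a \<in> K \<Longrightarrow> b \<in> K \<Longrightarrow> (\<lambda>a b. S a b \<and> a \<in> K \<and> b \<in> K)\<^sup>+\<^sup>+ a b"
    and r_pos: "r > 0" and u_pos: "\<And>a. a \<in> K \<Longrightarrow> u a > 0"
    and perron: "\<And>a. a \<in> K \<Longrightarrow> r * u a = (\<Sum>b\<in>{b\<in>K. S a b}. u b)"
begin

abbreviation SK :: "'a \<Rightarrow> 'a \<Rightarrow> bool" where "SK \<equiv> \<lambda>a b. S a b \<and> a \<in> K \<and> b \<in> K"

definition eigenfunction :: "complex \<Rightarrow> ('a \<Rightarrow> complex) \<Rightarrow> bool" where
  "eigenfunction \<mu> f \<longleftrightarrow> (\<forall>a\<in>E. \<mu> * f a = (\<Sum>b\<in>{b\<in>E. S a b}. f b)) \<and> (\<exists>a\<in>E. f a \<noteq> 0)"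

definition period :: "'a \<Rightarrow> nat" where
  "period a = Gcd {n. \<exists>p. length p = n \<and> walk_via SK a p a}"

lemma finK: "finite K" using finE KE finite_subset by blast

lemma SK_S: "SK\<^sup>+\<^sup>+ a b \<Longrightarrow> S\<^sup>+\<^sup>+ a b"
  by (induction rule: tranclp_induct) (auto intro: tranclp.trancl_into_trancl)

lemma irred_S: "a \<in> K \<Longrightarrow> b \<in> K \<Longrightarrow> S\<^sup>+\<^sup>+ a b"
  using irred SK_S by blast

lemma no_return:
  assumes "a \<in> K" "S a b" "b \<notin> K" "c \<in> K"
  shows "\<not> S\<^sup>+\<^sup>+ b c"
proof
  assume "S\<^sup>+\<^sup>+ b c"
  moreover have "S\<^sup>+\<^sup>+ c a" using irred_S assms by blast
  ultimately have "S\<^sup>+\<^sup>+ b b" using assms(2)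
    by (meson tranclp.trancl_into_trancl tranclp_trans)
  then show False using cyc assms by blast
qed

text \<open>As \<mu> is nonzero, a nonzero value passes on to some successor; beyond
  \<open>K\<close> this would go on forever and close a cycle outside \<open>K\<close>. The equation
  is assumed only off \<open>K\<close>, so the lemma can also be applied in
  \<open>eigenvalue_rotation\<close> to a function whose equation on \<open>K\<close> is still to be
  shown.\<close>

lemma vanishes_beyond:
  assumes eig: "\<And>a. a \<in> E \<Longrightarrow> a \<notin> K \<Longrightarrow> \<mu> * f a = (\<Sum>b\<in>{b\<in>E. S a b}. f b)"
    and \<mu>: "(\<mu> :: complex) \<noteq> 0" and b: "b \<in> E" "b \<notin> K" "\<And>c. c \<in> K \<Longrightarrow> \<not> S\<^sup>+\<^sup>+ b c"
  shows "f b = 0"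
proof (rule ccontr)
  assume nz: "f b \<noteq> 0"
  define A where "A = {b\<in>E. f b \<noteq> 0 \<and> b \<notin> K \<and> (\<forall>c\<in>K. \<not> S\<^sup>+\<^sup>+ b c)}"
  have "\<exists>a\<in>A. S\<^sup>+\<^sup>+ a a"
  proof (rule serial_on_finite_has_cycle)
    show "finite A" "A \<noteq> {}" using finE nz b by (auto simp: A_def)
    fix a assume a: "a \<in> A"
    have "\<exists>b\<in>{b\<in>E. S a b}. f b \<noteq> 0"
    proof (rule ccontr)
      assume "\<not> ?thesis"
      then have "\<mu> * f a = 0" using eig[of a] a by (simp add: A_def)
      then show False using \<mu> a by (simp add: A_def)
    qed
    then obtain b where b: "b \<in> E" "S a b" "f b \<noteq> 0" by blast
    then have "b \<in> A" using a unfolding A_def by (auto intro: tranclp_into_tranclp2)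
    then show "\<exists>b\<in>A. S a b" using b by blast
  qed
  then show False using cyc by (auto simp: A_def)
qed

lemma sum_successors_on_K:
  assumes eig: "\<And>a. a \<in> E \<Longrightarrow> a \<notin> K \<Longrightarrow> \<mu> * f a = (\<Sum>b\<in>{b\<in>E. S a b}. f b)"
    and \<mu>: "(\<mu> :: complex) \<noteq> 0" and a: "a \<in> K"
  shows "(\<Sum>b\<in>{b\<in>E. S a b}. f b) = (\<Sum>b\<in>{b\<in>K. S a b}. f b)"
proof (rule sum.mono_neutral_right)
  show "finite {b\<in>E. S a b}" "{b\<in>K. S a b} \<subseteq> {b\<in>E. S a b}" using finE KE by auto
  show "\<forall>b\<in>{b\<in>E. S a b} - {b\<in>K. S a b}. f b = 0"
  proof
    fix b assume "b \<in> {b\<in>E. S a b} - {b\<in>K. S a b}"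
    then have b: "b \<in> E" "b \<notin> K" "S a b" by auto
    show "f b = 0" by (rule vanishes_beyond[OF eig \<mu> b(1,2)]) (use no_return[OF a b(3,2)] in auto)
  qed
qed

lemma eigenfunction_on_K:
  assumes "eigenfunction \<mu> f" "\<mu> \<noteq> 0"
  shows "\<And>a. a \<in> K \<Longrightarrow> \<mu> * f a = (\<Sum>b\<in>{b\<in>K. S a b}. f b)" "\<exists>a\<in>K. f a \<noteq> 0"
proof -
  have eig: "\<mu> * f a = (\<Sum>b\<in>{b\<in>E. S a b}. f b)" if "a \<in> E" for a
    using assms that by (auto simp: eigenfunction_def)
  show "\<mu> * f a = (\<Sum>b\<in>{b\<in>K. S a b}. f b)" if "a \<in> K" for a
  proof -
    have "(\<Sum>b\<in>{b\<in>E. S a b}. f b) = (\<Sum>b\<in>{b\<in>K. S a b}. f b)"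
      by (rule sum_successors_on_K[OF eig assms(2) that])
    then show ?thesis using eig that KE by auto
  qed
  show "\<exists>a\<in>K. f a \<noteq> 0"
  proof (rule ccontr)
    assume z: "\<not> ?thesis"
    define A where "A = {a\<in>E. f a \<noteq> 0}"
    have "\<exists>a\<in>A. S\<^sup>+\<^sup>+ a a"
    proof (rule serial_on_finite_has_cycle)
      show "finite A" "A \<noteq> {}" using finE assms by (auto simp: A_def eigenfunction_def)
      fix a assume a: "a \<in> A"
      show "\<exists>b\<in>A. S a b"
      proof (rule ccontr)
        assume "\<not> ?thesis"
        then have "(\<Sum>b\<in>{b\<in>E. S a b}. f b) = 0" by (intro sum.neutral) (auto simp: A_def)
        then have "\<mu> * f a = 0" using eig[of a] a by (simp add: A_def)
        then show False using assms a by (simp add: A_def)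
      qed
    qed
    then show False using cyc z by (auto simp: A_def)
  qed
qed

lemma walk_power:
  fixes w :: "'a \<Rightarrow> complex"
  assumes "\<And>a b. SK a b \<Longrightarrow> w b = \<zeta> * w a" "walk_via SK a p b"
  shows "w b = \<zeta> ^ length p * w a"
  using assms(2)
proof (induction p arbitrary: a)
  case (Cons c p)
  then obtain z where z: "SK a z" "walk_via SK z p b" by auto
  then show ?case using Cons.IH[OF z(2)] assms(1)[OF z(1)] by simp
qed simp

lemma closed_walks_K:
  assumes "a \<in> K"
  shows "\<exists>p. p \<noteq> [] \<and> walk_via SK a p a"
  using irred[OF assms assms] walk_via_trancl[of SK a a] by blast

lemma period_dvd: "walk_via SK a p a \<Longrightarrow> period a dvd length p"
  unfolding period_def by (rule Gcd_dvd) blast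

lemma period_pos:
  assumes "a \<in> K"
  shows "period a > 0"
proof -
  obtain p where p: "p \<noteq> []" "walk_via SK a p a" using closed_walks_K assms by blast
  then show ?thesis using period_dvd[OF p(2)] by (intro gr0I) auto
qed

lemma eventually_period_multiples:
  assumes "a \<in> K"
  shows "\<exists>N. \<forall>n\<ge>N. period a dvd n \<longrightarrow> (\<exists>p. length p = n \<and> walk_via SK a p a)"
proof -
  let ?R = "{n. \<exists>p. length p = n \<and> walk_via SK a p a}"
  obtain p where p: "p \<noteq> []" "walk_via SK a p a" using closed_walks_K assms by blast
  have "\<exists>N. \<forall>n\<ge>N. Gcd ?R dvd n \<longrightarrow> n \<in> ?R"
  proof (rule add_closed_contains_multiples_of_Gcd)
    show "length p \<in> ?R" "length p > 0" using p by auto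
    show "m + n \<in> ?R" if mn: "m \<in> ?R" "n \<in> ?R" for m n
    proof -
      obtain p q where "length p = m" "walk_via SK a p a" "length q = n" "walk_via SK a q a"
        using mn by blast
      then have "length (p @ q) = m + n" "walk_via SK a (p @ q) a"
        by (auto simp: walk_via_append)
      then show ?thesis by blast
    qed
  qed
  then show ?thesis unfolding period_def by simp
qed

text \<open>Wielandt's argument: let \<open>c * u\<close> be the smallest multiple of
  \<open>u\<close> dominating the modulus of \<open>f\<close> on \<open>K\<close>. A point of
  contact gives the bound. If \<open>cmod \<mu> = r\<close>, contact spreads over all of
  \<open>K\<close>, and the phase of \<open>f\<close> is multiplied by \<open>\<mu> / r\<close> at
  every step, hence returns to itself along closed walks.\<close>

lemma eigenvalue_bound:
  assumes f: "eigenfunction \<mu> f"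
  shows "cmod \<mu> \<le> r" "cmod \<mu> = r \<Longrightarrow> a0 \<in> K \<Longrightarrow> (\<mu> / of_real r) ^ period a0 = 1"
proof -
  have main: "cmod \<mu> \<le> r \<and> (cmod \<mu> = r \<longrightarrow> (\<forall>a0\<in>K. (\<mu> / of_real r) ^ period a0 = 1))" if \<mu>: "\<mu> \<noteq> 0"
  proof -
    note eig = eigenfunction_on_K[OF f \<mu>]
    define c where "c = Max ((\<lambda>a. cmod (f a) / u a) ` K)"
    have Kne: "K \<noteq> {}" using eig(2) by auto
    have fc: "cmod (f a) \<le> c * u a" if "a \<in> K" for a
    proof -
      have "cmod (f a) / u a \<le> c" unfolding c_def using finK that by (intro Max_ge) auto
      then show ?thesis using u_pos[OF that] by (simp add: pos_divide_le_eq)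
    qed
    have "c \<in> (\<lambda>a. cmod (f a) / u a) ` K" unfolding c_def using finK Kne by (intro Max_in) auto
    then obtain a1 where "a1 \<in> K" "c = cmod (f a1) / u a1" by blast
    then have a1: "a1 \<in> K" "cmod (f a1) = c * u a1" using u_pos[of a1] by simp_all
    have c: "c > 0"
    proof -
      obtain a where "a \<in> K" "f a \<noteq> 0" using eig(2) by blast
      then have "0 < c * u a" using fc[of a] by (smt (verit) zero_less_norm_iff)
      then show ?thesis using u_pos[OF \<open>a \<in> K\<close>] by (simp add: zero_less_mult_iff)
    qed
    have bound: "cmod \<mu> * cmod (f a) \<le> (\<Sum>b\<in>{b\<in>K. S a b}. cmod (f b))" if "a \<in> K" for a
      unfolding norm_mult[symmetric] eig(1)[OF that] by (rule norm_sum)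
    have bound2: "(\<Sum>b\<in>{b\<in>K. S a b}. cmod (f b)) \<le> c * (r * u a)" if "a \<in> K" for a
      unfolding perron[OF that] sum_distrib_left by (rule sum_mono) (use fc in auto)
    have "cmod \<mu> * (c * u a1) \<le> r * (c * u a1)"
      using bound[OF a1(1)] bound2[OF a1(1)] a1(2) by (simp add: algebra_simps)
    then have le: "cmod \<mu> \<le> r" using c u_pos[OF a1(1)] by simp
    have per: "(\<mu> / of_real r) ^ period a0 = 1" if eqr: "cmod \<mu> = r" and a0: "a0 \<in> K" for a0
    proof -
      have step: "cmod (f b) = c * u b" if a: "a \<in> K" "cmod (f a) = c * u a" and b: "b \<in> K" "S a b" for a b
      proof -
        have "(\<Sum>b\<in>{b\<in>K. S a b}. cmod (f b)) = c * (r * u a)"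
          using bound[OF a(1)] bound2[OF a(1)] a(2) eqr by (simp add: algebra_simps)
        then have "(\<Sum>b\<in>{b\<in>K. S a b}. c * u b - cmod (f b)) = 0"
          unfolding perron[OF a(1)] by (simp add: sum_subtractf sum_distrib_left)
        then have "c * u b - cmod (f b) = 0"
          using finK fc b by (subst (asm) sum_nonneg_eq_0_iff) auto
        then show ?thesis by simp
      qed
      have modulus: "cmod (f a) = c * u a" if "a \<in> K" for a
        using irred[OF a1(1) that]
        by (induction rule: tranclp_induct) (use a1 step in auto)
      define w where "w = (\<lambda>a. f a / of_real (c * u a))"
      have w1: "cmod (w a) = 1" if "a \<in> K" for a
        using modulus[OF that] c u_pos[OF that] unfolding w_def
        by (simp add: norm_divide norm_mult)
      have fw: "f a = of_real (c * u a) * w a" if "a \<in> K" for a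
        using c u_pos[OF that] unfolding w_def by simp
      have wstep: "w b = (\<mu> / of_real r) * w a" if ab: "SK a b" for a b
      proof (rule weighted_sum_unit_disc_extremal[where B = "{b\<in>K. S a b}" and t = u])
        show "cmod ((\<mu> / of_real r) * w a) = 1" using w1 ab eqr r_pos by (simp add: norm_mult norm_divide)
        have "of_real c * (\<Sum>b\<in>{b\<in>K. S a b}. of_real (u b) * w b) = \<mu> * f a"
          using eig(1)[of a] ab fw by (simp add: sum_distrib_left mult.assoc)
        also have "\<dots> = of_real c * (of_real (u a) * \<mu> * w a)" using fw[of a] ab by (simp add: algebra_simps)
        finally have "(\<Sum>b\<in>{b\<in>K. S a b}. of_real (u b) * w b) = of_real (u a) * \<mu> * w a"
          using c by simp
        also have "\<dots> = of_real (r * u a) * (\<mu> / of_real r * w a)" using r_pos by simp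
        finally show "(\<Sum>b\<in>{b\<in>K. S a b}. of_real (u b) * w b) =
          of_real (sum u {b\<in>K. S a b}) * (\<mu> / of_real r * w a)" using perron[of a] ab by simp
      qed (use finK u_pos w1 ab in auto)
      obtain N where N: "\<And>n. n \<ge> N \<Longrightarrow> period a0 dvd n \<Longrightarrow> \<exists>p. length p = n \<and> walk_via SK a0 p a0"
        using eventually_period_multiples[OF a0] by blast
      have one: "(\<mu> / of_real r) ^ n = 1" if n: "n \<ge> N" "period a0 dvd n" for n
      proof -
        obtain p where p: "length p = n" "walk_via SK a0 p a0" using N n by blast
        have "w a0 = (\<mu> / of_real r) ^ n * w a0"
          using walk_power[of w, OF wstep p(2)] p(1) by simp
        moreover have "w a0 \<noteq> 0" using w1[OF a0] by auto
        ultimately show ?thesis by simp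
      qed
      \<comment> \<open>Closed walks are guaranteed only for large multiples of the period; two
        consecutive ones yield the period itself by division.\<close>
      have "N * period a0 \<ge> N" using period_pos[OF a0] by simp
      then have "(\<mu> / of_real r) ^ (N * period a0) = 1" "(\<mu> / of_real r) ^ (N * period a0 + period a0) = 1"
        by (intro one; simp add: trans_le_add1)+
      then show ?thesis by (simp add: power_add)
    qed
    show ?thesis using le per by blast
  qed
  show "cmod \<mu> \<le> r" using main r_pos by (cases "\<mu> = 0") auto
  show "cmod \<mu> = r \<Longrightarrow> a0 \<in> K \<Longrightarrow> (\<mu> / of_real r) ^ period a0 = 1"
    using main r_pos by (cases "\<mu> = 0") auto
qed

lemma period_cong:
  assumes "a0 \<in> K" "b \<in> K" "walk_via SK a0 p b" "walk_via SK a0 q b"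
  shows "length p mod period a0 = length q mod period a0"
proof -
  obtain s where s: "walk_via SK b s a0" using irred[OF assms(2,1)] walk_via_trancl[of SK b a0] by blast
  have "walk_via SK a0 (p @ s) a0" "walk_via SK a0 (q @ s) a0" using assms s by (auto simp: walk_via_append)
  then have "period a0 dvd length (p @ s)" "period a0 dvd length (q @ s)"
    by (simp_all only: period_dvd)
  then have "[length p + length s = length q + length s] (mod period a0)"
    by (simp add: cong_def mod_eq_0_iff_dvd)
  then have "[length p = length q] (mod period a0)" by (simp only: cong_add_rcancel_nat)
  then show ?thesis by (simp only: cong_def)
qed

text \<open>Twisting \<open>u\<close> by \<open>z\<close> to the power of the cyclic phase
  multiplies the eigenvalue by \<open>z\<close>. The phase is the length of any walk from
  \<open>a0\<close>, which is well defined modulo the period. Off \<open>K\<close> the eigenvalue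
  equation itself serves as a recursive definition.\<close>

lemma eigenvalue_rotation:
  assumes a0: "a0 \<in> K" and z: "z ^ period a0 = 1"
  shows "\<exists>f. eigenfunction (of_real r * z) f"
proof -
  define \<mu> where "\<mu> = of_real r * z"
  have z0: "z \<noteq> 0" using z period_pos[OF a0] by (metis power_eq_0_iff zero_neq_one zero_power)
  have \<mu>: "\<mu> \<noteq> 0" using r_pos z0 by (simp add: \<mu>_def)
  have "\<forall>b\<in>K. \<exists>p. walk_via SK a0 p b" using irred[OF a0] walk_via_trancl[of SK a0] by blast
  from bchoice[OF this] obtain P where P: "\<And>b. b \<in> K \<Longrightarrow> walk_via SK a0 (P b) b" by blast
  define v where "v = (\<lambda>b. of_real (u b) * z ^ length (P b))"
  have zmod: "z ^ m = z ^ n" if "m mod period a0 = n mod period a0" for m n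
  proof -
    have "z ^ m = z ^ (m mod period a0)" for m
      by (metis (no_types) div_mult_mod_eq mult.commute power_add power_mult power_one mult_1 z)
    then show ?thesis using that by metis
  qed
  have vstep: "\<mu> * v a = (\<Sum>b\<in>{b\<in>K. S a b}. v b)" if a: "a \<in> K" for a
  proof -
    have "v b = of_real (u b) * z ^ Suc (length (P a))" if b: "b \<in> K" "S a b" for b
    proof -
      have "walk_via SK a0 (P a @ [a]) b" using P[OF a] a b by (auto simp: walk_via_append)
      from period_cong[OF a0 b(1) P[OF b(1)] this] show ?thesis unfolding v_def using zmod
        by (metis length_append_singleton)
    qed
    then have "(\<Sum>b\<in>{b\<in>K. S a b}. v b) = (\<Sum>b\<in>{b\<in>K. S a b}. of_real (u b) * z ^ Suc (length (P a)))"
      by (intro sum.cong) auto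
    also have "\<dots> = of_real (r * u a) * z ^ Suc (length (P a))"
      unfolding perron[OF a] by (simp add: sum_distrib_right)
    finally show ?thesis by (simp add: \<mu>_def v_def algebra_simps)
  qed
  \<comment> \<open>Oriented so that the recursion for \<open>f a\<close> calls the successors of
    \<open>a\<close>; it terminates because all cycles lie in \<open>K\<close>.\<close>
  define R where "R = {(b, a). a \<in> E - K \<and> b \<in> E - K \<and> S a b}"
  have "wf R"
  proof (rule finite_acyclic_wf)
    show "finite R" by (rule finite_subset[of _ "E \<times> E"]) (use finE in \<open>auto simp: R_def\<close>)
    have "(b, a) \<in> R\<^sup>+ \<Longrightarrow> a \<in> E - K \<and> S\<^sup>+\<^sup>+ a b" for a b
      by (induction rule: converse_trancl_induct) (auto simp: R_def intro: tranclp.trancl_into_trancl)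
    then show "acyclic R" using cyc by (fastforce simp: acyclic_def)
  qed
  define F where "F = (\<lambda>f a. if a \<in> K then v a else (\<Sum>b\<in>{b\<in>E. S a b}. if b \<in> K then v b else f b) / \<mu>)"
  define f where "f = wfrec R F"
  have fK: "f a = v a" if "a \<in> K" for a
    using wfrec[OF \<open>wf R\<close>, of F a] that by (simp add: f_def F_def)
  have fE: "\<mu> * f a = (\<Sum>b\<in>{b\<in>E. S a b}. f b)" if a: "a \<in> E" "a \<notin> K" for a
  proof -
    have "f a = F (cut f R a) a" unfolding f_def by (rule wfrec[OF \<open>wf R\<close>])
    also have "\<dots> = (\<Sum>b\<in>{b\<in>E. S a b}. if b \<in> K then v b else cut f R a b) / \<mu>" using a by (simp add: F_def)
    also have "(\<Sum>b\<in>{b\<in>E. S a b}. if b \<in> K then v b else cut f R a b) = (\<Sum>b\<in>{b\<in>E. S a b}. f b)"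
      by (rule sum.cong) (use a fK in \<open>auto simp: cut_def R_def\<close>)
    finally show ?thesis using \<mu> by simp
  qed
  have fK2: "\<mu> * f a = (\<Sum>b\<in>{b\<in>E. S a b}. f b)" if a: "a \<in> K" for a
  proof -
    have "(\<Sum>b\<in>{b\<in>E. S a b}. f b) = (\<Sum>b\<in>{b\<in>K. S a b}. f b)"
      by (rule sum_successors_on_K[OF fE \<mu> a])
    also have "\<dots> = (\<Sum>b\<in>{b\<in>K. S a b}. v b)" by (rule sum.cong) (use fK in auto)
    finally show ?thesis using vstep[OF a] fK[OF a] by simp
  qed
  have "f a0 \<noteq> 0" using fK[OF a0] u_pos[OF a0] z0 by (simp add: v_def)
  then have "eigenfunction \<mu> f" unfolding eigenfunction_def using fE fK2 a0 KE by blast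
  then show ?thesis unfolding \<mu>_def by blast
qed

text \<open>The eigenvalues of modulus \<open>r\<close> are \<open>r\<close> times the roots of
  unity of order dividing the period. \<Sigma> is an abstract set at this point, which accounts for
  the disjunct \<open>infinite \<Sigma>\<close>; \<open>rho_nu\<close> excludes it for the spectrum
  of a matrix.\<close>

theorem peripheral_eigenvalues:
  assumes a0: "a0 \<in> K" and spec: "\<And>\<mu>. \<mu> \<in> \<Sigma> \<longleftrightarrow> (\<exists>f. eigenfunction \<mu> f)"
  shows "Max (cmod ` \<Sigma>) = r \<or> infinite \<Sigma>" "card {\<mu>\<in>\<Sigma>. cmod \<mu> = r} = period a0"
proof -
  have "of_real r \<in> \<Sigma>" using eigenvalue_rotation[OF a0, of 1] spec by auto
  then have "r \<in> cmod ` \<Sigma>" using r_pos by (intro image_eqI[of _ _ "of_real r"]) auto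
  then show "Max (cmod ` \<Sigma>) = r \<or> infinite \<Sigma>"
    using eigenvalue_bound(1) spec by (cases "finite \<Sigma>") (auto intro!: Max_eqI)
  have "{\<mu>\<in>\<Sigma>. cmod \<mu> = r} = (\<lambda>z. of_real r * z) ` {z. z ^ period a0 = 1}"
  proof
    show "{\<mu>\<in>\<Sigma>. cmod \<mu> = r} \<subseteq> (\<lambda>z. of_real r * z) ` {z. z ^ period a0 = 1}"
    proof
      fix \<mu> assume "\<mu> \<in> {\<mu>\<in>\<Sigma>. cmod \<mu> = r}"
      then have "(\<mu> / of_real r) ^ period a0 = 1" using eigenvalue_bound(2) spec a0 by blast
      then show "\<mu> \<in> (\<lambda>z. of_real r * z) ` {z. z ^ period a0 = 1}"
        using r_pos by (intro image_eqI[of _ _ "\<mu> / of_real r"]) auto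
    qed
    have "cmod z = 1" if "z ^ period a0 = 1" for z
      using power_eq_imp_eq_base[of "cmod z" "period a0" 1] period_pos[OF a0] arg_cong[OF that, of cmod]
      by (simp add: norm_power)
    then show "(\<lambda>z. of_real r * z) ` {z. z ^ period a0 = 1} \<subseteq> {\<mu>\<in>\<Sigma>. cmod \<mu> = r}"
      using eigenvalue_rotation[OF a0] spec r_pos by (auto simp: norm_mult)
  qed
  then have "card {\<mu>\<in>\<Sigma>. cmod \<mu> = r} = card {z :: complex. z ^ period a0 = 1}"
    using r_pos by (simp add: card_image inj_on_def)
  then show "card {\<mu>\<in>\<Sigma>. cmod \<mu> = r} = period a0"
    using card_roots_unity_eq period_pos[OF a0] by simp
qed

end

section \<open>The non-backtracking relation on oriented edges\<close>

declare split_paired_All [simp del] split_paired_Ex [simp del]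

lemma edge_inv_simps [simp]:
  "edge_inv (edge_inv a) = a" "edge_inv a \<noteq> a" "a \<noteq> edge_inv a" "edge_inv a = edge_inv b \<longleftrightarrow> a = b"
  "initial_vertex G (edge_inv a) = terminal_vertex G a" "terminal_vertex G (edge_inv a) = initial_vertex G a"
  "edge_inv a \<in> oriented_edges G \<longleftrightarrow> a \<in> oriented_edges G"
  by (auto simp: edge_inv_def initial_vertex_def terminal_vertex_def oriented_edges_def prod_eq_iff
      mem_Times_iff)

definition nonbacktracking :: "('v, 'e) pre_digraph \<Rightarrow> 'e \<times> bool \<Rightarrow> 'e \<times> bool \<Rightarrow> bool" where
  "nonbacktracking G a b \<longleftrightarrow> a \<in> oriented_edges G \<and> b \<in> oriented_edges G \<and>
     terminal_vertex G a = initial_vertex G b \<and> b \<noteq> edge_inv a"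

text \<open>\<open>walk_via\<close> includes a final step from \<open>last p\<close> back to
  \<open>hd p\<close>; for the nonbacktracking relation this single step expresses both closedness
  and the absence of a tail.\<close>

lemma circuit_iff_walk_via:
  "circuit G p \<longleftrightarrow> p \<noteq> [] \<and> walk_via (nonbacktracking G) (hd p) p (hd p)"
proof (cases "p = []")
  case False
  have 1: "(\<forall>i. Suc i < length p \<longrightarrow> p ! i \<in> oriented_edges G \<and> p ! Suc i \<in> oriented_edges G \<and> R (p ! i) (p ! Suc i)) \<and>
      last p \<in> oriented_edges G \<and> hd p \<in> oriented_edges G \<longleftrightarrow>
      set p \<subseteq> oriented_edges G \<and> (\<forall>i. Suc i < length p \<longrightarrow> R (p ! i) (p ! Suc i))" for R
  proof -
    have "set p \<subseteq> oriented_edges G" if "\<forall>i. Suc i < length p \<longrightarrow> p ! i \<in> oriented_edges G"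
      "last p \<in> oriented_edges G"
    proof
      fix x assume "x \<in> set p"
      then obtain i where "i < length p" "x = p ! i" by (auto simp: in_set_conv_nth)
      then show "x \<in> oriented_edges G" using that False
        by (cases "Suc i < length p") (auto simp: last_conv_nth dest: less_antisym Suc_lessI)
    qed
    then show ?thesis using False by (auto simp: subset_iff)
  qed
  show ?thesis
    using 1[of "\<lambda>a b. terminal_vertex G a = initial_vertex G b \<and> b \<noteq> edge_inv a"] False
    unfolding circuit_def walk_def walk_via_iff_successively[OF False] successively_conv_nth nonbacktracking_def
    by (auto simp: eq_commute[of "initial_vertex G _"])
qed (simp add: circuit_def walk_def)

section \<open>Strong connectedness and branching of the core\<close>

locale genus2_graph = fin_digraph G for G :: "('v, 'e) pre_digraph" +
  assumes conn: "Digraph_Component.connected G" and genus: "genus G \<ge> 2"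
begin

abbreviation (input) "ini \<equiv> initial_vertex G"
abbreviation (input) "ter \<equiv> terminal_vertex G"
abbreviation (input) "OE \<equiv> oriented_edges G"
abbreviation "nb \<equiv> nonbacktracking G"

definition core :: "('e \<times> bool) set" where
  "core = {a. nb\<^sup>+\<^sup>+ a a}"

abbreviation core_step :: "'e \<times> bool \<Rightarrow> 'e \<times> bool \<Rightarrow> bool" where
  "core_step \<equiv> \<lambda>a b. nb a b \<and> a \<in> core \<and> b \<in> core"

lemma finite_OE: "finite OE" by (simp add: oriented_edges_def)

lemma finite_circuits: "finite {p. circuit G p \<and> length p = l}"
  by (rule finite_subset[OF _ finite_lists_length_eq[OF finite_OE, of l]]) (auto simp: circuit_def walk_def)

lemma vertices_in: "a \<in> OE \<Longrightarrow> ini a \<in> verts G" "a \<in> OE \<Longrightarrow> ter a \<in> verts G"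
  by (auto simp: oriented_edges_def initial_vertex_def terminal_vertex_def)

lemma card_arcs: "card (arcs G) \<ge> card (verts G) + 1"
  using genus by (simp add: genus_def)

lemma verts_nonempty: "verts G \<noteq> {}"
  using conn by (auto simp: Digraph_Component.connected_def strongly_connected_def mk_symmetric_def)

lemma adjacency_closed_eq_verts:
  assumes A: "A \<subseteq> verts G" "A \<noteq> {}" and closed: "\<And>a. a \<in> OE \<Longrightarrow> ini a \<in> A \<Longrightarrow> ter a \<in> A"
  shows "A = verts G"
proof -
  obtain u where u: "u \<in> A" using A by blast
  have "v \<in> A" if "v \<in> verts G" for v
  proof -
    have "(u, v) \<in> rtrancl_on (verts G) (\<Union>e\<in>arcs G. {(tail G e, head G e), (head G e, tail G e)})"
      using conn u A that
      by (auto simp: Digraph_Component.connected_def strongly_connected_def mk_symmetric_def reachable_def)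
    then show "v \<in> A"
    proof (induction rule: rtrancl_on_induct)
      case (step y z)
      then obtain e where "e \<in> arcs G" "(y = tail G e \<and> z = head G e) \<or> (y = head G e \<and> z = tail G e)" by blast
      then show ?case using closed[of "(e, True)"] closed[of "(e, False)"] step
        by (auto simp: oriented_edges_def initial_vertex_def terminal_vertex_def)
    qed (rule u)
  qed
  then show ?thesis using A by blast
qed

lemma nb_OE: "nb a b \<Longrightarrow> a \<in> OE \<and> b \<in> OE" by (simp add: nonbacktracking_def)

lemma tranclp_nb_OE: "nb\<^sup>+\<^sup>+ a b \<Longrightarrow> a \<in> OE \<and> b \<in> OE"
  by (induction rule: tranclp_induct) (auto dest: nb_OE)

lemma reachable_OE: "{b. nb\<^sup>+\<^sup>+ a b} \<subseteq> OE"
  using tranclp_nb_OE by blast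

lemma core_OE: "core \<subseteq> OE" unfolding core_def using tranclp_nb_OE by blast

lemma nb_inv: "nb a b \<Longrightarrow> nb (edge_inv b) (edge_inv a)"
  unfolding nonbacktracking_def by (auto simp: eq_commute)

lemma tranclp_nb_inv: "nb\<^sup>+\<^sup>+ a b \<Longrightarrow> nb\<^sup>+\<^sup>+ (edge_inv b) (edge_inv a)"
  by (induction rule: tranclp_induct) (auto intro: nb_inv tranclp_into_tranclp2)

lemma core_inv: "a \<in> core \<Longrightarrow> edge_inv a \<in> core"
  unfolding core_def using tranclp_nb_inv by blast

text \<open>Since \<open>a\<close> lies on a closed walk, every edge of \<open>R\<close> has a
  predecessor in \<open>R\<close>, so its initial vertex is also a terminal vertex of
  \<open>R\<close>. This settles the only edge by which a walk ending in \<open>b\<close> cannot be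
  continued, namely \<open>edge_inv b\<close>.\<close>

lemma reach_from_core:
  assumes a: "a \<in> core"
  defines "R \<equiv> {b. nb\<^sup>+\<^sup>+ a b}"
  shows "ter ` R = verts G" "\<And>b. b \<in> OE \<Longrightarrow> b \<in> R \<or> edge_inv b \<in> R"
    "\<And>b c. b \<in> R \<Longrightarrow> nb b c \<Longrightarrow> c \<in> R"
proof -
  show ext: "c \<in> R" if "b \<in> R" "nb b c" for b c
    using that unfolding R_def by (auto intro: tranclp.trancl_into_trancl)
  have aR: "a \<in> R" using a by (simp add: R_def core_def)
  have RE: "R \<subseteq> OE" unfolding R_def by (rule reachable_OE)
  have ini: "ini b \<in> ter ` R" if b: "b \<in> R" for b
  proof -
    obtain z where "z \<in> R" "nb z b"
      using b aR unfolding R_def mem_Collect_eq by (metis tranclp.cases)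
    then show ?thesis by (metis imageI nonbacktracking_def)
  qed
  show all: "ter ` R = verts G"
  proof (rule adjacency_closed_eq_verts)
    show "ter ` R \<subseteq> verts G" "ter ` R \<noteq> {}" using aR RE vertices_in by auto
    fix c assume c: "c \<in> OE" "ini c \<in> ter ` R"
    then obtain b where b: "b \<in> R" "ini c = ter b" by blast
    show "ter c \<in> ter ` R"
    proof (cases "c = edge_inv b")
      case True then show ?thesis using ini[OF b(1)] by simp
    next
      case False
      then have "nb b c" using b c RE by (auto simp: nonbacktracking_def)
      then have "c \<in> R" by (rule ext[OF b(1)])
      then show ?thesis by blast
    qed
  qed
  fix b assume b: "b \<in> OE"
  then obtain t where t: "t \<in> R" "ini b = ter t" using vertices_in(1)[OF b] all by blast
  show "b \<in> R \<or> edge_inv b \<in> R"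
  proof (cases "b = edge_inv t")
    case False
    then have "nb t b" using t b RE by (auto simp: nonbacktracking_def)
    then show ?thesis using ext[OF t(1)] by blast
  qed (use t in simp)
qed

text \<open>
  If \<open>a\<close> did not reach its inverse, the edges reachable from \<open>a\<close> would orient every edge so that
  each vertex has exactly one incoming edge, which forces genus 1.
\<close>

lemma reaches_inverse:
  assumes a: "a \<in> core"
  shows "nb\<^sup>+\<^sup>+ a (edge_inv a)"
proof (rule ccontr)
  assume no: "\<not> ?thesis"
  define R where "R = {b. nb\<^sup>+\<^sup>+ a b}"
  note R = reach_from_core[OF a, folded R_def]
  have RE: "R \<subseteq> OE" unfolding R_def by (rule reachable_OE)
  have noinv: "edge_inv b \<notin> R" if "b \<in> R" for b
  proof
    assume "edge_inv b \<in> R"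
    moreover have "nb\<^sup>+\<^sup>+ (edge_inv b) (edge_inv a)" using that tranclp_nb_inv by (simp add: R_def)
    ultimately show False using no by (auto simp: R_def intro: tranclp_trans)
  qed
  \<comment> \<open>If two edges of \<open>R\<close> ended at the same vertex, one could be followed
    by the inverse of the other.\<close>
  have "inj_on ter R"
  proof (rule inj_onI, rule ccontr)
    fix b b' assume b: "b \<in> R" "b' \<in> R" "ter b = ter b'" "b \<noteq> b'"
    then have "nb b' (edge_inv b)" using RE by (auto simp: nonbacktracking_def)
    then show False using R(3)[OF b(2)] noinv[OF b(1)] by blast
  qed
  then have "card R = card (verts G)" using R(1) card_image by fastforce
  moreover have "arcs G \<subseteq> fst ` R"
  proof
    fix e assume "e \<in> arcs G"
    then have "(e, True) \<in> R \<or> edge_inv (e, True) \<in> R" by (intro R(2)) (simp add: oriented_edges_def)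
    then show "e \<in> fst ` R" by (force simp: edge_inv_def)
  qed
  moreover have "finite R" using RE finite_OE finite_subset by blast
  ultimately have "card (arcs G) \<le> card (verts G)" by (metis card_image_le card_mono finite_imageI order_trans)
  then show False using card_arcs by simp
qed

text \<open>From \<open>a\<close> one reaches \<open>b\<close> or its inverse, and by
  \<open>reaches_inverse\<close> a walk along a core edge can turn around.\<close>

lemma core_strongly_connected:
  assumes "a \<in> core" "b \<in> core"
  shows "nb\<^sup>+\<^sup>+ a b"
proof -
  have "nb\<^sup>+\<^sup>+ a b \<or> nb\<^sup>+\<^sup>+ a (edge_inv b)" using reach_from_core(2)[OF assms(1)] assms(2) core_OE by blast
  moreover have "nb\<^sup>+\<^sup>+ (edge_inv b) b" using reaches_inverse[OF core_inv[OF assms(2)]] by simp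
  ultimately show ?thesis by (auto intro: tranclp_trans)
qed

lemma nb_between_core:
  assumes "nb a z" "nb\<^sup>*\<^sup>* z b" "a \<in> core" "b \<in> core"
  shows "z \<in> core"
proof -
  have "nb\<^sup>+\<^sup>+ b a" using core_strongly_connected assms by blast
  then have "nb\<^sup>+\<^sup>+ z z" using assms(1,2)
    by (meson rtranclp_tranclp_tranclp tranclp.trancl_into_trancl)
  then show ?thesis by (simp add: core_def)
qed

lemma core_step_tranclp:
  assumes "a \<in> core" "b \<in> core"
  shows "core_step\<^sup>+\<^sup>+ a b"
  using core_strongly_connected[OF assms] assms(1)
proof (induction rule: converse_tranclp_induct)
  case (base a)
  then show ?case using assms(2) by blast
next
  case (step a z)
  then have "z \<in> core" using nb_between_core[of a z b] assms(2) by (auto dest: tranclp_into_rtranclp)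
  then show ?case using step by (auto intro: tranclp_into_tranclp2[of core_step])
qed

lemma walk_via_core_step:
  assumes "walk_via nb a p b" "a \<in> core" "b \<in> core"
  shows "walk_via core_step a p b"
  using assms
proof (induction p arbitrary: a)
  case (Cons c p)
  then obtain z where z: "c = a" "nb a z" "walk_via nb z p b" by auto
  have "nb\<^sup>*\<^sup>* z b" using z(3) walk_via_trancl[of nb z b] by (cases "p = []") (auto dest: tranclp_into_rtranclp)
  then have zc: "z \<in> core" using nb_between_core z Cons.prems by blast
  then have "walk_via core_step z p b" using Cons.IH[OF z(3)] Cons.prems(3) by blast
  then show ?case using z(1,2) zc Cons.prems(2) by (simp, blast)
qed simp

lemma walk_via_core_step_nb: "walk_via core_step a p b \<Longrightarrow> walk_via nb a p b"
  by (induction p arbitrary: a) auto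

lemma circuit_iff_core:
  "circuit G p \<longleftrightarrow> p \<noteq> [] \<and> hd p \<in> core \<and> walk_via core_step (hd p) p (hd p)"
proof -
  have "hd p \<in> core" if "p \<noteq> []" "walk_via nb (hd p) p (hd p)"
    using that walk_via_trancl[of nb "hd p" "hd p"] by (auto simp: core_def)
  then show ?thesis unfolding circuit_iff_walk_via using walk_via_core_step walk_via_core_step_nb by blast
qed

text \<open>The list records the edges that are left and omits the end \<open>b\<close>. The
  reversed walk leaves \<open>edge_inv b\<close> and ends at \<open>edge_inv a\<close>, which shifts
  the list by one to \<open>tl (p @ [b])\<close>.\<close>

lemma walk_via_inv:
  "walk_via core_step a p b \<Longrightarrow> walk_via core_step (edge_inv b) (map edge_inv (rev (tl (p @ [b])))) (edge_inv a)"
proof (induction p arbitrary: a)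
  case (Cons c p)
  then obtain z where z: "c = a" "core_step a z" "walk_via core_step z p b" by auto
  have hd: "z = hd (p @ [b])" using walk_via_start z(3) by fastforce
  have "walk_via core_step (edge_inv b) (map edge_inv (rev (tl (p @ [b])))) (edge_inv z)" by (rule Cons.IH[OF z(3)])
  moreover have "core_step (edge_inv z) (edge_inv a)" using nb_inv core_inv z(2) by blast
  ultimately have "walk_via core_step (edge_inv b) (map edge_inv (rev (tl (p @ [b]))) @ [edge_inv z]) (edge_inv a)"
    by (auto simp: walk_via_append)
  also have "map edge_inv (rev (tl (p @ [b]))) @ [edge_inv z] = map edge_inv (rev (p @ [b]))"
    unfolding hd by (cases p) simp_all
  also have "p @ [b] = tl ((c # p) @ [b])" by simp
  finally show ?case .
qed simp

text \<open>
  If all successors in the core were unique, the inner part of a shortest walk from an edge to its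
  inverse would be a shorter one.
\<close>

lemma core_branches:
  assumes "core \<noteq> {}"
  shows "\<exists>a b c. b \<noteq> c \<and> core_step a b \<and> core_step a c"
proof (rule ccontr)
  assume "\<not> ?thesis"
  then have uniq: "core_step a b \<Longrightarrow> core_step a c \<Longrightarrow> b = c" for a b c by blast
  define Pk where "Pk = (\<lambda>k. \<exists>a p. length p = k \<and> walk_via core_step a p (edge_inv a))"
  obtain a where a: "a \<in> core" using assms by blast
  have "\<exists>p. walk_via core_step a p (edge_inv a)"
    using core_step_tranclp[OF a core_inv[OF a]] walk_via_trancl[of core_step a "edge_inv a"] by blast
  then have "\<exists>k. Pk k" unfolding Pk_def by blast
  then obtain k where k: "Pk k" and min: "\<And>j. j < k \<Longrightarrow> \<not> Pk j"
    using exists_least_iff[of Pk] by blast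
  from k obtain a p where p: "length p = k" "walk_via core_step a p (edge_inv a)" unfolding Pk_def by blast
  have "p \<noteq> []" using p(2) by auto
  then obtain p' z where p': "p = a # p'" "core_step a z" "walk_via core_step z p' (edge_inv a)"
    using p(2) by (cases p) auto
  have "p' \<noteq> []" using p' by (auto simp: nonbacktracking_def)
  then obtain q y where q: "p' = q @ [y]" by (metis rev_exhaust)
  then have y: "walk_via core_step z q y" "core_step y (edge_inv a)" using p'(3) by (auto simp: walk_via_append)
  \<comment> \<open>Reversing the last step shows that \<open>edge_inv y\<close> also follows
    \<open>a\<close>. Uniqueness identifies it with \<open>z\<close>, and the inner walk
    \<open>q\<close> leads from \<open>z\<close> to its inverse.\<close>
  have "nb (edge_inv (edge_inv a)) (edge_inv y)" using nb_inv y(2) by blast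
  then have "core_step a (edge_inv y)" using y(2) core_inv[of y] p'(2) by simp
  then have "z = edge_inv y" using uniq[OF p'(2)] by blast
  then have "y = edge_inv z" by simp
  then have "Pk (length q)" using y(1) unfolding Pk_def by blast
  then show False using min[of "length q"] p(1) p'(1) q by simp
qed

text \<open>Walks that never get stuck lead from \<open>b\<close> and from its inverse into the
  core. Reversing the second one gives a way from the core back to \<open>b\<close>, and the core
  connects the two.\<close>

lemma all_edges_core:
  assumes ne: "core \<noteq> {}" and succ: "\<And>a. a \<in> OE \<Longrightarrow> \<exists>b. nb a b"
  shows "core = OE"
proof
  show "OE \<subseteq> core"
  proof
    fix b assume b: "b \<in> OE"
    have reach: "\<exists>c\<in>core. nb\<^sup>+\<^sup>+ b c" if b: "b \<in> OE" for b
    proof -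
      have "\<exists>c\<in>{c. nb\<^sup>+\<^sup>+ b c}. nb\<^sup>+\<^sup>+ c c"
      proof (rule serial_on_finite_has_cycle)
        show "finite {c. nb\<^sup>+\<^sup>+ b c}" by (rule finite_subset[OF reachable_OE finite_OE])
        show "{c. nb\<^sup>+\<^sup>+ b c} \<noteq> {}" using succ[OF b] by auto
        show "\<exists>d\<in>{c. nb\<^sup>+\<^sup>+ b c}. nb c d" if "c \<in> {c. nb\<^sup>+\<^sup>+ b c}" for c
          using that succ[of c] tranclp_nb_OE[of b c] by (auto intro: tranclp.trancl_into_trancl)
      qed
      then show ?thesis by (auto simp: core_def)
    qed
    obtain c where c: "c \<in> core" "nb\<^sup>+\<^sup>+ b c" using reach[OF b] by blast
    obtain d where d: "d \<in> core" "nb\<^sup>+\<^sup>+ (edge_inv b) d" using reach[of "edge_inv b"] b by auto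
    have "nb\<^sup>+\<^sup>+ (edge_inv d) b" using tranclp_nb_inv[OF d(2)] by simp
    moreover have "nb\<^sup>+\<^sup>+ c (edge_inv d)" using core_strongly_connected c(1) core_inv[OF d(1)] by blast
    ultimately have "nb\<^sup>+\<^sup>+ b b" using c(2) by (meson tranclp_trans)
    then show "b \<in> core" by (simp add: core_def)
  qed
qed (rule core_OE)

end

section \<open>Integral cycles are sums of circuits\<close>

definition edge_value :: "('e \<Rightarrow> real) \<Rightarrow> 'e \<times> bool \<Rightarrow> real" where
  "edge_value c a = (if snd a then c (fst a) else - c (fst a))"

lemma edge_value_inv [simp]: "edge_value c (edge_inv a) = - edge_value c a"
  by (simp add: edge_value_def edge_inv_def)

lemma abelianization_simps [simp]:
  "abelianization [] = (\<lambda>e. 0)"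
  "abelianization (a # p) = (\<lambda>e. edge_chain a e + abelianization p e)"
  "abelianization (p @ q) = (\<lambda>e. abelianization p e + abelianization q e)"
  by (auto simp: abelianization_def)

lemma edge_chain_inv: "edge_chain (edge_inv a) = (\<lambda>e. - edge_chain a e)"
  by (auto simp: edge_chain_def edge_inv_def)

lemma abelianization_inv_rev: "abelianization (map edge_inv (rev p)) e = - abelianization p e"
  by (induction p) (auto simp: edge_chain_inv)

lemma abelianization_Ints: "abelianization p e \<in> \<int>"
  by (induction p) (auto simp: edge_chain_def intro: Ints_add)

lemma boundary_add: "boundary G (\<lambda>e. c e + d e) v = boundary G c v + boundary G d v"
  by (simp add: boundary_def distrib_right sum.distrib)

lemma boundary_uminus: "boundary G (\<lambda>e. - c e) v = - boundary G c v"
  by (simp add: boundary_def sum_negf)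

lemma boundary_diff: "boundary G (\<lambda>e. c e - d e) v = boundary G c v - boundary G d v"
  by (simp add: boundary_def left_diff_distrib sum_subtractf)

lemma boundary_zero [simp]: "boundary G (\<lambda>e. 0) v = 0"
  by (simp add: boundary_def)

lemma H1_int_closed:
  "(\<lambda>e. 0) \<in> H1_int G"
  "c \<in> H1_int G \<Longrightarrow> d \<in> H1_int G \<Longrightarrow> (\<lambda>e. c e + d e) \<in> H1_int G"
  "c \<in> H1_int G \<Longrightarrow> (\<lambda>e. - c e) \<in> H1_int G"
  "c \<in> H1_int G \<Longrightarrow> d \<in> H1_int G \<Longrightarrow> (\<lambda>e. c e - d e) \<in> H1_int G"
  by (auto simp: H1_int_def chains_def boundary_add boundary_uminus boundary_diff)

context genus2_graph
begin

lemma edge_chain_chains: "a \<in> OE \<Longrightarrow> edge_chain a \<in> chains G"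
  by (auto simp: chains_def edge_chain_def oriented_edges_def)

lemma boundary_edge_chain:
  assumes "a \<in> OE"
  shows "boundary G (edge_chain a) v = of_bool (ter a = v) - of_bool (ini a = v)"
proof -
  have "boundary G (edge_chain a) v =
      (\<Sum>e\<in>arcs G. if e = fst a then (if snd a then 1 else -1) * (of_bool (head G e = v) - of_bool (tail G e = v)) else 0)"
    unfolding boundary_def edge_chain_def by (rule sum.cong) auto
  also have "\<dots> = (if snd a then 1 else -1) * (of_bool (head G (fst a) = v) - of_bool (tail G (fst a) = v))"
    using assms by (subst sum.delta) (auto simp: oriented_edges_def)
  also have "\<dots> = of_bool (ter a = v) - of_bool (ini a = v)"
    by (simp add: initial_vertex_def terminal_vertex_def)
  finally show ?thesis .
qed

lemma walk_chain:
  assumes "walk_via nb x p y"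
  shows "abelianization p \<in> chains G"
    "boundary G (abelianization p) v = of_bool (ini y = v) - of_bool (ini x = v)"
proof -
  have "abelianization p \<in> chains G \<and>
    boundary G (abelianization p) v = of_bool (ini y = v) - of_bool (ini x = v)"
    using assms
  proof (induction p arbitrary: x)
    case Nil
    then show ?case by (simp add: chains_def)
  next
    case (Cons a p)
    then obtain z where z: "a = x" "nb x z" "walk_via nb z p y" by auto
    then have x: "x \<in> OE" "ter x = ini z" by (auto simp: nonbacktracking_def)
    show ?case using Cons.IH[OF z(3)] z(1) boundary_edge_chain[OF x(1), of v] edge_chain_chains[OF x(1)] x(2)
      by (simp add: boundary_add chains_def)
  qed
  then show "abelianization p \<in> chains G"
    "boundary G (abelianization p) v = of_bool (ini y = v) - of_bool (ini x = v)" by blast+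
qed

lemma circuit_H1_int: "circuit G p \<Longrightarrow> abelianization p \<in> H1_int G"
  unfolding circuit_iff_walk_via H1_int_def
  using walk_chain[of "hd p" p "hd p"] abelianization_Ints by auto

lemma sum_edge_values:
  "(\<Sum>a | a \<in> OE \<and> ini a = v. edge_value c a) = - boundary G c v"
proof -
  have "(\<Sum>a | a \<in> OE \<and> ini a = v. edge_value c a) = (\<Sum>a\<in>arcs G \<times> UNIV. of_bool (ini a = v) * edge_value c a)"
    by (rule sum.mono_neutral_cong_left) (auto simp: oriented_edges_def)
  also have "\<dots> = (\<Sum>e\<in>arcs G. \<Sum>b\<in>UNIV. of_bool (ini (e, b) = v) * edge_value c (e, b))"
    unfolding sum.cartesian_product by (rule sum.cong) auto
  also have "\<dots> = (\<Sum>e\<in>arcs G. - (c e * (of_bool (head G e = v) - of_bool (tail G e = v))))"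
    by (rule sum.cong) (auto simp: UNIV_bool edge_value_def initial_vertex_def algebra_simps)
  finally show ?thesis by (simp add: boundary_def sum_negf)
qed

text \<open>Conservation at the terminal vertex of \<open>a\<close>: the outgoing values add up to 0
  and that of \<open>edge_inv a\<close> is negative, so some outgoing edge is positive. It does not
  backtrack, because inverse edges have opposite values.\<close>

lemma positive_support_serial:
  assumes c: "c \<in> H1_int G" and a: "a \<in> OE" "edge_value c a > 0"
  shows "\<exists>b. nb a b \<and> edge_value c b > 0"
proof -
  let ?A = "{b. b \<in> OE \<and> ini b = ter a}"
  have fin: "finite ?A" using finite_OE by simp
  have s: "(\<Sum>b\<in>?A. edge_value c b) = 0"
    using sum_edge_values[where v = "ter a" and c = c] c by (simp add: H1_int_def)
  have "edge_inv a \<in> ?A" "edge_value c (edge_inv a) < 0" using a by auto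
  have "\<exists>b\<in>?A. edge_value c b > 0"
  proof (rule ccontr)
    assume "\<not> ?thesis"
    then have le: "edge_value c b \<le> 0" if "b \<in> ?A" for b using that by force
    have "(\<Sum>b\<in>?A. edge_value c b) < (\<Sum>b\<in>?A. 0)"
      by (rule sum_strict_mono_ex1[OF fin])
        (use le \<open>edge_inv a \<in> ?A\<close> \<open>edge_value c (edge_inv a) < 0\<close> in blast)+
    then show False using s by simp
  qed
  then obtain b where b: "b \<in> OE" "ini b = ter a" "edge_value c b > 0" by blast
  moreover from this have "b \<noteq> edge_inv a" using a(2) by auto
  ultimately show ?thesis using a(1) by (auto simp: nonbacktracking_def)
qed

text \<open>In a closed walk of minimal length a repeated entry would cut off a shorter closed
  walk.\<close>

lemma distinct_closed_walk:
  assumes "R\<^sup>+\<^sup>+ a a"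
  shows "\<exists>b p. p \<noteq> [] \<and> distinct p \<and> walk_via R b p b"
proof -
  define Pk where "Pk = (\<lambda>k. \<exists>b p. p \<noteq> [] \<and> length p = k \<and> walk_via R b p b)"
  have "\<exists>k. Pk k" using assms walk_via_trancl[of R a a] unfolding Pk_def by blast
  then obtain k where k: "Pk k" and min: "\<And>j. j < k \<Longrightarrow> \<not> Pk j"
    using exists_least_iff[of Pk] by blast
  from k obtain b p where p: "p \<noteq> []" "length p = k" "walk_via R b p b" unfolding Pk_def by blast
  have "distinct p"
  proof (rule ccontr)
    assume "\<not> distinct p"
    then obtain xs ys zs y where "p = xs @ [y] @ ys @ [y] @ zs" using not_distinct_decomp by blast
    then have "walk_via R b (xs @ (y # ys) @ (y # zs)) b" using p(3) by simp
    then obtain z z' where z: "walk_via R z (y # ys) z'" "walk_via R z' (y # zs) b"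
      unfolding walk_via_append by blast
    have "z = y" "z' = y" using walk_via_start[OF z(1)] walk_via_start[OF z(2)] by simp_all
    then have "walk_via R y (y # ys) y" using z(1) by simp
    then have "Pk (length (y # ys))" unfolding Pk_def by blast
    then show False using min[of "length (y # ys)"] p(2) \<open>p = xs @ [y] @ ys @ [y] @ zs\<close> by simp
  qed
  then show ?thesis using p by blast
qed

lemma circuit_in_positive_support:
  assumes c: "c \<in> H1_int G" "c \<noteq> (\<lambda>e. 0)"
  shows "\<exists>p. circuit G p \<and> distinct p \<and> (\<forall>a\<in>set p. edge_value c a > 0)"
proof -
  define R where "R = (\<lambda>a b. nb a b \<and> edge_value c a > 0 \<and> edge_value c b > 0)"
  have "\<exists>a\<in>{a\<in>OE. edge_value c a > 0}. R\<^sup>+\<^sup>+ a a"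
  proof (rule serial_on_finite_has_cycle)
    show "finite {a\<in>OE. edge_value c a > 0}" using finite_OE by simp
    obtain e where e: "c e \<noteq> 0" using c(2) by auto
    then have "e \<in> arcs G" using c(1) by (auto simp: H1_int_def chains_def)
    then have "(e, c e > 0) \<in> {a\<in>OE. edge_value c a > 0}"
      using e by (auto simp: oriented_edges_def edge_value_def)
    then show "{a\<in>OE. edge_value c a > 0} \<noteq> {}" by blast
    fix a assume "a \<in> {a\<in>OE. edge_value c a > 0}"
    then show "\<exists>b\<in>{a\<in>OE. edge_value c a > 0}. R a b"
      using positive_support_serial[OF c(1), of a] nb_OE unfolding R_def by blast
  qed
  then obtain a where a: "R\<^sup>+\<^sup>+ a a" by blast
  obtain b p where p: "p \<noteq> []" "distinct p" "walk_via R b p b" using distinct_closed_walk[OF a] by blast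
  have imp: "walk_via nb x q y \<and> (\<forall>a\<in>set q. edge_value c a > 0)" if "walk_via R x q y" for x q y
    using that
  proof (induction q arbitrary: x)
    case (Cons d q)
    then obtain z where z: "d = x" "R x z" "walk_via R z q y" by auto
    then show ?case using Cons.IH[OF z(3)] by (simp add: R_def) blast
  qed simp
  note nb = imp[THEN conjunct1] and pos = imp[THEN conjunct2]
  have "hd p = b" using walk_via_iff_successively[OF p(1)] p(3) by blast
  then have "circuit G p" unfolding circuit_iff_walk_via using nb[OF p(3)] p(1) by simp
  then show ?thesis using pos[OF p(3)] p(2) by blast
qed

lemma abelianization_positive_support:
  assumes p: "distinct p" "\<forall>a\<in>set p. edge_value c a > 0"
  shows "abelianization p e = (if (e, True) \<in> set p then 1 else if (e, False) \<in> set p then -1 else 0)"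
proof -
  have "abelianization p e = (\<Sum>a\<in>set p. edge_chain a e)"
    unfolding abelianization_def using p(1) by (simp add: sum_list_distinct_conv_sum_set)
  also have "\<dots> = (\<Sum>a\<in>set p \<inter> {(e, True), (e, False)}. edge_chain a e)"
    by (rule sum.mono_neutral_right) (auto simp: edge_chain_def prod_eq_iff)
  also have "\<dots> = (if (e, True) \<in> set p then 1 else if (e, False) \<in> set p then -1 else 0)"
  proof -
    have "\<not> ((e, True) \<in> set p \<and> (e, False) \<in> set p)"
      using bspec[OF p(2), of "(e, True)"] bspec[OF p(2), of "(e, False)"] by (auto simp: edge_value_def)
    then show ?thesis by (auto simp: edge_chain_def Int_insert_right)
  qed
  finally show ?thesis .
qed

text \<open>Flow decomposition: subtracting a circuit along which \<open>c\<close> is positive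
  lowers the sum of the absolute values by at least 1. The set \<open>H\<close> has to be closed
  only under sums, which is what concatenation of walks provides, so the theorem serves as an
  induction rule for \<open>H1_int\<close>.\<close>

theorem circuits_generate_H1:
  assumes zero: "(\<lambda>e. 0) \<in> H" and add: "\<And>c d. c \<in> H \<Longrightarrow> d \<in> H \<Longrightarrow> (\<lambda>e. c e + d e) \<in> H"
    and circ: "\<And>p. circuit G p \<Longrightarrow> abelianization p \<in> H"
    and c: "c \<in> H1_int G"
  shows "c \<in> H"
  using c
proof (induction "nat \<lfloor>\<Sum>e\<in>arcs G. \<bar>c e\<bar>\<rfloor>" arbitrary: c rule: less_induct)
  case less
  show ?case
  proof (cases "c = (\<lambda>e. 0)")
    case True then show ?thesis using zero by simp
  next
    case False
    then obtain p where p: "circuit G p" "distinct p" "\<forall>a\<in>set p. edge_value c a > 0"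
      using circuit_in_positive_support less.prems by blast
    define d where "d = (\<lambda>e. c e - abelianization p e)"
    have dH: "d \<in> H1_int G" unfolding d_def using less.prems circuit_H1_int[OF p(1)] by (rule H1_int_closed)
    have ge: "\<bar>x\<bar> \<ge> 1" if "x \<noteq> 0" "x \<in> \<int>" for x :: real using that by (rule Ints_nonzero_abs_ge1[rotated])
    have int: "c e \<in> \<int>" for e using less.prems by (simp add: H1_int_def)
    \<comment> \<open>On an edge used by \<open>p\<close> the coefficient of \<open>c\<close> is a
      nonzero integer with the sign of the direction in which \<open>p\<close> runs through it, so
      subtracting \<open>p\<close> moves it towards 0.\<close>
    have dle: "\<bar>d e\<bar> \<le> \<bar>c e\<bar> - of_bool ((e, True) \<in> set p \<or> (e, False) \<in> set p)" for e
    proof (cases "(e, True) \<in> set p \<or> (e, False) \<in> set p")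
      case True
      then show ?thesis
        using abelianization_positive_support[OF p(2,3), of e] ge[of "c e", OF _ int]
          bspec[OF p(3), of "(e, True)"] bspec[OF p(3), of "(e, False)"]
        by (auto simp: d_def edge_value_def)
    next
      case False
      then show ?thesis using abelianization_positive_support[OF p(2,3), of e] by (simp add: d_def)
    qed
    have "p \<noteq> []" using p(1) by (simp add: circuit_def walk_def)
    then obtain a where a: "a \<in> set p" using hd_in_set by blast
    then have fa: "fst a \<in> arcs G" using p(1) by (auto simp: circuit_def walk_def oriented_edges_def)
    have fa': "(fst a, True) \<in> set p \<or> (fst a, False) \<in> set p" using a by (metis (full_types) prod.collapse)
    have "(\<Sum>e\<in>arcs G. \<bar>d e\<bar>) \<le> (\<Sum>e\<in>arcs G. \<bar>c e\<bar> - of_bool ((e, True) \<in> set p \<or> (e, False) \<in> set p))"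
      using dle by (rule sum_mono)
    also have "\<dots> \<le> (\<Sum>e\<in>arcs G. \<bar>c e\<bar>) - 1"
      using member_le_sum[OF fa, of "\<lambda>e. of_bool ((e, True) \<in> set p \<or> (e, False) \<in> set p) :: real"] fa'
      by (simp add: sum_subtractf)
    finally have le: "(\<Sum>e\<in>arcs G. \<bar>d e\<bar>) \<le> (\<Sum>e\<in>arcs G. \<bar>c e\<bar>) - 1" .
    have "0 \<le> (\<Sum>e\<in>arcs G. \<bar>d e\<bar>)" by (rule sum_nonneg) simp
    then have "nat \<lfloor>\<Sum>e\<in>arcs G. \<bar>d e\<bar>\<rfloor> < nat \<lfloor>\<Sum>e\<in>arcs G. \<bar>c e\<bar>\<rfloor>" using le by linarith
    then have "d \<in> H" using less.hyps dH by blast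
    then have "(\<lambda>e. d e + abelianization p e) \<in> H" using add circ[OF p(1)] by blast
    then show ?thesis by (simp add: d_def)
  qed
qed

text \<open>
  Pigeonhole principle: with coefficients up to \<open>B = (2 m + 1) ^ n\<close> there are more integral chains
  than possible boundaries, since there are more edges than vertices.
\<close>

lemma H1_int_nontrivial: "\<exists>c\<in>H1_int G. c \<noteq> (\<lambda>e. 0)"
proof -
  define m n where "m = card (arcs G)" and "n = card (verts G)"
  define B :: int where "B = (2 * int m + 1) ^ n"
  define F where "F = PiE (arcs G) (\<lambda>_. {0..B})"
  define T where "T = PiE (verts G) (\<lambda>_. {- (int m * B)..int m * B})"
  define bd where "bd = (\<lambda>f::'e \<Rightarrow> int. \<lambda>v\<in>verts G. \<Sum>e\<in>arcs G. f e * (of_bool (head G e = v) - of_bool (tail G e = v)))"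
  have B: "B \<ge> 1" by (simp add: B_def)
  have finT: "finite T" unfolding T_def by (rule finite_PiE) auto
  have "bd ` F \<subseteq> T"
  proof
    fix g assume "g \<in> bd ` F"
    then obtain f where f: "f \<in> F" "g = bd f" by blast
    have "\<bar>\<Sum>e\<in>arcs G. f e * (of_bool (head G e = v) - of_bool (tail G e = v))\<bar> \<le> int m * B" for v
    proof -
      have "\<bar>\<Sum>e\<in>arcs G. f e * (of_bool (head G e = v) - of_bool (tail G e = v))\<bar>
          \<le> (\<Sum>e\<in>arcs G. \<bar>f e * (of_bool (head G e = v) - of_bool (tail G e = v))\<bar>)" by (rule sum_abs)
      also have "\<dots> \<le> (\<Sum>e\<in>arcs G. B)"
      proof (rule sum_mono)
        fix e assume "e \<in> arcs G"
        then have "0 \<le> f e" "f e \<le> B" using f(1) unfolding F_def by (auto dest: PiE_mem)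
        then show "\<bar>f e * (of_bool (head G e = v) - of_bool (tail G e = v))\<bar> \<le> B" using B by auto
      qed
      finally show ?thesis by (simp add: m_def)
    qed
    then show "g \<in> T" unfolding f(2) bd_def T_def by (auto simp: abs_le_iff minus_le_iff)
  qed
  moreover have "card T < card F"
  proof -
    have mn: "m \<ge> n + 1" using card_arcs by (simp add: m_def n_def)
    have "card T = nat (2 * (int m * B) + 1) ^ n"
      unfolding T_def n_def by (subst card_PiE) (auto simp: algebra_simps)
    moreover have "card F = nat (B + 1) ^ m" unfolding F_def m_def using B by (subst card_PiE) auto
    moreover have "int (nat (2 * (int m * B) + 1) ^ n) < int (nat (B + 1) ^ m)"
    proof -
      have "int (nat (2 * (int m * B) + 1) ^ n) = (2 * (int m * B) + 1) ^ n" using B by simp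
      also have "\<dots> \<le> ((2 * int m + 1) * B) ^ n" using B by (intro power_mono) (auto simp: algebra_simps)
      \<comment> \<open>This equation dictates the value of \<open>B\<close>: the loss
        \<open>(2 * m + 1) ^ n\<close> from the spread of the boundaries becomes one more power of
        \<open>B\<close>, which the surplus edge pays for.\<close>
      also have "\<dots> = B * B ^ n" by (simp add: power_mult_distrib B_def)
      also have "\<dots> < (B + 1) * (B + 1) ^ n"
        using B by (intro mult_less_le_imp_less power_mono) auto
      also have "\<dots> = (B + 1) ^ (n + 1)" by simp
      also have "\<dots> \<le> (B + 1) ^ m" using mn B by (intro power_increasing) auto
      finally show ?thesis using B by simp
    qed
    ultimately show ?thesis by linarith
  qed
  ultimately have "\<not> inj_on bd F" using card_inj_on_le finT by (metis leD)
  then obtain f g where fg: "f \<in> F" "g \<in> F" "bd f = bd g" "f \<noteq> g" unfolding inj_on_def by blast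
  define c where "c = (\<lambda>e. if e \<in> arcs G then real_of_int (f e - g e) else 0)"
  have "boundary G c v = 0" for v
  proof (cases "v \<in> verts G")
    case True
    have "(\<Sum>e\<in>arcs G. f e * (of_bool (head G e = v) - of_bool (tail G e = v))) =
        (\<Sum>e\<in>arcs G. g e * (of_bool (head G e = v) - of_bool (tail G e = v)))"
      using fun_cong[OF fg(3), of v] True by (simp add: bd_def)
    then have "(\<Sum>e\<in>arcs G. (f e - g e) * (of_bool (head G e = v) - of_bool (tail G e = v))) = 0"
      by (simp add: sum_subtractf algebra_simps)
    then have "real_of_int (\<Sum>e\<in>arcs G. (f e - g e) * (of_bool (head G e = v) - of_bool (tail G e = v))) = 0"
      by simp
    moreover have "boundary G c v = real_of_int (\<Sum>e\<in>arcs G. (f e - g e) * (of_bool (head G e = v) - of_bool (tail G e = v)))"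
      unfolding boundary_def c_def of_int_sum by (rule sum.cong) auto
    ultimately show ?thesis by simp
  next
    case False
    then have "head G e \<noteq> v" "tail G e \<noteq> v" if "e \<in> arcs G" for e using that by auto
    then show ?thesis unfolding boundary_def by (intro sum.neutral) auto
  qed
  then have "c \<in> H1_int G" by (auto simp: H1_int_def chains_def c_def)
  moreover have "c \<noteq> (\<lambda>e. 0)"
  proof
    assume "c = (\<lambda>e. 0)"
    then have "f e = g e" if "e \<in> arcs G" for e using that by (metis c_def cancel_comm_monoid_add_class.diff_cancel of_int_eq_0_iff right_minus_eq)
    then have "f = g" using fg(1,2) unfolding F_def by (intro PiE_ext)
    then show False using fg(4) by simp
  qed
  ultimately show ?thesis by blast
qed

lemma core_nonempty: "core \<noteq> {}"
proof -
  obtain c where "c \<in> H1_int G" "c \<noteq> (\<lambda>e. 0)" using H1_int_nontrivial by blast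
  then obtain p where "circuit G p" using circuit_in_positive_support by blast
  then show ?thesis using circuit_iff_core by blast
qed

text \<open>A substitute for a spanning tree: an integral chain from \<open>v0\<close> to each
  vertex, propagated along the edges by connectedness.\<close>

lemma potential_exists:
  "\<exists>s. \<forall>v\<in>verts G. s v \<in> chains G \<and> (\<forall>e. s v e \<in> \<int>) \<and>
     (\<forall>w. boundary G (s v) w = of_bool (v = w) - of_bool (v0 = w))"
  if v0: "v0 \<in> verts G"
proof -
  define Pt where "Pt = (\<lambda>v c. c \<in> chains G \<and> (\<forall>e. c e \<in> \<int>) \<and>
     (\<forall>w. boundary G c w = of_bool (v = w) - of_bool (v0 = w)))"
  have "{v\<in>verts G. \<exists>c. Pt v c} = verts G"
  proof (rule adjacency_closed_eq_verts)
    have "Pt v0 (\<lambda>e. 0)" by (simp add: Pt_def chains_def)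
    then show "{v\<in>verts G. \<exists>c. Pt v c} \<noteq> {}" using v0 by blast
    fix a assume a: "a \<in> OE" "ini a \<in> {v\<in>verts G. \<exists>c. Pt v c}"
    then obtain c where c: "Pt (ini a) c" by blast
    have "Pt (ter a) (\<lambda>e. c e + edge_chain a e)"
      using c edge_chain_chains[OF a(1)] boundary_edge_chain[OF a(1)] abelianization_Ints[of "[a]"]
      unfolding Pt_def by (auto simp: boundary_add chains_def)
    then show "ter a \<in> {v\<in>verts G. \<exists>c. Pt v c}" using vertices_in(2)[OF a(1)] by blast
  qed simp
  then have "\<forall>v\<in>verts G. \<exists>c. Pt v c" by blast
  from bchoice[OF this] show ?thesis unfolding Pt_def by blast
qed

end

section \<open>Harmonic forms and characters\<close>

definition additively_closed :: "('e \<Rightarrow> real) set \<Rightarrow> bool" where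
  "additively_closed V \<longleftrightarrow> (\<lambda>e. 0) \<in> V \<and> (\<forall>c\<in>V. \<forall>d\<in>V. (\<lambda>e. c e + d e) \<in> V) \<and> (\<forall>c\<in>V. (\<lambda>e. - c e) \<in> V)"

lemma additively_closedD:
  assumes "additively_closed V"
  shows "(\<lambda>e. 0) \<in> V" "c \<in> V \<Longrightarrow> d \<in> V \<Longrightarrow> (\<lambda>e. c e + d e) \<in> V" "c \<in> V \<Longrightarrow> (\<lambda>e. - c e) \<in> V"
    "c \<in> V \<Longrightarrow> d \<in> V \<Longrightarrow> (\<lambda>e. c e - d e) \<in> V"
proof -
  show 1: "(\<lambda>e. 0) \<in> V" "c \<in> V \<Longrightarrow> d \<in> V \<Longrightarrow> (\<lambda>e. c e + d e) \<in> V" "c \<in> V \<Longrightarrow> (\<lambda>e. - c e) \<in> V" for c d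
    using assms unfolding additively_closed_def by blast+
  show "c \<in> V \<Longrightarrow> d \<in> V \<Longrightarrow> (\<lambda>e. c e - d e) \<in> V" using 1(2)[of c "\<lambda>e. - d e"] 1(3)[of d] by simp
qed

lemma comm_group_pointwise_add:
  assumes "additively_closed V"
  shows "comm_group (pointwise_add_group V)"
proof (rule comm_groupI)
  fix x assume "x \<in> carrier (pointwise_add_group V)"
  then show "\<exists>y\<in>carrier (pointwise_add_group V). y \<otimes>\<^bsub>pointwise_add_group V\<^esub> x = \<one>\<^bsub>pointwise_add_group V\<^esub>"
    using additively_closedD(3)[OF assms, of x]
    by (intro bexI[of _ "\<lambda>e. - x e"]) (auto simp: pointwise_add_group_def)
qed (use additively_closedD[OF assms] in \<open>auto simp: pointwise_add_group_def fun_eq_iff\<close>)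

lemma inv_pointwise_add:
  assumes "additively_closed V" "c \<in> V"
  shows "inv\<^bsub>pointwise_add_group V\<^esub> c = (\<lambda>e. - c e)"
proof -
  interpret comm_group "pointwise_add_group V" by (rule comm_group_pointwise_add[OF assms(1)])
  show ?thesis
    by (rule inv_equality) (use assms additively_closedD(3)[OF assms] in \<open>auto simp: pointwise_add_group_def\<close>)
qed

lemma subgroup_pointwise_add_iff:
  assumes V: "additively_closed V"
  shows "subgroup L (pointwise_add_group V) \<longleftrightarrow> L \<subseteq> V \<and> additively_closed L"
proof
  assume "subgroup L (pointwise_add_group V)"
  then interpret subgroup L "pointwise_add_group V" .
  have LV: "L \<subseteq> V" using subset by (simp add: pointwise_add_group_def)
  have "(\<lambda>e. - c e) \<in> L" if "c \<in> L" for c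
    using m_inv_closed[OF that] unfolding inv_pointwise_add[OF V subsetD[OF LV that]] .
  then show "L \<subseteq> V \<and> additively_closed L"
    using LV one_closed m_closed unfolding additively_closed_def by (auto simp: pointwise_add_group_def)
next
  assume L: "L \<subseteq> V \<and> additively_closed L"
  have "inv\<^bsub>pointwise_add_group V\<^esub> c = (\<lambda>e. - c e)" if "c \<in> L" for c
    using inv_pointwise_add[OF V] L that by blast
  then show "subgroup L (pointwise_add_group V)"
    using L additively_closedD[of L] by unfold_locales (auto simp: pointwise_add_group_def)
qed

lemma mem_pointwise_coset:
  "x \<in> L #>\<^bsub>pointwise_add_group V\<^esub> c \<longleftrightarrow> (\<lambda>e. x e - c e) \<in> L"
proof
  assume "(\<lambda>e. x e - c e) \<in> L"
  then show "x \<in> L #>\<^bsub>pointwise_add_group V\<^esub> c"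
    unfolding r_coset_def pointwise_add_group_def
    by (simp add: bexI[of _ "\<lambda>e. x e - c e"])
qed (auto simp: r_coset_def pointwise_add_group_def)

lemma pointwise_coset_eq_iff:
  assumes "additively_closed L"
  shows "L #>\<^bsub>pointwise_add_group V\<^esub> c = L #>\<^bsub>pointwise_add_group V\<^esub> d \<longleftrightarrow> (\<lambda>e. c e - d e) \<in> L"
proof
  assume "L #>\<^bsub>pointwise_add_group V\<^esub> c = L #>\<^bsub>pointwise_add_group V\<^esub> d"
  moreover have "c \<in> L #>\<^bsub>pointwise_add_group V\<^esub> c"
    using additively_closedD(1)[OF assms] by (simp add: mem_pointwise_coset)
  ultimately show "(\<lambda>e. c e - d e) \<in> L" by (simp add: mem_pointwise_coset)
next
  assume cd: "(\<lambda>e. c e - d e) \<in> L"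
  show "L #>\<^bsub>pointwise_add_group V\<^esub> c = L #>\<^bsub>pointwise_add_group V\<^esub> d"
  proof (rule Set.set_eqI)
    fix x
    have "(\<lambda>e. x e - d e) \<in> L" if "(\<lambda>e. x e - c e) \<in> L"
      using additively_closedD(2)[OF assms that cd] by simp
    moreover have "(\<lambda>e. x e - c e) \<in> L" if "(\<lambda>e. x e - d e) \<in> L"
      using additively_closedD(4)[OF assms that cd] by simp
    ultimately show "x \<in> L #>\<^bsub>pointwise_add_group V\<^esub> c \<longleftrightarrow> x \<in> L #>\<^bsub>pointwise_add_group V\<^esub> d"
      unfolding mem_pointwise_coset by blast
  qed
qed

lemma pointwise_coset_mult:
  assumes "additively_closed V" "subgroup L (pointwise_add_group V)" "c \<in> V" "d \<in> V"
  shows "(L #>\<^bsub>pointwise_add_group V\<^esub> c) \<otimes>\<^bsub>pointwise_add_group V Mod L\<^esub> (L #>\<^bsub>pointwise_add_group V\<^esub> d) =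
    L #>\<^bsub>pointwise_add_group V\<^esub> (\<lambda>e. c e + d e)"
proof -
  interpret comm_group "pointwise_add_group V" by (rule comm_group_pointwise_add[OF assms(1)])
  interpret normal L "pointwise_add_group V" using assms(2) by (rule subgroup_imp_normal)
  show ?thesis
    using rcos_sum[of c d] assms by (simp add: FactGroup_def) (simp add: pointwise_add_group_def)
qed

lemma form_eval_linear:
  "form_eval G (\<lambda>e. \<omega> e + \<eta> e) c = form_eval G \<omega> c + form_eval G \<eta> c"
  "form_eval G (\<lambda>e. \<omega> e - \<eta> e) c = form_eval G \<omega> c - form_eval G \<eta> c"
  "form_eval G (\<lambda>e. - \<omega> e) c = - form_eval G \<omega> c"
  "form_eval G \<omega> (\<lambda>e. c e + d e) = form_eval G \<omega> c + form_eval G \<omega> d"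
  "form_eval G \<omega> (\<lambda>e. c e - d e) = form_eval G \<omega> c - form_eval G \<omega> d"
  by (simp_all add: form_eval_def algebra_simps sum.distrib sum_subtractf sum_negf)

lemma additively_closed_H1_int: "additively_closed (H1_int G)"
  unfolding additively_closed_def using H1_int_closed by blast

text \<open>Gram-Schmidt by induction on the index set: both \<omega> and the new vector
  \<open>d k\<close> are first reduced to residuals \<open>y\<close> and \<open>x\<close> orthogonal
  to the earlier vectors, and then \<open>y\<close> is corrected along \<open>x\<close>.\<close>

lemma orthogonal_projection_exists:
  fixes d :: "'i \<Rightarrow> 'e \<Rightarrow> real"
  assumes "finite I" "finite A"
  shows "\<exists>c. \<forall>j\<in>I. (\<Sum>e\<in>A. (\<omega> e - (\<Sum>i\<in>I. c i * d i e)) * d j e) = 0"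
  using assms(1)
proof (induction I arbitrary: \<omega> rule: finite_induct)
  case empty
  then show ?case by simp
next
  case (insert k I)
  define ip where "ip = (\<lambda>f g :: 'e \<Rightarrow> real. \<Sum>e\<in>A. f e * g e)"
  define lin where "lin = (\<lambda>c e. \<Sum>i\<in>I. c i * d i e)"
  obtain c where c: "\<And>j. j \<in> I \<Longrightarrow> ip (\<lambda>e. d k e - lin c e) (d j) = 0"
    using insert.IH[of "d k"] unfolding ip_def lin_def by blast
  obtain a where a: "\<And>j. j \<in> I \<Longrightarrow> ip (\<lambda>e. \<omega> e - lin a e) (d j) = 0"
    using insert.IH[of \<omega>] unfolding ip_def lin_def by blast
  define x where "x = (\<lambda>e. d k e - lin c e)"
  define y where "y = (\<lambda>e. \<omega> e - lin a e)"
  \<comment> \<open>If \<open>d k\<close> depends on the earlier vectors, then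
    \<open>ip x x = 0\<close> and the quotient is 0 by convention; \<open>x\<close> vanishes on
    \<open>A\<close> in this case, so orthogonality to it is automatic.\<close>
  define t where "t = ip y x / ip x x"
  have ip_lin: "ip f (lin b) = (\<Sum>i\<in>I. b i * ip f (d i))" for f b
  proof -
    have "ip f (lin b) = (\<Sum>e\<in>A. \<Sum>i\<in>I. b i * (f e * d i e))"
      by (simp add: ip_def lin_def sum_distrib_left algebra_simps)
    also have "\<dots> = (\<Sum>i\<in>I. \<Sum>e\<in>A. b i * (f e * d i e))" by (rule sum.swap)
    finally show ?thesis by (simp add: ip_def sum_distrib_left)
  qed
  have ip_diff: "ip (\<lambda>e. y e - t * x e) g = ip y g - t * ip x g" for g
    by (simp add: ip_def sum_subtractf sum_distrib_left algebra_simps)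
  have orth: "ip (\<lambda>e. y e - t * x e) (d j) = 0" if "j \<in> I" for j
    using a[OF that] c[OF that] ip_diff by (simp add: x_def y_def)
  have "ip y x - t * ip x x = 0"
  proof (cases "ip x x = 0")
    case True
    then have "x e = 0" if "e \<in> A" for e
      using that assms(2) sum_nonneg_eq_0_iff[of A "\<lambda>e. x e * x e"] by (simp add: ip_def)
    then have "ip y x = 0" by (simp add: ip_def)
    then show ?thesis using True by simp
  qed (simp add: t_def)
  then have "ip (\<lambda>e. y e - t * x e) x = 0" using ip_diff by simp
  moreover have "d k = (\<lambda>e. x e + lin c e)" by (simp add: x_def)
  moreover have "ip f (\<lambda>e. x e + lin c e) = ip f x + ip f (lin c)" for f
    by (simp add: ip_def sum.distrib algebra_simps)
  ultimately have orth_k: "ip (\<lambda>e. y e - t * x e) (d k) = 0" using orth by (simp add: ip_lin)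
  define b where "b = (\<lambda>i. if i = k then t else a i - t * c i)"
  have "(\<Sum>i\<in>insert k I. b i * d i e) = t * d k e + (\<Sum>i\<in>I. (a i - t * c i) * d i e)" for e
  proof -
    have "(\<Sum>i\<in>I. b i * d i e) = (\<Sum>i\<in>I. (a i - t * c i) * d i e)"
      using insert.hyps by (intro sum.cong) (auto simp: b_def)
    then show ?thesis using insert.hyps by (simp add: b_def)
  qed
  then have "\<omega> e - (\<Sum>i\<in>insert k I. b i * d i e) = y e - t * x e" for e
    by (simp add: y_def x_def lin_def algebra_simps sum_subtractf sum_distrib_left)
  then show ?case using orth orth_k unfolding ip_def by (intro exI[of _ b]) simp
qed

section \<open>Discrete Hodge decomposition and the canonical character\<close>

context genus2_graph
begin

lemma sum_vertex_indicator: "w \<in> verts G \<Longrightarrow> (\<Sum>v\<in>verts G. f v * of_bool (w = v)) = (f w :: real)"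
proof -
  assume w: "w \<in> verts G"
  have "(\<Sum>v\<in>verts G. f v * of_bool (w = v)) = (\<Sum>v\<in>verts G. if w = v then f w else 0)"
    by (rule sum.cong) auto
  then show ?thesis using w by simp
qed

text \<open>Discrete Stokes formula. It makes exact forms vanish on cycles and exhibits harmonic
  forms as the orthogonal complement of exact ones.\<close>

lemma form_eval_differential:
  "form_eval G (differential G f) c = (\<Sum>v\<in>verts G. f v * boundary G c v)"
proof -
  have "(\<Sum>v\<in>verts G. f v * boundary G c v) =
      (\<Sum>v\<in>verts G. \<Sum>e\<in>arcs G. c e * (f v * of_bool (head G e = v) - f v * of_bool (tail G e = v)))"
    unfolding boundary_def sum_distrib_left by (intro sum.cong) (auto simp: algebra_simps)
  also have "\<dots> = (\<Sum>e\<in>arcs G. \<Sum>v\<in>verts G. c e * (f v * of_bool (head G e = v) - f v * of_bool (tail G e = v)))"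
    by (rule sum.swap)
  also have "\<dots> = (\<Sum>e\<in>arcs G. c e * (f (head G e) - f (tail G e)))"
    by (rule sum.cong) (simp_all add: sum_distrib_left[symmetric] sum_subtractf sum_vertex_indicator)
  also have "\<dots> = form_eval G (differential G f) c"
    unfolding form_eval_def differential_def by (rule sum.cong) auto
  finally show ?thesis by simp
qed

text \<open>Chains and forms share one representation by coefficients, in which harmonicity of a
  form becomes the cycle condition on a chain.\<close>

lemma harmonic_forms_iff:
  "\<eta> \<in> harmonic_forms G \<longleftrightarrow> \<eta> \<in> forms G \<and> (\<forall>v\<in>verts G. boundary G \<eta> v = 0)"
proof -
  have "form_eval G \<eta> (edge_chain a) = edge_value \<eta> a" if "a \<in> OE" for a
  proof -
    have "form_eval G \<eta> (edge_chain a) = (\<Sum>e\<in>arcs G. if e = fst a then edge_value \<eta> a else 0)"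
      unfolding form_eval_def by (rule sum.cong) (auto simp: edge_chain_def edge_value_def)
    then show ?thesis using that by (auto simp: oriented_edges_def)
  qed
  then have "(\<Sum>a | a \<in> OE \<and> ini a = v. form_eval G \<eta> (edge_chain a)) = - boundary G \<eta> v" for v
    using sum_edge_values[where v = v and c = \<eta>] by simp
  then show ?thesis by (simp add: harmonic_forms_def)
qed

lemma harmonic_decomposition_exists:
  assumes "\<omega> \<in> forms G"
  shows "\<exists>\<eta>. \<eta> \<in> harmonic_forms G \<and> (\<lambda>e. \<omega> e - \<eta> e) \<in> exact_forms G"
proof -
  define d where "d = (\<lambda>w. differential G (\<lambda>v. of_bool (v = w)))"
  obtain c where c: "\<And>v. v \<in> verts G \<Longrightarrow> (\<Sum>e\<in>arcs G. (\<omega> e - (\<Sum>w\<in>verts G. c w * d w e)) * d v e) = 0"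
    using orthogonal_projection_exists[of "verts G" "arcs G" \<omega> d] by auto
  define \<eta> where "\<eta> = (\<lambda>e. \<omega> e - (\<Sum>w\<in>verts G. c w * d w e))"
  have "boundary G \<eta> v = 0" if v: "v \<in> verts G" for v
  proof -
    have "0 = (\<Sum>e\<in>arcs G. d v e * \<eta> e)" using c[OF v] by (simp add: \<eta>_def mult.commute)
    also have "\<dots> = form_eval G (d v) \<eta>" by (simp add: form_eval_def)
    also have "\<dots> = (\<Sum>w\<in>verts G. if w = v then boundary G \<eta> v else 0)"
      unfolding d_def form_eval_differential by (rule sum.cong) auto
    finally show ?thesis using v by simp
  qed
  moreover have "\<eta> \<in> forms G" using assms by (auto simp: forms_def \<eta>_def d_def differential_def)
  moreover have "(\<lambda>e. \<omega> e - \<eta> e) = differential G c"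
  proof
    fix e
    show "\<omega> e - \<eta> e = differential G c e"
    proof (cases "e \<in> arcs G")
      case True
      then have "(\<Sum>w\<in>verts G. c w * d w e) = (\<Sum>w\<in>verts G. c w * of_bool (head G e = w)) - (\<Sum>w\<in>verts G. c w * of_bool (tail G e = w))"
        by (simp add: d_def differential_def sum_subtractf right_diff_distrib)
      then show ?thesis using True sum_vertex_indicator by (simp add: \<eta>_def differential_def)
    qed (simp add: \<eta>_def d_def differential_def)
  qed
  ultimately show ?thesis unfolding harmonic_forms_iff exact_forms_def by blast
qed

lemma harmonic_decomposition_unique:
  assumes "\<eta> \<in> harmonic_forms G" "(\<lambda>e. \<omega> e - \<eta> e) \<in> exact_forms G"
    and "\<eta>' \<in> harmonic_forms G" "(\<lambda>e. \<omega> e - \<eta>' e) \<in> exact_forms G"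
  shows "\<eta> = \<eta>'"
proof -
  define \<delta> where "\<delta> = (\<lambda>e. \<eta> e - \<eta>' e)"
  obtain f f' where f: "(\<lambda>e. \<omega> e - \<eta> e) = differential G f" "(\<lambda>e. \<omega> e - \<eta>' e) = differential G f'"
    using assms unfolding exact_forms_def by auto
  have "\<delta> e = differential G f' e - differential G f e" for e
    unfolding f[symmetric] by (simp add: \<delta>_def)
  then have "\<delta> = differential G (\<lambda>v. f' v - f v)"
    by (auto simp: differential_def fun_eq_iff)
  then have "form_eval G \<delta> \<delta> = (\<Sum>v\<in>verts G. (f' v - f v) * boundary G \<delta> v)"
    using form_eval_differential[of "\<lambda>v. f' v - f v" \<delta>] by simp
  also have "\<dots> = 0" using assms by (auto simp: \<delta>_def harmonic_forms_iff boundary_diff)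
  finally have "(\<Sum>e\<in>arcs G. \<delta> e * \<delta> e) = 0" by (simp add: form_eval_def)
  then have "\<delta> e = 0" if "e \<in> arcs G" for e using that by (subst (asm) sum_nonneg_eq_0_iff) auto
  moreover have "\<eta> e = 0" "\<eta>' e = 0" if "e \<notin> arcs G" for e
    using assms that by (auto simp: harmonic_forms_def forms_def)
  ultimately have "\<eta> e = \<eta>' e" for e by (cases "e \<in> arcs G") (auto simp: \<delta>_def)
  then show ?thesis by blast
qed

text \<open>Exact forms vanish on cycles, so every pairing of \<phi>_1(\<omega>) with homology may
  be computed with \<omega> itself.\<close>

lemma harmonic_part:
  assumes "\<omega> \<in> forms G"
  shows "harmonic_part G \<omega> \<in> harmonic_forms G"
    "c \<in> H1_int G \<Longrightarrow> form_eval G (harmonic_part G \<omega>) c = form_eval G \<omega> c"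
proof -
  let ?P = "\<lambda>\<eta>. \<eta> \<in> harmonic_forms G \<and> (\<lambda>e. \<omega> e - \<eta> e) \<in> exact_forms G"
  have "\<exists>!\<eta>. ?P \<eta>"
    using harmonic_decomposition_exists[OF assms] harmonic_decomposition_unique by blast
  then have hp: "?P (harmonic_part G \<omega>)" unfolding harmonic_part_def by (rule theI')
  then show "harmonic_part G \<omega> \<in> harmonic_forms G" by blast
  assume c: "c \<in> H1_int G"
  obtain f where "(\<lambda>e. \<omega> e - harmonic_part G \<omega> e) = differential G f"
    using hp by (auto simp: exact_forms_def)
  then have "form_eval G (\<lambda>e. \<omega> e - harmonic_part G \<omega> e) c = 0"
    using form_eval_differential[of f c] c by (simp add: H1_int_def)
  then show "form_eval G (harmonic_part G \<omega>) c = form_eval G \<omega> c" by (simp add: form_eval_linear)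
qed

lemma additively_closed_harmonic: "additively_closed (harmonic_forms G)"
  unfolding additively_closed_def
  by (auto simp: harmonic_forms_iff forms_def boundary_add boundary_uminus)

lemma additively_closed_dual_lattice: "additively_closed (dual_lattice G L)"
  unfolding additively_closed_def dual_lattice_def
  using additively_closedD[OF additively_closed_harmonic]
  by (auto simp: form_eval_linear) (simp add: form_eval_def)

lemma harmonic_coset_eq_iff:
  "harmonic_coset G \<eta> = harmonic_coset G \<eta>' \<longleftrightarrow> (\<lambda>e. \<eta> e - \<eta>' e) \<in> dual_lattice G (H1_int G)"
  unfolding harmonic_coset_def by (rule pointwise_coset_eq_iff[OF additively_closed_dual_lattice])

lemma harmonic_coset_mult:
  assumes "\<eta> \<in> harmonic_forms G" "\<eta>' \<in> harmonic_forms G"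
  shows "harmonic_coset G \<eta> \<otimes>\<^bsub>character_group G\<^esub> harmonic_coset G \<eta>' = harmonic_coset G (\<lambda>e. \<eta> e + \<eta>' e)"
  unfolding harmonic_coset_def character_group_def
  by (rule pointwise_coset_mult)
    (use assms additively_closed_harmonic additively_closed_dual_lattice[of "H1_int G"] in
      \<open>auto simp: subgroup_pointwise_add_iff dual_lattice_def\<close>)

lemma one_character_group: "\<one>\<^bsub>character_group G\<^esub> = harmonic_coset G (\<lambda>e. 0)"
proof -
  have "harmonic_coset G (\<lambda>e. 0) = dual_lattice G (H1_int G)"
    by (auto simp: harmonic_coset_def mem_pointwise_coset)
  then show ?thesis by (simp add: character_group_def FactGroup_def)
qed

lemma orientation_form: "orientation_form G \<in> forms G"
  by (simp add: orientation_form_def forms_def)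

text \<open>Twice the pairing with the form \<omega>_O. Every oriented edge contributes 1 or -1, so
  on a circuit it has the parity of the length; this is how \<theta> detects parity. Congruence
  modulo 2 is expressed by integrality of half the difference.\<close>

definition edge_sum :: "('e \<Rightarrow> real) \<Rightarrow> real" where
  "edge_sum c = (\<Sum>e\<in>arcs G. c e)"

lemma form_eval_orientation: "form_eval G (orientation_form G) c = edge_sum c / 2"
  by (simp add: form_eval_def orientation_form_def edge_sum_def sum_divide_distrib)

lemma edge_sum_Ints: "c \<in> H1_int G \<Longrightarrow> edge_sum c \<in> \<int>"
  unfolding edge_sum_def by (auto simp: H1_int_def intro!: Ints_sum)

lemma edge_sum_linear:
  "edge_sum (\<lambda>e. c e + d e) = edge_sum c + edge_sum d" "edge_sum (\<lambda>e. c e - d e) = edge_sum c - edge_sum d"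
  by (simp_all add: edge_sum_def sum.distrib sum_subtractf)

lemma edge_sum_length: "set p \<subseteq> OE \<Longrightarrow> (edge_sum (abelianization p) - real (length p)) / 2 \<in> \<int>"
proof (induction p)
  case Nil
  then show ?case by (simp add: edge_sum_def)
next
  case (Cons a p)
  have "edge_sum (edge_chain a) = (\<Sum>e\<in>arcs G. if e = fst a then (if snd a then 1 else -1) else 0)"
    unfolding edge_sum_def edge_chain_def by (rule sum.cong) auto
  also have "\<dots> = (if snd a then 1 else -1)" using Cons.prems by (subst sum.delta) (auto simp: oriented_edges_def)
  finally have "(edge_sum (edge_chain a) - 1) / 2 \<in> \<int>" by simp
  moreover have "(edge_sum (abelianization p) - real (length p)) / 2 \<in> \<int>" using Cons by simp
  moreover have "(edge_sum (abelianization (a # p)) - real (length (a # p))) / 2 =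
    (edge_sum (edge_chain a) - 1) / 2 + (edge_sum (abelianization p) - real (length p)) / 2"
    by (simp add: edge_sum_linear field_simps)
  ultimately show ?case using Ints_add by metis
qed

end

section \<open>Circuits in a class of the homology quotient\<close>

lemma tendsto_residue_class:
  fixes f :: "nat \<Rightarrow> real"
  assumes lim: "(\<lambda>n. f (n * D + j)) \<longlonglongrightarrow> c" and D: "D > 0" and S: "\<And>l. l \<in> S \<Longrightarrow> l mod D = j mod D" and j: "j < D"
  shows "(f \<longlongrightarrow> c) (inf sequentially (principal S))"
proof -
  have "((\<lambda>l. f (l div D * D + j)) \<longlongrightarrow> c) sequentially"
    by (rule filterlim_compose[OF lim]) (rule filterlim_at_top_div_const_nat[OF D])
  then have "((\<lambda>l. f (l div D * D + j)) \<longlongrightarrow> c) (inf sequentially (principal S))"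
    by (rule tendsto_mono[rotated]) simp
  moreover have "\<forall>\<^sub>F l in inf sequentially (principal S). f (l div D * D + j) = f l"
  proof -
    have "f (l div D * D + j) = f l" if "l \<in> S" for l
      using S[OF that] j div_mult_mod_eq[of l D] by simp
    then show ?thesis by (simp add: eventually_inf_principal)
  qed
  ultimately show ?thesis by (rule Lim_transform_eventually)
qed

text \<open>The potentials \<open>s\<close> and the Perron data \<open>r\<close>, \<open>u\<close>
  are auxiliary choices, fixed here as parameters so that later definitions can refer to them;
  \<open>covered_graph_exists\<close> supplies them.\<close>

locale covered_graph = genus2_graph G for G :: "('v, 'e) pre_digraph" +
  fixes \<Lambda> :: "('e \<Rightarrow> real) set" and s :: "'v \<Rightarrow> 'e \<Rightarrow> real" and r :: real and u :: "'e \<times> bool \<Rightarrow> real" and v0 :: 'v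
  assumes \<Lambda>: "subgroup \<Lambda> (homology_group G)" and finQ: "finite (carrier (quotient_group G \<Lambda>))"
    and s: "\<And>v. v \<in> verts G \<Longrightarrow> s v \<in> chains G \<and> (\<forall>e. s v e \<in> \<int>) \<and>
       (\<forall>w. boundary G (s v) w = of_bool (v = w) - of_bool (v0 = w))"
    and r_pos: "r > 0" and u_pos: "\<And>a. a \<in> core \<Longrightarrow> u a > 0"
    and perron: "\<And>a. a \<in> core \<Longrightarrow> r * u a = (\<Sum>b\<in>{b\<in>core. nb a b}. u b)"
begin

abbreviation Q where "Q \<equiv> quotient_group G \<Lambda>"
abbreviation coset where "coset \<equiv> homology_coset G \<Lambda>"

lemma \<Lambda>_H1: "\<Lambda> \<subseteq> H1_int G" and \<Lambda>_closed: "additively_closed \<Lambda>"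
  using \<Lambda> unfolding homology_group_def by (simp_all add: subgroup_pointwise_add_iff[OF additively_closed_H1_int])

lemma coset_eq_iff: "coset c = coset d \<longleftrightarrow> (\<lambda>e. c e - d e) \<in> \<Lambda>"
  unfolding homology_coset_def homology_group_def by (rule pointwise_coset_eq_iff[OF \<Lambda>_closed])

lemma mem_coset: "x \<in> coset c \<longleftrightarrow> coset x = coset c"
  unfolding coset_eq_iff by (simp add: homology_coset_def homology_group_def mem_pointwise_coset)

lemma coset_mult: "c \<in> H1_int G \<Longrightarrow> d \<in> H1_int G \<Longrightarrow> coset c \<otimes>\<^bsub>Q\<^esub> coset d = coset (\<lambda>e. c e + d e)"
  unfolding homology_coset_def quotient_group_def homology_group_def
  by (rule pointwise_coset_mult[OF additively_closed_H1_int]) (use \<Lambda> in \<open>simp_all add: homology_group_def\<close>)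

lemma coset_one: "\<one>\<^bsub>Q\<^esub> = coset (\<lambda>e. 0)"
proof -
  have "coset (\<lambda>e. 0) = \<Lambda>" by (auto simp: homology_coset_def homology_group_def mem_pointwise_coset)
  then show ?thesis by (simp add: quotient_group_def FactGroup_def)
qed

lemma carrier_Q: "carrier Q = coset ` H1_int G"
  by (auto simp: quotient_group_def FactGroup_def RCOSETS_def homology_coset_def homology_group_def
      pointwise_add_group_def)

lemma comm_group_Q: "comm_group Q"
proof -
  interpret comm_group "homology_group G"
    unfolding homology_group_def by (rule comm_group_pointwise_add[OF additively_closed_H1_int])
  show ?thesis unfolding quotient_group_def by (rule abelian_FactGroup[OF \<Lambda>])
qed

sublocale Qg: comm_group Q by (rule comm_group_Q)

text \<open>The voltage of an edge: from the base vertex to its initial vertex, across it, and back.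
  Along a walk the potentials telescope, and along a closed walk only the abelianization
  remains.\<close>

definition cycle_of_edge :: "'e \<times> bool \<Rightarrow> 'e \<Rightarrow> real" where
  "cycle_of_edge a = (\<lambda>e. s (ini a) e + edge_chain a e - s (ter a) e)"

lemma cycle_of_edge_H1:
  assumes "a \<in> OE"
  shows "cycle_of_edge a \<in> H1_int G"
proof -
  note v = vertices_in[OF assms]
  have "cycle_of_edge a \<in> chains G" "cycle_of_edge a e \<in> \<int>" "boundary G (cycle_of_edge a) w = 0" for e w
    using s[OF v(1)] s[OF v(2)] edge_chain_chains[OF assms] boundary_edge_chain[OF assms] abelianization_Ints[of "[a]"]
    unfolding cycle_of_edge_def by (auto simp: chains_def boundary_add boundary_diff)
  then show ?thesis by (simp add: H1_int_def)
qed

lemma foldr_cycle_of_edge: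
  assumes "walk_via core_step x p y"
  shows "(\<lambda>e. s (ini x) e + abelianization p e - s (ini y) e) \<in> H1_int G"
    "foldr (\<lambda>a q. coset (cycle_of_edge a) \<otimes>\<^bsub>Q\<^esub> q) p \<one>\<^bsub>Q\<^esub> =
       coset (\<lambda>e. s (ini x) e + abelianization p e - s (ini y) e)"
proof -
  have "(\<lambda>e. s (ini x) e + abelianization p e - s (ini y) e) \<in> H1_int G \<and>
    foldr (\<lambda>a q. coset (cycle_of_edge a) \<otimes>\<^bsub>Q\<^esub> q) p \<one>\<^bsub>Q\<^esub> =
       coset (\<lambda>e. s (ini x) e + abelianization p e - s (ini y) e)"
    using assms
  proof (induction p arbitrary: x)
    case Nil
    then show ?case by (simp add: coset_one H1_int_closed)
  next
    case (Cons a p)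
    then obtain z where z: "a = x" "core_step x z" "walk_via core_step z p y" by auto
    have x: "x \<in> OE" "ter x = ini z" using z(2) by (auto simp: nonbacktracking_def)
    have eq: "(\<lambda>e. cycle_of_edge x e + (s (ini z) e + abelianization p e - s (ini y) e)) =
      (\<lambda>e. s (ini x) e + abelianization (x # p) e - s (ini y) e)"
      using x(2) by (auto simp: cycle_of_edge_def)
    note IH = Cons.IH[OF z(3)] and k = cycle_of_edge_H1[OF x(1)]
    show ?case
      using H1_int_closed(2)[OF k IH[THEN conjunct1]] coset_mult[OF k IH[THEN conjunct1]] IH z(1)
      unfolding eq by simp
  qed
  then show "(\<lambda>e. s (ini x) e + abelianization p e - s (ini y) e) \<in> H1_int G"
    "foldr (\<lambda>a q. coset (cycle_of_edge a) \<otimes>\<^bsub>Q\<^esub> q) p \<one>\<^bsub>Q\<^esub> =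
       coset (\<lambda>e. s (ini x) e + abelianization p e - s (ini y) e)" by blast+
qed

definition cls :: "('e \<times> bool) list \<Rightarrow> ('e \<Rightarrow> real) set" where
  "cls p = foldr (\<lambda>a q. coset (cycle_of_edge a) \<otimes>\<^bsub>Q\<^esub> q) p \<one>\<^bsub>Q\<^esub>"

lemma cls_carrier: "walk_via core_step x p y \<Longrightarrow> cls p \<in> carrier Q"
  unfolding cls_def carrier_Q using foldr_cycle_of_edge by blast

lemma cls_closed: "walk_via core_step x p x \<Longrightarrow> cls p = coset (abelianization p)"
  unfolding cls_def using foldr_cycle_of_edge(2)[of x p x] by simp

lemma closed_walk_H1: "walk_via core_step x p x \<Longrightarrow> abelianization p \<in> H1_int G"
  using foldr_cycle_of_edge(1)[of x p x] by simp

lemma cls_append: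
  assumes "walk_via core_step x p y" "walk_via core_step y q z"
  shows "cls (p @ q) = cls p \<otimes>\<^bsub>Q\<^esub> cls q"
proof -
  have w: "walk_via core_step x (p @ q) z" using assms by (auto simp: walk_via_append)
  show ?thesis
    unfolding cls_def foldr_cycle_of_edge(2)[OF w] foldr_cycle_of_edge(2)[OF assms(1)] foldr_cycle_of_edge(2)[OF assms(2)]
      coset_mult[OF foldr_cycle_of_edge(1)[OF assms(1)] foldr_cycle_of_edge(1)[OF assms(2)]]
    by (rule arg_cong[of _ _ coset]) (simp add: fun_eq_iff)
qed

lemma core_walk: "x \<in> core \<Longrightarrow> y \<in> core \<Longrightarrow> \<exists>p. walk_via core_step x p y"
  using core_step_tranclp walk_via_trancl[of core_step x y] by blast

text \<open>Circuits generate the homology but are based at different edges. A circuit is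
  transported to \<open>x\<close> by connecting walks \<open>a\<close> and \<open>b\<close>, and the
  class of \<open>a @ b\<close> introduced by the detour is killed by repeating it, \<open>Q\<close>
  being finite.\<close>

lemma closed_walk_every_class:
  assumes x: "x \<in> core" and q: "q \<in> carrier Q"
  shows "\<exists>p. walk_via core_step x p x \<and> cls p = q"
proof -
  define H where "H = {c \<in> H1_int G. \<exists>p. walk_via core_step x p x \<and> cls p = coset c}"
  have "c \<in> H" if "c \<in> H1_int G" for c
  proof (rule circuits_generate_H1[OF _ _ _ that])
    have "walk_via core_step x [] x \<and> cls [] = coset (\<lambda>e. 0)" by (simp add: cls_def coset_one)
    then show "(\<lambda>e. 0) \<in> H" unfolding H_def using H1_int_closed(1) by blast
    show "(\<lambda>e. c e + d e) \<in> H" if cd: "c \<in> H" "d \<in> H" for c d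
    proof -
      obtain p where p: "walk_via core_step x p x" "cls p = coset c" "c \<in> H1_int G" using cd(1) by (auto simp: H_def)
      obtain p' where p': "walk_via core_step x p' x" "cls p' = coset d" "d \<in> H1_int G" using cd(2) by (auto simp: H_def)
      have "walk_via core_step x (p @ p') x" "cls (p @ p') = coset (\<lambda>e. c e + d e)"
        using cls_append[OF p(1) p'(1)] coset_mult[OF p(3) p'(3)] p p' by (auto simp: walk_via_append)
      then show ?thesis using H1_int_closed(2)[OF p(3) p'(3)] unfolding H_def by blast
    qed
    fix p assume p: "circuit G p"
    then have w: "hd p \<in> core" "walk_via core_step (hd p) p (hd p)" using circuit_iff_core by blast+
    obtain a where a: "walk_via core_step x a (hd p)" using core_walk x w(1) by blast
    obtain b where b: "walk_via core_step (hd p) b x" using core_walk x w(1) by blast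
    define v where "v = cls (a @ b)"
    have ab: "walk_via core_step x (a @ b) x" using a b by (auto simp: walk_via_append)
    have v: "v \<in> carrier Q" unfolding v_def by (rule cls_carrier[OF ab])
    have rep: "walk_via core_step x (concat (replicate n (a @ b))) x \<and> cls (concat (replicate n (a @ b))) = v [^]\<^bsub>Q\<^esub> n" for n
    proof (induction n)
      case 0
      then show ?case by (simp add: cls_def)
    next
      case (Suc n)
      have "cls ((a @ b) @ concat (replicate n (a @ b))) = v \<otimes>\<^bsub>Q\<^esub> v [^]\<^bsub>Q\<^esub> n"
        unfolding cls_append[OF ab Suc[THEN conjunct1]] Suc[THEN conjunct2] v_def[symmetric] ..
      moreover have "walk_via core_step x ((a @ b) @ concat (replicate n (a @ b))) x"
        unfolding walk_via_append[of core_step x "a @ b"] by (intro exI conjI, rule ab, rule Suc[THEN conjunct1])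
      moreover have "v \<otimes>\<^bsub>Q\<^esub> v [^]\<^bsub>Q\<^esub> n = v [^]\<^bsub>Q\<^esub> Suc n" using v by (rule Qg.nat_pow_Suc2[symmetric])
      ultimately show ?case by simp
    qed
    let ?N = "order Q - 1"
    have N: "Suc ?N = order Q" using finQ Qg.order_gt_0_iff_finite by simp
    \<comment> \<open>Together with the detour around \<open>p\<close> there are
      \<open>order Q\<close> copies of the class \<open>v\<close>, and these multiply to the
      identity.\<close>
    define w' where "w' = a @ p @ b @ concat (replicate ?N (a @ b))"
    have pb: "walk_via core_step (hd p) (p @ b) x" using w(2) b by (auto simp: walk_via_append)
    have apb: "walk_via core_step x (a @ p @ b) x" using a pb by (auto simp: walk_via_append)
    have car: "cls a \<in> carrier Q" "cls b \<in> carrier Q" "cls p \<in> carrier Q" "v [^]\<^bsub>Q\<^esub> ?N \<in> carrier Q"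
      using cls_carrier a b w(2) v by blast+
    have "cls w' = cls (a @ p @ b) \<otimes>\<^bsub>Q\<^esub> v [^]\<^bsub>Q\<^esub> ?N"
      using cls_append[OF apb, of "concat (replicate ?N (a @ b))" x] rep[of ?N] by (simp add: w'_def)
    also have "cls (a @ p @ b) = cls a \<otimes>\<^bsub>Q\<^esub> (cls p \<otimes>\<^bsub>Q\<^esub> cls b)"
      using cls_append[OF a pb] cls_append[OF w(2) b] by simp
    also have "cls a \<otimes>\<^bsub>Q\<^esub> (cls p \<otimes>\<^bsub>Q\<^esub> cls b) = cls p \<otimes>\<^bsub>Q\<^esub> (cls a \<otimes>\<^bsub>Q\<^esub> cls b)"
      using car Qg.m_lcomm by blast
    also have "cls a \<otimes>\<^bsub>Q\<^esub> cls b = v" unfolding v_def using cls_append[OF a b] by simp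
    also have "cls p \<otimes>\<^bsub>Q\<^esub> v \<otimes>\<^bsub>Q\<^esub> v [^]\<^bsub>Q\<^esub> ?N = cls p \<otimes>\<^bsub>Q\<^esub> (v \<otimes>\<^bsub>Q\<^esub> v [^]\<^bsub>Q\<^esub> ?N)"
      using car v Qg.m_assoc by blast
    also have "v \<otimes>\<^bsub>Q\<^esub> v [^]\<^bsub>Q\<^esub> ?N = v [^]\<^bsub>Q\<^esub> order Q"
      using Qg.nat_pow_Suc2[OF v, of ?N] N by simp
    also have "\<dots> = \<one>\<^bsub>Q\<^esub>" using Qg.pow_order_eq_1[OF v] .
    finally have "cls w' = coset (abelianization p)" using cls_closed[OF w(2)] car by simp
    moreover have "walk_via core_step x w' x"
      using apb rep[of ?N] walk_via_append[of core_step x "a @ p @ b"] unfolding w'_def by auto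
    ultimately show "abelianization p \<in> H" using circuit_H1_int[OF p] unfolding H_def by blast
  qed
  then show ?thesis using q unfolding carrier_Q H_def by blast
qed

lemma finite_core: "finite core" using core_OE finite_OE finite_subset by blast

sublocale vd: voltage_digraph core core_step Q "\<lambda>a. coset (cycle_of_edge a)" r u
proof
  show "finite core" by (rule finite_core)
  show "finite (carrier Q)" by (rule finQ)
  show "coset (cycle_of_edge x) \<in> carrier Q" if "x \<in> core" for x
    using that cycle_of_edge_H1 core_OE carrier_Q by blast
  show "r * u x = (\<Sum>y\<in>{y\<in>core. core_step x y}. u y)" if "x \<in> core" for x
    using perron[OF that] that by (simp add: conj_commute cong: conj_cong)
  show "\<exists>p. walk_via core_step x p y \<and> foldr (\<lambda>a b. coset (cycle_of_edge a) \<otimes>\<^bsub>Q\<^esub> b) p \<one>\<^bsub>Q\<^esub> = q"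
    if xy: "x \<in> core" "y \<in> core" and q: "q \<in> carrier Q" for x y q
  proof -
    obtain a where a: "walk_via core_step x a y" using core_walk xy by blast
    note ca = cls_carrier[OF a]
    have "q \<otimes>\<^bsub>Q\<^esub> inv\<^bsub>Q\<^esub> cls a \<in> carrier Q" using q ca by simp
    then obtain p where p: "walk_via core_step x p x" "cls p = q \<otimes>\<^bsub>Q\<^esub> inv\<^bsub>Q\<^esub> cls a"
      using closed_walk_every_class[OF xy(1)] by blast
    have "cls (p @ a) = q" using cls_append[OF p(1) a] p(2) q ca by (simp add: Qg.m_assoc)
    moreover have "walk_via core_step x (p @ a) y" using p(1) a by (auto simp: walk_via_append)
    ultimately show ?thesis unfolding cls_def by blast
  qed
qed (use r_pos u_pos in auto)

lemma volt_cls: "vd.volt p = cls p" by (simp add: vd.volt_def cls_def)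

sublocale rc: recurrent_class OE core nb r u
proof
  show "core_step\<^sup>+\<^sup>+ a b" if "a \<in> core" "b \<in> core" for a b by (rule core_step_tranclp[OF that])
  show "a \<in> core" if "nb\<^sup>+\<^sup>+ a a" for a using that by (simp add: core_def)
qed (use finite_OE core_OE nb_OE r_pos u_pos perron in auto)

lemma spectrum_edge_adjacency_matrix:
  "\<mu> \<in> spectrum (edge_adjacency_matrix G) \<longleftrightarrow> (\<exists>f. rc.eigenfunction \<mu> f)"
proof -
  define es where "es = oriented_edge_list G"
  have "\<exists>es. distinct es \<and> set es = OE" using finite_distinct_list[OF finite_OE] by blast
  then have es: "distinct es" "set es = OE"
    unfolding es_def oriented_edge_list_def by (rule someI_ex[THEN conjunct1], rule someI_ex[THEN conjunct2])
  define n where "n = length es"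
  have W: "edge_adjacency_matrix G = mat n n (\<lambda>(i, j). if nb (es ! i) (es ! j) then 1 else 0)"
    unfolding edge_adjacency_matrix_def Let_def es_def[symmetric] n_def
  proof (rule cong_mat)
    fix i j assume "i < length es" "j < length es"
    then have "es ! i \<in> OE" "es ! j \<in> OE" unfolding es(2)[symmetric] by simp_all
    then show "(case (i, j) of (i, j) \<Rightarrow> if ter (es ! i) = ini (es ! j) \<and> es ! j \<noteq> edge_inv (es ! i) then 1 else 0) =
      (case (i, j) of (i, j) \<Rightarrow> if nb (es ! i) (es ! j) then 1 else 0)"
      by (simp add: nonbacktracking_def)
  qed simp_all
  have bij: "bij_betw (\<lambda>i. es ! i) {..<n} OE" using bij_betw_nth[OF es(1)] es(2) by (simp add: n_def)
  have row: "(mat n n (\<lambda>(i, j). if nb (es ! i) (es ! j) then 1 else 0) *\<^sub>v v) $ i = (\<Sum>b\<in>{b\<in>OE. nb (es ! i) b}. f b)"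
    if v: "v \<in> carrier_vec n" and i: "i < n" and f: "\<And>j. j < n \<Longrightarrow> f (es ! j) = v $ j" for v :: "complex vec" and f i
  proof -
    have "(mat n n (\<lambda>(i, j). if nb (es ! i) (es ! j) then 1 else 0) *\<^sub>v v) $ i =
        (\<Sum>j\<in>{..<n}. (if nb (es ! i) (es ! j) then 1 else 0) * v $ j)"
      using v i by (simp add: scalar_prod_def lessThan_atLeast0)
    also have "\<dots> = (\<Sum>j\<in>{..<n}. (\<lambda>b. if nb (es ! i) b then f b else 0) (es ! j))"
      by (rule sum.cong) (auto simp: f)
    also have "\<dots> = (\<Sum>b\<in>OE. if nb (es ! i) b then f b else 0)"
      by (rule sum.reindex_bij_betw[OF bij])
    also have "\<dots> = (\<Sum>b\<in>{b\<in>OE. nb (es ! i) b}. f b)" using finite_OE by (rule sum.inter_filter[symmetric])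
    finally show ?thesis .
  qed
  show ?thesis
  proof
    assume "\<mu> \<in> spectrum (edge_adjacency_matrix G)"
    then obtain v where v: "v \<in> carrier_vec n" "v \<noteq> 0\<^sub>v n"
      "mat n n (\<lambda>(i, j). if nb (es ! i) (es ! j) then 1 else 0) *\<^sub>v v = \<mu> \<cdot>\<^sub>v v"
      unfolding spectrum_def eigenvalue_def eigenvector_def W by auto
    define f where "f = (\<lambda>b. v $ (the_inv_into {..<n} (\<lambda>i. es ! i) b))"
    have f: "f (es ! j) = v $ j" if "j < n" for j
      unfolding f_def using that bij by (subst the_inv_into_f_f) (auto simp: bij_betw_def)
    have "\<mu> * f a = (\<Sum>b\<in>{b\<in>OE. nb a b}. f b)" if a: "a \<in> OE" for a
    proof -
      have "a \<in> (\<lambda>i. es ! i) ` {..<n}" using a bij_betw_imp_surj_on[OF bij] by simp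
      then obtain i where i: "i < n" "a = es ! i" by blast
      show ?thesis using row[OF v(1) i(1), of f] f v(3) i v(1) by simp
    qed
    moreover have "\<exists>a\<in>OE. f a \<noteq> 0"
    proof -
      obtain i where i: "i < n" "v $ i \<noteq> 0" using v(1,2) by (auto simp: vec_eq_iff)
      then have "es ! i \<in> OE" "f (es ! i) \<noteq> 0" using bij f by (auto simp: bij_betw_def)
      then show ?thesis by blast
    qed
    ultimately show "\<exists>f. rc.eigenfunction \<mu> f" unfolding rc.eigenfunction_def by blast
  next
    assume "\<exists>f. rc.eigenfunction \<mu> f"
    then obtain f where f: "\<And>a. a \<in> OE \<Longrightarrow> \<mu> * f a = (\<Sum>b\<in>{b\<in>OE. nb a b}. f b)" "\<exists>a\<in>OE. f a \<noteq> 0"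
      unfolding rc.eigenfunction_def by blast
    define v where "v = vec n (\<lambda>i. f (es ! i))"
    have v: "v \<in> carrier_vec n" by (simp add: v_def)
    have esE: "es ! i \<in> OE" if "i < n" for i using bij that by (auto simp: bij_betw_def)
    have "mat n n (\<lambda>(i, j). if nb (es ! i) (es ! j) then 1 else 0) *\<^sub>v v = \<mu> \<cdot>\<^sub>v v"
    proof (rule eq_vecI)
      fix i assume "i < dim_vec (\<mu> \<cdot>\<^sub>v v)"
      then have i: "i < n" by (simp add: v_def)
      show "(mat n n (\<lambda>(i, j). if nb (es ! i) (es ! j) then 1 else 0) *\<^sub>v v) $ i = (\<mu> \<cdot>\<^sub>v v) $ i"
        using row[OF v i, of f] f(1)[OF esE[OF i]] i by (simp add: v_def)
    qed (simp add: v_def)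
    moreover have "v \<noteq> 0\<^sub>v n"
    proof -
      obtain a where "a \<in> (\<lambda>i. es ! i) ` {..<n}" "f a \<noteq> 0"
        using f(2) bij_betw_imp_surj_on[OF bij] by blast
      then obtain i where "i < n" "f (es ! i) \<noteq> 0" by blast
      then have "v $ i \<noteq> 0\<^sub>v n $ i" "i < n" by (simp_all add: v_def)
      then show ?thesis by auto
    qed
    ultimately show "\<mu> \<in> spectrum (edge_adjacency_matrix G)"
      unfolding spectrum_def eigenvalue_def eigenvector_def W using v by auto
  qed
qed

lemma rho_nu:
  assumes "a \<in> core"
  shows "rho G = r" "nu G = rc.period a"
proof -
  have "finite (spectrum (edge_adjacency_matrix G))"
    by (rule card_finite_spectrum(1)[of _ "dim_row (edge_adjacency_matrix G)"])
      (auto simp: edge_adjacency_matrix_def Let_def)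
  then show "rho G = r"
    using rc.peripheral_eigenvalues(1)[OF assms spectrum_edge_adjacency_matrix]
    by (auto simp: rho_def spectral_radius_def)
  then show "nu G = rc.period a"
    using rc.peripheral_eigenvalues(2)[OF assms spectrum_edge_adjacency_matrix] by (simp add: nu_def)
qed

lemma nu_pos: "nu G > 0"
  using core_nonempty rho_nu(2) rc.period_pos by fastforce

lemma nu_dvd_closed: "x \<in> core \<Longrightarrow> walk_via core_step x p x \<Longrightarrow> nu G dvd length p"
  using rc.period_dvd rho_nu(2) by simp

lemma nu_dvd_circuit: "circuit G p \<Longrightarrow> nu G dvd length p"
  using circuit_iff_core nu_dvd_closed by blast

text \<open>If \<open>r \<le> 1\<close>, an edge with the minimal value \<open>m\<close> of
  \<open>u\<close> has successors of total value at most \<open>m\<close>, so each successor is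
  minimal too. Hence \<open>u\<close> is constant on the core, and an edge with two successors gives
  \<open>2 * m \<le> m\<close>.\<close>

lemma r_gt_1: "r > 1"
proof (rule ccontr)
  assume r: "\<not> r > 1"
  obtain a b c where br: "b \<noteq> c" "core_step a b" "core_step a c" using core_branches core_nonempty by blast
  define m where "m = Min (u ` core)"
  have m: "m \<le> u x" if "x \<in> core" for x unfolding m_def using that finite_core by simp
  have "m \<in> u ` core" unfolding m_def using finite_core core_nonempty by (intro Min_in) auto
  then obtain x0 where x0: "x0 \<in> core" "u x0 = m" by blast
  have mpos: "m > 0" using u_pos[OF x0(1)] x0(2) by simp
  have sub: "sum u B \<le> m" if x: "x \<in> core" "u x = m" and B: "B \<subseteq> {y\<in>core. nb x y}" for x B
  proof -
    have "sum u B \<le> (\<Sum>y\<in>{y\<in>core. nb x y}. u y)"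
      by (rule sum_mono2) (use B finite_core u_pos in \<open>auto intro: less_imp_le\<close>)
    also have "\<dots> = r * m" using perron[OF x(1)] x(2) by simp
    also have "\<dots> \<le> 1 * m" using r mpos by (intro mult_right_mono) auto
    finally show ?thesis by simp
  qed
  have "u x = m" if "core_step\<^sup>+\<^sup>+ x0 x" for x
    using that
  proof (induction rule: tranclp_induct)
    case (base y)
    then show ?case using sub[of x0 "{y}"] x0 m[of y] by auto
  next
    case (step y z)
    then show ?case using sub[of y "{z}"] m[of z] by auto
  qed
  then have "u a = m" using core_step_tranclp x0 br(2) by blast
  then have "u b + u c \<le> m" using sub[of a "{b, c}"] br by auto
  then show False using m[of b] m[of c] br mpos by auto
qed

end

section \<open>The period of the cover and the growth of circuits in a class\<close>

lemma half_Ints_iff: "(of_int k / 2 :: real) \<in> \<int> \<longleftrightarrow> even k"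
proof
  assume "(of_int k / 2 :: real) \<in> \<int>"
  then obtain i where "(of_int k / 2 :: real) = of_int i" by (elim Ints_cases)
  then have "(of_int k :: real) = of_int (2 * i)" by simp
  then show "even k" unfolding of_int_eq_iff by simp
qed (auto elim!: evenE)

lemma chi_half_integer:
  assumes k: "form_eval G \<omega> c - of_int k / 2 \<in> \<int>"
  shows "chi G \<omega> c = (if even k then 1 else - 1)"
proof -
  obtain i where "form_eval G \<omega> c - of_int k / 2 = of_int i" using k by (elim Ints_cases)
  then have f: "form_eval G \<omega> c = of_int i + of_int k / 2" by simp
  obtain j where j: "k = 2 * j + (if even k then 0 else 1)" by (cases "even k") (auto elim: evenE oddE)
  have "chi G \<omega> c = cis (2 * pi * form_eval G \<omega> c)"
    by (simp add: chi_def cis_conv_exp mult_ac)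
  also have "2 * pi * form_eval G \<omega> c = 2 * pi * of_int (i + j) + pi * of_bool (odd k)"
    unfolding f by (subst j) (simp add: algebra_simps add_divide_distrib)
  also have "cis \<dots> = cis (2 * pi * of_int (i + j)) * cis (pi * of_bool (odd k))" by (rule cis_mult[symmetric])
  also have "cis (2 * pi * of_int (i + j)) = 1" by (rule cis_multiple_2pi) simp
  finally show ?thesis by (simp add: cis_pi)
qed

context covered_graph
begin

definition cover_period :: nat where
  "cover_period = Gcd (vd.null_return_times (SOME a. a \<in> core))"

lemma cover_period_eq: "a \<in> core \<Longrightarrow> Gcd (vd.null_return_times a) = cover_period"
proof -
  assume a: "a \<in> core"
  have b: "(SOME a. a \<in> core) \<in> core" using core_nonempty by (simp add: some_in_eq)
  have "Gcd (vd.null_return_times x) dvd Gcd (vd.null_return_times y)" if "x \<in> core" "y \<in> core" for x y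
    using vd.Gcd_null_return_times_dvd[OF that] by (intro Gcd_greatest) (auto simp: vd.null_return_times_def)
  then show ?thesis unfolding cover_period_def using a b by (intro dvd_antisym)
qed

lemma cover_period_pos: "cover_period > 0"
  using vd.Gcd_null_return_times_pos cover_period_eq core_nonempty by fastforce

lemma walk_lengths_cong_cover_period:
  assumes "x \<in> core" "y \<in> core" "walk_via core_step x p y" "walk_via core_step x p' y" "cls p = cls p'"
  shows "length p mod cover_period = length p' mod cover_period"
  using vd.walk_lengths_cong[OF assms(1,1,2,3,4)] assms cover_period_eq by (simp add: volt_cls)

text \<open>Inserting \<open>p\<close> at \<open>x\<close> or \<open>p'\<close> at \<open>y\<close>
  into the same round trip \<open>a @ b\<close> gives two closed walks at \<open>x\<close>; as
  \<open>Q\<close> is abelian, they have the same class.\<close>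

lemma closed_lengths_cong:
  assumes x: "x \<in> core" "walk_via core_step x p x" and y: "y \<in> core" "walk_via core_step y p' y" and eq: "cls p = cls p'"
  shows "[length p = length p'] (mod cover_period)"
proof -
  obtain a where a: "walk_via core_step x a y" using core_walk x(1) y(1) by blast
  obtain b where b: "walk_via core_step y b x" using core_walk x(1) y(1) by blast
  have ya: "walk_via core_step x (a @ p') y" and yb: "walk_via core_step x (a @ b) x"
    using a b y(2) by (auto simp: walk_via_append)
  have w: "walk_via core_step x ((a @ p') @ b) x" "walk_via core_step x (p @ (a @ b)) x"
    unfolding walk_via_append[of core_step x "a @ p'"] walk_via_append[of core_step x p] using ya yb b x(2) by blast+
  note car = cls_carrier[OF a] cls_carrier[OF b] cls_carrier[OF x(2)]
  have "cls ((a @ p') @ b) = cls p \<otimes>\<^bsub>Q\<^esub> (cls a \<otimes>\<^bsub>Q\<^esub> cls b)"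
    unfolding cls_append[OF ya b] cls_append[OF a y(2)] eq[symmetric] using car
    by (simp add: Qg.m_assoc Qg.m_lcomm)
  also have "\<dots> = cls (p @ (a @ b))" unfolding cls_append[OF x(2) yb] cls_append[OF a b] ..
  finally have "length ((a @ p') @ b) mod cover_period = length (p @ (a @ b)) mod cover_period"
    by (rule walk_lengths_cong_cover_period[OF x(1) x(1) w])
  then have "[length p' + (length a + length b) = length p + (length a + length b)] (mod cover_period)"
    by (simp add: cong_def add_ac)
  then show ?thesis unfolding cong_add_rcancel_nat by (rule cong_sym)
qed

lemma cover_period_greatest:
  assumes "\<And>x p. x \<in> core \<Longrightarrow> walk_via core_step x p x \<Longrightarrow> abelianization p \<in> \<Lambda> \<Longrightarrow> k dvd length p"
  shows "k dvd cover_period"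
proof -
  obtain a where a: "a \<in> core" using core_nonempty by blast
  have "k dvd Gcd (vd.null_return_times a)"
  proof (rule Gcd_greatest)
    fix n assume "n \<in> vd.null_return_times a"
    then obtain p where p: "length p = n" "walk_via core_step a p a" "cls p = \<one>\<^bsub>Q\<^esub>"
      unfolding vd.null_return_times_def volt_cls by blast
    then have "abelianization p \<in> \<Lambda>" using cls_closed[OF p(2)] by (simp add: coset_one coset_eq_iff)
    then show "k dvd n" using assms[OF a p(2)] p(1) by simp
  qed
  then show ?thesis using cover_period_eq[OF a] by simp
qed

lemma nu_dvd_cover_period: "nu G dvd cover_period"
  using nu_dvd_closed by (rule cover_period_greatest)

lemma nu_greatest:
  assumes "\<And>p. circuit G p \<Longrightarrow> k dvd length p"
  shows "k dvd nu G"
proof -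
  obtain a where a: "a \<in> core" using core_nonempty by blast
  have "k dvd rc.period a" unfolding rc.period_def
  proof (rule Gcd_greatest)
    fix n assume "n \<in> {n. \<exists>p. length p = n \<and> walk_via core_step a p a}"
    then obtain p where p: "length p = n" "walk_via core_step a p a" by blast
    show "k dvd n"
    proof (cases "p = []")
      case False
      then have "hd p = a" using walk_via_iff_successively[OF False] p(2) by blast
      then show ?thesis using assms[of p] p False a circuit_iff_core by simp
    qed (use p in simp)
  qed
  then show ?thesis using rho_nu(2)[OF a] by simp
qed

text \<open>
  A circuit and its reverse have the same length and opposite classes, so together they close up
  in the cover.
\<close>

lemma cover_period_dvd_twice_length:
  assumes x: "x \<in> core" "walk_via core_step x p x"
  shows "cover_period dvd 2 * length p"
proof -
  define y where "y = edge_inv x"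
  define p' where "p' = map edge_inv (rev (tl (p @ [x])))"
  have y: "y \<in> core" using core_inv x(1) by (simp add: y_def)
  have p': "walk_via core_step y p' y" using walk_via_inv[OF x(2)] by (simp add: y_def p'_def)
  have len: "length p' = length p" by (simp add: p'_def)
  have hd: "p @ [x] = x # tl (p @ [x])" using walk_via_start[OF x(2)] by (cases p) simp_all
  have "abelianization p' e = - abelianization (tl (p @ [x])) e" for e
    unfolding p'_def by (rule abelianization_inv_rev)
  moreover have "abelianization (p @ [x]) e = edge_chain x e + abelianization (tl (p @ [x])) e" for e
    by (subst hd) simp
  ultimately have ab: "abelianization p' = (\<lambda>e. - abelianization p e)" by (auto simp: fun_eq_iff)
  \<comment> \<open>The reversed walk is based at \<open>edge_inv x\<close>, so the two have to be
    joined; comparing with the bare round trip \<open>a @ b\<close> removes the joining lengths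
    again.\<close>
  obtain a where a: "walk_via core_step x a y" using core_walk x(1) y by blast
  obtain b where b: "walk_via core_step y b x" using core_walk x(1) y by blast
  have pa: "walk_via core_step x (p @ a) y" and pb: "walk_via core_step y (p' @ b) x"
    and yb: "walk_via core_step x (a @ b) x"
    using a b x(2) p' by (auto simp: walk_via_append)
  have w: "walk_via core_step x ((p @ a) @ (p' @ b)) x"
    unfolding walk_via_append[of core_step x "p @ a"] using pa pb by blast
  note H = closed_walk_H1[OF x(2)] closed_walk_H1[OF p']
  note car = cls_carrier[OF a] cls_carrier[OF b] cls_carrier[OF x(2)] cls_carrier[OF p']
  have "cls p \<otimes>\<^bsub>Q\<^esub> cls p' = \<one>\<^bsub>Q\<^esub>"
    unfolding cls_closed[OF x(2)] cls_closed[OF p'] coset_mult[OF H] unfolding ab coset_one by simp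
  moreover have "cls ((p @ a) @ (p' @ b)) = (cls p \<otimes>\<^bsub>Q\<^esub> cls p') \<otimes>\<^bsub>Q\<^esub> (cls a \<otimes>\<^bsub>Q\<^esub> cls b)"
    unfolding cls_append[OF pa pb] cls_append[OF x(2) a] cls_append[OF p' b] using car
    by (simp add: Qg.m_assoc Qg.m_lcomm)
  ultimately have "cls ((p @ a) @ (p' @ b)) = cls (a @ b)" using car cls_append[OF a b] by simp
  then have "length ((p @ a) @ (p' @ b)) mod cover_period = length (a @ b) mod cover_period"
    by (rule walk_lengths_cong_cover_period[OF x(1) x(1) w yb])
  then have "[2 * length p + (length a + length b) = 0 + (length a + length b)] (mod cover_period)"
    using len by (simp add: cong_def mult_2 add_ac)
  then show ?thesis unfolding cong_add_rcancel_nat by (simp add: cong_0_iff)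
qed

text \<open>The period of the cover divides twice every circuit length, and \<open>nu G\<close> is
  the gcd of these lengths; hence it lies between \<open>nu G\<close> and \<open>2 * nu G\<close>
  with respect to divisibility.\<close>

lemma cover_period_cases: "cover_period = nu G \<or> cover_period = 2 * nu G"
proof -
  obtain k where k: "cover_period = nu G * k" using nu_dvd_cover_period by blast
  have "k dvd 2"
  proof (cases "even cover_period")
    case True
    then obtain h where h: "cover_period = 2 * h" by blast
    have "h dvd nu G"
    proof (rule nu_greatest)
      fix p assume "circuit G p"
      then have "cover_period dvd 2 * length p" using cover_period_dvd_twice_length circuit_iff_core by blast
      then show "h dvd length p" using h by simp
    qed
    then have "2 * h dvd 2 * nu G" by simp
    then have "nu G * k dvd nu G * 2" unfolding h[symmetric] k by (simp add: mult.commute)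
    then show ?thesis using nu_pos by simp
  next
    case False
    have "cover_period dvd nu G"
    proof (rule nu_greatest)
      fix p assume "circuit G p"
      then have "cover_period dvd 2 * length p" using cover_period_dvd_twice_length circuit_iff_core by blast
      then show "cover_period dvd length p" using False by (simp add: coprime_dvd_mult_right_iff)
    qed
    then have "cover_period = nu G" using nu_dvd_cover_period by (simp add: dvd_antisym)
    then show ?thesis using k nu_pos by simp
  qed
  then have "k \<le> 2" "k \<noteq> 0" by (auto dest: dvd_imp_le intro: gr0I)
  then have "k = 1 \<or> k = 2" by linarith
  then show ?thesis using k by auto
qed

text \<open>Splitting by the base edge. For \<open>l = 0\<close> and the trivial class the right
  side would count the empty walk, which is not a circuit.\<close>

lemma circuit_count_eq:
  assumes l: "l > 0"
  shows "circuit_count G (coset \<alpha>) l = (\<Sum>x\<in>core. vd.count_walks l x (coset \<alpha>) x)"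
proof -
  have "{p. circuit G p \<and> length p = l \<and> abelianization p \<in> coset \<alpha>} =
      (\<Union>x\<in>core. {p. length p = l \<and> walk_via core_step x p x \<and> vd.volt p = coset \<alpha>})" (is "?L = (\<Union>x\<in>core. ?A x)")
  proof
    show "?L \<subseteq> (\<Union>x\<in>core. ?A x)"
    proof
      fix p assume p: "p \<in> ?L"
      then have "hd p \<in> core" "walk_via core_step (hd p) p (hd p)" using circuit_iff_core by blast+
      then show "p \<in> (\<Union>x\<in>core. ?A x)" using p cls_closed mem_coset by (auto simp: volt_cls)
    qed
    show "(\<Union>x\<in>core. ?A x) \<subseteq> ?L"
    proof
      fix p assume "p \<in> (\<Union>x\<in>core. ?A x)"
      then obtain x where x: "x \<in> core" "length p = l" "walk_via core_step x p x" "cls p = coset \<alpha>"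
        by (auto simp: volt_cls)
      then have "p \<noteq> []" using l by auto
      moreover have "hd p = x" using walk_via_iff_successively[OF \<open>p \<noteq> []\<close>] x(3) by blast
      ultimately have "circuit G p" unfolding circuit_iff_core using x by simp
      then show "p \<in> ?L" using x cls_closed[OF x(3)] mem_coset by simp
    qed
  qed
  moreover have "card (\<Union>x\<in>core. ?A x) = (\<Sum>x\<in>core. card (?A x))"
  proof (rule card_UN_disjoint)
    show "\<forall>x\<in>core. \<forall>y\<in>core. x \<noteq> y \<longrightarrow> ?A x \<inter> ?A y = {}"
    proof (intro ballI impI)
      fix x y :: "'e \<times> bool" assume ne: "x \<noteq> y"
      show "?A x \<inter> ?A y = {}"
      proof (rule ccontr)
        assume "?A x \<inter> ?A y \<noteq> {}"
        then obtain p where p: "length p = l" "walk_via core_step x p x" "walk_via core_step y p y" by blast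
        have "p \<noteq> []" using p(1) l by auto
        then show False using walk_via_start[OF p(2)] walk_via_start[OF p(3)] ne by simp
      qed
    qed
  qed (use finite_core vd.finite_walks in auto)
  ultimately show ?thesis unfolding circuit_count_def vd.count_walks_def by simp
qed

text \<open>Return probabilities in the cover are at most 1. This gives a bound valid for each
  single length, which is used to control proper powers.\<close>

lemma circuit_count_total:
  "real (card {p. circuit G p \<and> length p = l}) \<le> real (card (carrier Q)) * real (card core) * r ^ l"
proof (cases "l = 0")
  case True
  have "{p. circuit G p \<and> length p = l} = {}" using True by (auto simp: circuit_def walk_def)
  then have "card {p. circuit G p \<and> length p = l} = 0" by (simp only: card.empty)
  then show ?thesis using r_pos by simp
next
  case False
  have "{p. circuit G p \<and> length p = l} \<subseteq> (\<Union>q\<in>carrier Q. {p. circuit G p \<and> length p = l \<and> abelianization p \<in> q})"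
  proof
    fix p assume p: "p \<in> {p. circuit G p \<and> length p = l}"
    then have "abelianization p \<in> coset (abelianization p)" "coset (abelianization p) \<in> carrier Q"
      using circuit_H1_int carrier_Q mem_coset by auto
    then show "p \<in> (\<Union>q\<in>carrier Q. {p. circuit G p \<and> length p = l \<and> abelianization p \<in> q})" using p by blast
  qed
  moreover have "finite (\<Union>q\<in>carrier Q. {p. circuit G p \<and> length p = l \<and> abelianization p \<in> q})"
    using finQ by (intro finite_UN_I finite_subset[OF _ finite_circuits[of l]]) auto
  ultimately have "card {p. circuit G p \<and> length p = l} \<le> card (\<Union>q\<in>carrier Q. {p. circuit G p \<and> length p = l \<and> abelianization p \<in> q})"
    by (rule card_mono[rotated])
  also have "\<dots> \<le> (\<Sum>q\<in>carrier Q. circuit_count G q l)"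
    unfolding circuit_count_def by (rule card_UN_le[OF finQ])
  finally have "real (card {p. circuit G p \<and> length p = l}) \<le> real (\<Sum>q\<in>carrier Q. circuit_count G q l)"
    by (rule of_nat_mono)
  also have "\<dots> = (\<Sum>q\<in>carrier Q. real (circuit_count G q l))" by (rule of_nat_sum)
  also have "\<dots> \<le> (\<Sum>q\<in>carrier Q. real (card core) * r ^ l)"
  proof (rule sum_mono)
    fix q assume q: "q \<in> carrier Q"
    then obtain \<alpha> where \<alpha>: "q = coset \<alpha>" by (auto simp: carrier_Q)
    have "real (vd.count_walks l x q x) \<le> r ^ l" if x: "x \<in> core" for x
    proof -
      have "kpow vd.cover vd.kernel l (x, \<one>\<^bsub>Q\<^esub>) (x, \<one>\<^bsub>Q\<^esub> \<otimes>\<^bsub>Q\<^esub> q) \<le> 1"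
        by (rule vd.markov.p_le_1) (use x q in auto)
      then have "u x / (r ^ l * u x) * real (vd.count_walks l x q x) \<le> 1"
        unfolding vd.kpow_kernel_count[OF x Qg.one_closed q] .
      then show ?thesis using u_pos[OF x] r_pos by (simp add: field_simps)
    qed
    then have "(\<Sum>x\<in>core. real (vd.count_walks l x q x)) \<le> (\<Sum>x\<in>core. r ^ l)" by (rule sum_mono)
    then show "real (circuit_count G q l) \<le> real (card core) * r ^ l"
      using circuit_count_eq[of l \<alpha>] False \<alpha> by simp
  qed
  finally show ?thesis by (simp add: algebra_simps)
qed

theorem circuit_count_limit:
  assumes \<alpha>: "\<alpha> \<in> H1_int G" and x0: "x0 \<in> core" "walk_via core_step x0 p0 x0" "cls p0 = coset \<alpha>"
    and S: "\<And>l. l \<in> S \<Longrightarrow> l mod cover_period = length p0 mod cover_period"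
  shows "((\<lambda>l. real (circuit_count G (coset \<alpha>) l) / r ^ l) \<longlongrightarrow> real cover_period / real (card (carrier Q)))
    (inf sequentially (principal S))"
proof (rule tendsto_residue_class[where D = cover_period and j = "length p0 mod cover_period"])
  let ?j = "length p0 mod cover_period"
  have \<alpha>Q: "coset \<alpha> \<in> carrier Q" using \<alpha> by (simp add: carrier_Q)
  have "\<exists>p. walk_via core_step x p x \<and> vd.volt p = coset \<alpha> \<and> length p mod cover_period = ?j mod cover_period" if x: "x \<in> core" for x
  proof -
    obtain p where p: "walk_via core_step x p x" "cls p = coset \<alpha>"
      using closed_walk_every_class[OF x \<alpha>Q] by blast
    have "[length p = length p0] (mod cover_period)"
      by (rule closed_lengths_cong[OF x p(1) x0(1,2)]) (simp add: p(2) x0(3))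
    then show ?thesis using p by (auto simp: volt_cls cong_def)
  qed
  then have "(\<lambda>n. (\<Sum>x\<in>core. real (vd.count_walks (n * cover_period + ?j) x (coset \<alpha>) x)) / r ^ (n * cover_period + ?j))
      \<longlonglongrightarrow> real cover_period / real (card (carrier Q))"
    using vd.closed_walk_count_limit[OF x0(1) \<alpha>Q, of ?j] by (simp only: cover_period_eq[OF x0(1)])
  moreover have "\<forall>\<^sub>F n in sequentially.
      (\<Sum>x\<in>core. real (vd.count_walks (n * cover_period + ?j) x (coset \<alpha>) x)) / r ^ (n * cover_period + ?j) =
      real (circuit_count G (coset \<alpha>) (n * cover_period + ?j)) / r ^ (n * cover_period + ?j)"
    using eventually_gt_at_top[of 0]
    by eventually_elim (subst circuit_count_eq, use cover_period_pos in simp_all)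
  ultimately show "(\<lambda>n. real (circuit_count G (coset \<alpha>) (n * cover_period + ?j)) / r ^ (n * cover_period + ?j))
      \<longlonglongrightarrow> real cover_period / real (card (carrier Q))"
    by (rule Lim_transform_eventually)
qed (use cover_period_pos S in auto)

end

section \<open>The canonical character and the period of the cover\<close>

lemma half_diff_Ints_iff:
  fixes x y :: real
  assumes "(x - y) / 2 \<in> \<int>"
  shows "x / 2 \<in> \<int> \<longleftrightarrow> y / 2 \<in> \<int>"
proof -
  have "x / 2 = (x - y) / 2 + y / 2" "y / 2 = x / 2 - (x - y) / 2" by (simp_all add: field_simps)
  then show ?thesis using assms Ints_add Ints_diff by metis
qed

lemma half_of_nat_Ints_iff: "(real n / 2) \<in> \<int> \<longleftrightarrow> even n"
  using half_Ints_iff[of "int n"] by simp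

context genus2_graph
begin

lemma circuit_edge_sum: "circuit G p \<Longrightarrow> (edge_sum (abelianization p) - real (length p)) / 2 \<in> \<int>"
  by (rule edge_sum_length) (simp add: circuit_def walk_def)

lemma even_circuits_imp_even_cycles:
  assumes even: "\<And>p. circuit G p \<Longrightarrow> even (length p)" and c: "c \<in> H1_int G"
  shows "edge_sum c / 2 \<in> \<int>"
proof -
  have "c \<in> {c. edge_sum c / 2 \<in> \<int>}"
  proof (rule circuits_generate_H1[OF _ _ _ c])
    show "(\<lambda>e. 0) \<in> {c. edge_sum c / 2 \<in> \<int>}" by (simp add: edge_sum_def)
    show "(\<lambda>e. c e + d e) \<in> {c. edge_sum c / 2 \<in> \<int>}"
      if "c \<in> {c. edge_sum c / 2 \<in> \<int>}" "d \<in> {c. edge_sum c / 2 \<in> \<int>}" for c d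
      using that by (simp add: edge_sum_linear add_divide_distrib)
    show "abelianization p \<in> {c. edge_sum c / 2 \<in> \<int>}" if "circuit G p" for p
      using half_diff_Ints_iff[OF circuit_edge_sum[OF that]] half_of_nat_Ints_iff even[OF that] by simp
  qed
  then show ?thesis by simp
qed

lemma bipartite_walk_parity:
  assumes AB: "verts G = A \<union> B" "A \<inter> B = {}" "\<And>a. a \<in> OE \<Longrightarrow> ini a \<in> A \<longleftrightarrow> ter a \<in> B"
    and "walk_via nb x p y" "x \<in> OE"
  shows "even (length p) \<longleftrightarrow> (ini x \<in> A \<longleftrightarrow> ini y \<in> A)"
  using assms(4,5)
proof (induction p arbitrary: x)
  case (Cons c p)
  then obtain z where z: "c = x" "nb x z" "walk_via nb z p y" by auto
  then have "z \<in> OE" "ter x = ini z" by (auto simp: nonbacktracking_def)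
  moreover have "ter x \<in> B \<longleftrightarrow> ter x \<notin> A" using AB(1,2) vertices_in(2)[OF Cons.prems(2)] by blast
  ultimately show ?case using Cons.IH[OF z(3)] AB(3)[OF Cons.prems(2)] by simp blast
qed simp

lemma bipartite_circuit_even:
  assumes "bipartite G" "circuit G p"
  shows "even (length p)"
proof -
  obtain A B where AB: "verts G = A \<union> B" "A \<inter> B = {}" "\<And>a. a \<in> OE \<Longrightarrow> ini a \<in> A \<longleftrightarrow> ter a \<in> B"
    using assms(1) unfolding bipartite_def by blast
  have "walk_via nb (hd p) p (hd p)" "hd p \<in> OE"
    using assms(2) core_OE circuit_iff_core circuit_iff_walk_via by blast+
  from bipartite_walk_parity[OF AB this] show ?thesis by simp
qed

text \<open>Double counting of oriented edges gives \<open>2 * m = n * d\<close>, and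
  \<open>m > n\<close> by the genus.\<close>

lemma regular_degree_ge_3:
  assumes "regular_graph G" "v \<in> verts G"
  shows "degree_at G v \<ge> 3"
proof -
  obtain d where d: "\<And>v. v \<in> verts G \<Longrightarrow> degree_at G v = d" using assms(1) unfolding regular_graph_def by blast
  have "OE = (\<Union>v\<in>verts G. {a \<in> OE. ini a = v})" using vertices_in by auto
  then have "card OE = (\<Sum>v\<in>verts G. card {a \<in> OE. ini a = v})"
    using card_UN_disjoint[of "verts G" "\<lambda>v. {a \<in> OE. ini a = v}"] finite_OE by auto
  also have "\<dots> = card (verts G) * d" using d by (simp add: degree_at_def)
  finally have "2 * card (arcs G) = card (verts G) * d"
    by (simp add: oriented_edges_def card_cartesian_product mult.commute)
  then have "card (verts G) * 2 < card (verts G) * d" using card_arcs by linarith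
  then show ?thesis using d[OF assms(2)] by simp
qed

lemma ex_other_edge:
  assumes "degree_at G v \<ge> 3"
  shows "\<exists>d\<in>OE. ini d = v \<and> d \<noteq> b \<and> d \<noteq> c"
proof (rule ccontr)
  assume "\<not> ?thesis"
  then have "{a \<in> OE. ini a = v} \<subseteq> {b, c}" by blast
  then have "card {a \<in> OE. ini a = v} \<le> card {b, c}" by (intro card_mono) auto
  also have "\<dots> \<le> 2" using card_length[of "[b, c]"] by simp
  finally show False using assms by (simp add: degree_at_def)
qed

lemma core_eq_OE:
  assumes "\<And>v. v \<in> verts G \<Longrightarrow> degree_at G v \<ge> 3"
  shows "core = OE"
proof (rule all_edges_core[OF core_nonempty])
  fix a assume a: "a \<in> OE"
  obtain b where "b \<in> OE" "ini b = ter a" "b \<noteq> edge_inv a"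
    using ex_other_edge[OF assms[OF vertices_in(2)[OF a]], of "edge_inv a" "edge_inv a"] by blast
  then have "nb a b" using a by (simp add: nonbacktracking_def)
  then show "\<exists>b. nb a b" ..
qed

end

context covered_graph
begin

text \<open>Vertices are coloured by the parity of \<open>edge_sum (s v)\<close>. The cycle of an
  edge has even sum and the edge itself an odd one, so its ends differ in colour; this covers edges
  outside the core as well.\<close>

lemma even_circuits_bipartite:
  assumes even: "\<And>p. circuit G p \<Longrightarrow> even (length p)"
  shows "bipartite G"
proof -
  define A where "A = {v\<in>verts G. edge_sum (s v) / 2 \<in> \<int>}"
  have "ini a \<in> A \<longleftrightarrow> ter a \<in> verts G - A" if a: "a \<in> OE" for a
  proof -
    note v = vertices_in[OF a]
    have int: "edge_sum (s w) \<in> \<int>" if "w \<in> verts G" for w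
      unfolding edge_sum_def using s[OF that] by (intro Ints_sum) blast
    obtain i where i: "edge_sum (s (ini a)) = of_int i" using int[OF v(1)] by (elim Ints_cases)
    obtain t where t: "edge_sum (s (ter a)) = of_int t" using int[OF v(2)] by (elim Ints_cases)
    have "(edge_sum (abelianization [a]) - real (length [a])) / 2 \<in> \<int>" using a by (intro edge_sum_length) simp
    then have "(edge_sum (edge_chain a) - 1) / 2 \<in> \<int>" by simp
    moreover have "edge_sum (cycle_of_edge a) / 2 \<in> \<int>"
      using even_circuits_imp_even_cycles[OF even cycle_of_edge_H1[OF a]] .
    ultimately have "edge_sum (cycle_of_edge a) / 2 - (edge_sum (edge_chain a) - 1) / 2 \<in> \<int>" by (rule Ints_diff[rotated])
    moreover have "edge_sum (cycle_of_edge a) = edge_sum (s (ini a)) + edge_sum (edge_chain a) - edge_sum (s (ter a))"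
      unfolding cycle_of_edge_def by (simp add: edge_sum_linear)
    then have "edge_sum (cycle_of_edge a) / 2 - (edge_sum (edge_chain a) - 1) / 2 = of_int (i - t + 1) / 2"
      unfolding i t by (simp add: add_divide_distrib diff_divide_distrib)
    ultimately have "of_int (i - t + 1) / 2 \<in> (\<int> :: real set)" by (simp only:)
    then have "even (i - t + 1)" unfolding half_Ints_iff .
    then have "even i \<longleftrightarrow> odd t" by auto
    then show ?thesis using v i t by (simp add: A_def half_Ints_iff)
  qed
  moreover have "verts G = A \<union> (verts G - A)" by (auto simp: A_def)
  moreover have "A \<inter> (verts G - A) = {}" by blast
  ultimately show ?thesis unfolding bipartite_def
    by (intro exI[of _ A] exI[of _ "verts G - A"] conjI ballI)
qed

text \<open>For an even period the parity of the length of a closed walk is a function of its class,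
  additive under concatenation. It agrees with \<open>edge_sum\<close> on circuits, hence on all of
  \<open>H1_int\<close>.\<close>

lemma even_cover_period_class_parity:
  assumes even: "even cover_period" and c: "c \<in> H1_int G"
    and p: "x \<in> core" "walk_via core_step x p x" "cls p = coset c"
  shows "(edge_sum c - real (length p)) / 2 \<in> \<int>"
proof -
  define H where "H = {c \<in> H1_int G. \<forall>x p. x \<in> core \<longrightarrow> walk_via core_step x p x \<longrightarrow> cls p = coset c \<longrightarrow>
    (edge_sum c - real (length p)) / 2 \<in> \<int>}"
  have len: "(real (length p) - real (length q)) / 2 \<in> \<int>"
    if "x \<in> core" "walk_via core_step x p x" "y \<in> core" "walk_via core_step y q y" "cls p = cls q" for x y p q
  proof -
    have "[length p = length q] (mod cover_period)" using closed_lengths_cong that by blast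
    then have "[length p = length q] (mod 2)" using even by (rule cong_dvd_modulus_nat)
    then have "even (int (length p) - int (length q))" by (auto simp: cong_def)
    then show ?thesis unfolding half_Ints_iff[symmetric] by simp
  qed
  have "c \<in> H"
  proof (rule circuits_generate_H1[OF _ _ _ c])
    have "(edge_sum (\<lambda>e. 0) - real (length p)) / 2 \<in> \<int>"
      if "x \<in> core" "walk_via core_step x p x" "cls p = coset (\<lambda>e. 0)" for x p
      using len[OF that(1) _ that(1,2), of "[]"] that(3) by (simp add: edge_sum_def cls_def coset_one)
    then show "(\<lambda>e. 0) \<in> H" using H1_int_closed(1) by (simp add: H_def)
    fix c d assume cd: "c \<in> H" "d \<in> H"
    then have cd': "c \<in> H1_int G" "d \<in> H1_int G" by (simp_all add: H_def)
    show "(\<lambda>e. c e + d e) \<in> H" unfolding H_def mem_Collect_eq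
    proof (intro conjI allI impI)
      show "(\<lambda>e. c e + d e) \<in> H1_int G" using cd' by (rule H1_int_closed)
      fix x p assume p: "x \<in> core" "walk_via core_step x p x" "cls p = coset (\<lambda>e. c e + d e)"
      obtain p1 where p1: "walk_via core_step x p1 x" "cls p1 = coset c"
        using closed_walk_every_class[OF p(1), of "coset c"] cd' carrier_Q by blast
      obtain p2 where p2: "walk_via core_step x p2 x" "cls p2 = coset d"
        using closed_walk_every_class[OF p(1), of "coset d"] cd' carrier_Q by blast
      have w: "walk_via core_step x (p1 @ p2) x" using p1 p2 by (auto simp: walk_via_append)
      have "cls (p1 @ p2) = cls p" using cls_append[OF p1(1) p2(1)] p1 p2 p(3) coset_mult[OF cd'] by simp
      then have 1: "(real (length (p1 @ p2)) - real (length p)) / 2 \<in> \<int>" by (rule len[OF p(1) w p(1,2)])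
      have 2: "(edge_sum c - real (length p1)) / 2 \<in> \<int>" "(edge_sum d - real (length p2)) / 2 \<in> \<int>"
        using cd p(1) p1 p2 unfolding H_def by blast+
      have "(edge_sum (\<lambda>e. c e + d e) - real (length p)) / 2 = (edge_sum c - real (length p1)) / 2 +
        (edge_sum d - real (length p2)) / 2 + (real (length (p1 @ p2)) - real (length p)) / 2"
        by (simp add: edge_sum_linear field_simps)
      also have "\<dots> \<in> \<int>" by (intro Ints_add 1 2)
      finally show "(edge_sum (\<lambda>e. c e + d e) - real (length p)) / 2 \<in> \<int>" .
    qed
  next
    fix P assume P: "circuit G P"
    then have w: "hd P \<in> core" "walk_via core_step (hd P) P (hd P)" using circuit_iff_core by blast+
    show "abelianization P \<in> H" unfolding H_def mem_Collect_eq
    proof (intro conjI allI impI)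
      show "abelianization P \<in> H1_int G" by (rule circuit_H1_int[OF P])
      fix x p assume p: "x \<in> core" "walk_via core_step x p x" "cls p = coset (abelianization P)"
      have "(real (length P) - real (length p)) / 2 \<in> \<int>"
        by (rule len[OF w p(1,2)]) (simp add: p(3) cls_closed[OF w(2)])
      then have "(edge_sum (abelianization P) - real (length P)) / 2 + (real (length P) - real (length p)) / 2 \<in> \<int>"
        using circuit_edge_sum[OF P] by (intro Ints_add)
      then show "(edge_sum (abelianization P) - real (length p)) / 2 \<in> \<int>" by (simp add: diff_divide_distrib)
    qed
  qed
  then show ?thesis using p unfolding H_def by blast
qed

text \<open>Membership means that \<theta> is trivial on \<Lambda>: a change of representative
  alters the values on homology only by integers.\<close>

lemma canonical_character_iff:
  "canonical_character G \<in> quotient_characters G \<Lambda> \<longleftrightarrow> (\<forall>c\<in>\<Lambda>. edge_sum c / 2 \<in> \<int>)"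
proof -
  define h where "h = harmonic_part G (orientation_form G)"
  note h = harmonic_part[OF orientation_form, folded h_def]
  have ev: "form_eval G h c = edge_sum c / 2" if "c \<in> H1_int G" for c
    using h(2)[OF that] form_eval_orientation by simp
  have \<theta>: "canonical_character G = harmonic_coset G h"
    by (simp add: canonical_character_def character_of_def h_def)
  show ?thesis
  proof
    assume "canonical_character G \<in> quotient_characters G \<Lambda>"
    then obtain \<eta> where \<eta>: "\<eta> \<in> dual_lattice G \<Lambda>" "harmonic_coset G h = harmonic_coset G \<eta>"
      unfolding quotient_characters_def \<theta> by blast
    then have d: "(\<lambda>e. h e - \<eta> e) \<in> dual_lattice G (H1_int G)" by (simp add: harmonic_coset_eq_iff)
    show "\<forall>c\<in>\<Lambda>. edge_sum c / 2 \<in> \<int>"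
    proof
      fix c assume c: "c \<in> \<Lambda>"
      then have cH: "c \<in> H1_int G" using \<Lambda>_H1 by blast
      have "form_eval G (\<lambda>e. h e - \<eta> e) c \<in> \<int>" "form_eval G \<eta> c \<in> \<int>"
        using d \<eta>(1) c cH by (auto simp: dual_lattice_def)
      then have "form_eval G (\<lambda>e. h e - \<eta> e) c + form_eval G \<eta> c \<in> \<int>" by (rule Ints_add)
      then show "edge_sum c / 2 \<in> \<int>" using ev[OF cH] by (simp add: form_eval_linear)
    qed
  next
    assume all: "\<forall>c\<in>\<Lambda>. edge_sum c / 2 \<in> \<int>"
    have "form_eval G h c \<in> \<int>" if "c \<in> \<Lambda>" for c
    proof -
      have "form_eval G h c = edge_sum c / 2" using ev \<Lambda>_H1 that by blast
      then show ?thesis using bspec[OF all that] by (simp only:)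
    qed
    then have "h \<in> dual_lattice G \<Lambda>" using h(1) by (simp add: dual_lattice_def)
    then show "canonical_character G \<in> quotient_characters G \<Lambda>"
      unfolding quotient_characters_def \<theta> by blast
  qed
qed

lemma cover_period_eq_nu_if_not_theta:
  assumes "canonical_character G \<notin> quotient_characters G \<Lambda>"
  shows "cover_period = nu G"
proof (rule ccontr)
  assume "cover_period \<noteq> nu G"
  then have even: "even cover_period" using cover_period_cases by auto
  obtain c where c: "c \<in> \<Lambda>" "edge_sum c / 2 \<notin> \<int>" using assms unfolding canonical_character_iff by blast
  obtain x where x: "x \<in> core" using core_nonempty by blast
  \<comment> \<open>The empty walk, of length 0, represents the class of
    \<open>c \<in> \<Lambda>\<close>, so an even period would force \<open>edge_sum c\<close> to be
    even.\<close>
  have "cls [] = coset (\<lambda>e. 0)" by (simp add: cls_def coset_one)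
  also have "\<dots> = coset c" using c(1) additively_closedD(3)[OF \<Lambda>_closed] by (simp add: coset_eq_iff)
  finally have "(edge_sum c - real (length ([] :: ('e \<times> bool) list))) / 2 \<in> \<int>"
    using even_cover_period_class_parity[OF even _ x, of c "[]"] c(1) \<Lambda>_H1 by auto
  then show False using c(2) by simp
qed

lemma odd_nu_if_not_bipartite:
  assumes "\<not> bipartite G"
  shows "odd (nu G)"
proof
  assume "even (nu G)"
  then have "even (length p)" if "circuit G p" for p using nu_dvd_circuit[OF that] by (rule dvd_trans)
  then show False using even_circuits_bipartite assms by blast
qed

text \<open>If \<theta> is trivial on \<Lambda>, closed walks with class in \<Lambda> have even
  length; \<open>nu G\<close> is odd without a bipartition, so it cannot be the period.\<close>

lemma cover_period_eq_twice_nu: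
  assumes "\<not> bipartite G" "canonical_character G \<in> quotient_characters G \<Lambda>"
  shows "cover_period = 2 * nu G"
proof -
  have "2 dvd cover_period"
  proof (rule cover_period_greatest)
    fix x p assume p: "x \<in> core" "walk_via core_step x p x" "abelianization p \<in> \<Lambda>"
    have "set p \<subseteq> core" using walk_via_subset[OF _ p(2), of core] by blast
    then have "(edge_sum (abelianization p) - real (length p)) / 2 \<in> \<int>"
      using core_OE by (intro edge_sum_length) blast
    then show "2 dvd length p"
      using half_diff_Ints_iff half_of_nat_Ints_iff assms(2) p(3) canonical_character_iff by blast
  qed
  then show ?thesis using cover_period_cases odd_nu_if_not_bipartite[OF assms(1)] by auto
qed

lemma chi_canonical_character:
  assumes \<theta>: "canonical_character G \<in> quotient_characters G \<Lambda>" and \<alpha>: "\<alpha> \<in> H1_int G"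
  shows "chi_coset G (canonical_character G) (coset \<alpha>) = (if edge_sum \<alpha> / 2 \<in> \<int> then 1 else - 1)"
proof -
  define h where "h = harmonic_part G (orientation_form G)"
  note h = harmonic_part[OF orientation_form, folded h_def]
  have \<theta>_eq: "canonical_character G = harmonic_coset G h"
    by (simp add: canonical_character_def character_of_def h_def)
  obtain k where k: "edge_sum \<alpha> = of_int k" using edge_sum_Ints[OF \<alpha>] by (elim Ints_cases)
  have val: "chi G \<omega> a = (if even k then 1 else - 1)" if \<omega>: "\<omega> \<in> canonical_character G" and a: "a \<in> coset \<alpha>" for \<omega> a
  proof (rule chi_half_integer)
    have l: "(\<lambda>e. a e - \<alpha> e) \<in> \<Lambda>" using a unfolding mem_coset coset_eq_iff .
    then have lH: "(\<lambda>e. a e - \<alpha> e) \<in> H1_int G" using \<Lambda>_H1 by blast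
    then have aH: "a \<in> H1_int G" using H1_int_closed(2)[OF lH \<alpha>] by simp
    have "(\<lambda>e. \<omega> e - h e) \<in> dual_lattice G (H1_int G)"
      using \<omega> unfolding \<theta>_eq harmonic_coset_def mem_pointwise_coset .
    then have 1: "form_eval G (\<lambda>e. \<omega> e - h e) a \<in> \<int>" using aH by (simp add: dual_lattice_def)
    have 2: "edge_sum (\<lambda>e. a e - \<alpha> e) / 2 \<in> \<int>" using \<theta> l canonical_character_iff by blast
    have "form_eval G \<omega> a - of_int k / 2 = form_eval G (\<lambda>e. \<omega> e - h e) a + edge_sum (\<lambda>e. a e - \<alpha> e) / 2"
      using h(2)[OF aH] by (simp add: form_eval_linear form_eval_orientation edge_sum_linear k field_simps)
    then show "form_eval G \<omega> a - of_int k / 2 \<in> \<int>" using 1 2 by simp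
  qed
  have "h \<in> canonical_character G"
    unfolding \<theta>_eq harmonic_coset_def mem_pointwise_coset
    using additively_closedD(1)[OF additively_closed_dual_lattice] by simp
  moreover have "\<alpha> \<in> coset \<alpha>" by (simp add: mem_coset)
  ultimately have "chi_coset G (canonical_character G) (coset \<alpha>) = (if even k then 1 else - 1)"
    unfolding chi_coset_def
  proof (intro the_equality)
    assume "h \<in> canonical_character G" "\<alpha> \<in> coset \<alpha>"
    then show "\<exists>\<omega>\<in>canonical_character G. \<exists>\<alpha>\<in>coset \<alpha>. (if even k then 1 else - 1) = chi G \<omega> \<alpha>"
      using val by (intro bexI[of _ h] bexI[of _ \<alpha>]) simp_all
    fix z assume "\<exists>\<omega>\<in>canonical_character G. \<exists>\<alpha>\<in>coset \<alpha>. z = chi G \<omega> \<alpha>"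
    then show "z = (if even k then 1 else - 1)" using val by auto
  qed
  then show ?thesis by (simp add: k half_Ints_iff)
qed

lemma circuit_class_parity:
  assumes \<theta>: "canonical_character G \<in> quotient_characters G \<Lambda>"
    and p: "circuit G p" "abelianization p \<in> coset \<alpha>"
  shows "even (length p) \<longleftrightarrow> edge_sum \<alpha> / 2 \<in> \<int>"
proof -
  have "(\<lambda>e. abelianization p e - \<alpha> e) \<in> \<Lambda>" using p(2) unfolding mem_coset coset_eq_iff .
  then have "(edge_sum (abelianization p) - edge_sum \<alpha>) / 2 \<in> \<int>"
    using \<theta> canonical_character_iff by (force simp: edge_sum_linear)
  then show ?thesis
    using half_diff_Ints_iff circuit_edge_sum[OF p(1)] half_of_nat_Ints_iff by blast
qed

lemma exists_odd_multiple:
  assumes x: "x \<in> core"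
  shows "\<exists>p. walk_via core_step x p x \<and> odd (length p div nu G)"
proof (rule ccontr)
  assume no: "\<not> ?thesis"
  have "2 * nu G dvd rc.period x" unfolding rc.period_def
  proof (rule Gcd_greatest)
    fix n assume "n \<in> {n. \<exists>p. length p = n \<and> walk_via core_step x p x}"
    then obtain p where p: "length p = n" "walk_via core_step x p x" by blast
    then have "even (n div nu G)" "nu G dvd n" using no nu_dvd_closed[OF x p(2)] by blast+
    then show "2 * nu G dvd n" using nu_pos by (auto elim!: dvdE)
  qed
  then have "2 * nu G dvd nu G" using rho_nu(2)[OF x] by simp
  then show False using nu_pos by (auto dest: dvd_imp_le)
qed

text \<open>
  If the period of the cover is \<open>2 * nu G\<close>, then the parity of the length divided by \<open>nu G\<close> is a
  nontrivial homomorphism from the quotient to the integers mod 2. Half of it, evaluated on the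
  fundamental cycles of the edges, is a 1-form whose harmonic part is a 2-torsion character.
\<close>

lemma cover_period_eq_nu_if_no_two_torsion:
  assumes no: "\<forall>x\<in>quotient_characters G \<Lambda>. x \<noteq> \<one>\<^bsub>character_group G\<^esub> \<longrightarrow>
    x \<otimes>\<^bsub>character_group G\<^esub> x \<noteq> \<one>\<^bsub>character_group G\<^esub>"
  shows "cover_period = nu G"
proof (rule ccontr)
  assume "cover_period \<noteq> nu G"
  then have D: "cover_period = 2 * nu G" using cover_period_cases by blast
  obtain x where x: "x \<in> core" using core_nonempty by blast
  \<comment> \<open>Lengths of closed walks in one class agree modulo \<open>2 * nu G\<close>, so
    this parity depends neither on the chosen walk nor on its base edge.\<close>
  define \<psi> where "\<psi> = (\<lambda>c. odd (length (SOME p. walk_via core_step x p x \<and> cls p = coset c) div nu G))"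
  have \<psi>: "\<psi> c \<longleftrightarrow> odd (length p div nu G)" if A: "y \<in> core" "walk_via core_step y p y" "cls p = coset c" "c \<in> H1_int G" for c p y
  proof -
    define p' where "p' = (SOME p. walk_via core_step x p x \<and> cls p = coset c)"
    have "\<exists>p. walk_via core_step x p x \<and> cls p = coset c"
      using closed_walk_every_class[OF x, of "coset c"] A(4) carrier_Q by blast
    then have p': "walk_via core_step x p' x" "cls p' = coset c" unfolding p'_def by (metis (mono_tags, lifting) someI_ex)+
    have "[length p' = length p] (mod cover_period)"
      using closed_lengths_cong[OF x p'(1) A(1,2)] p'(2) A(3) by simp
    moreover obtain i j where ij: "length p' = nu G * i" "length p = nu G * j"
      using nu_dvd_closed[OF x p'(1)] nu_dvd_closed[OF A(1,2)] by blast
    ultimately have "[nu G * i = nu G * j] (mod (nu G * 2))" by (simp add: D mult.commute)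
    then have "[i = j] (mod 2)" using nu_pos by (simp add: cong_def mult_mod_right[symmetric])
    then show ?thesis unfolding \<psi>_def p'_def[symmetric] using ij nu_pos by (simp add: cong_def) presburger
  qed
  define half where "half = (\<lambda>b. if b then 1 / 2 else 0 :: real)"
  have \<psi>_add: "half (\<psi> (\<lambda>e. c e + d e)) - half (\<psi> c) - half (\<psi> d) \<in> \<int>" if cd: "c \<in> H1_int G" "d \<in> H1_int G" for c d
  proof -
    obtain p where p: "walk_via core_step x p x" "cls p = coset c"
      using closed_walk_every_class[OF x, of "coset c"] cd carrier_Q by blast
    obtain q where q: "walk_via core_step x q x" "cls q = coset d"
      using closed_walk_every_class[OF x, of "coset d"] cd carrier_Q by blast
    have w: "walk_via core_step x (p @ q) x" using p q by (auto simp: walk_via_append)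
    have "cls (p @ q) = coset (\<lambda>e. c e + d e)" using cls_append[OF p(1) q(1)] p q coset_mult[OF cd] by simp
    then have "\<psi> (\<lambda>e. c e + d e) \<longleftrightarrow> odd (length (p @ q) div nu G)"
      using \<psi>[OF x w] H1_int_closed(2)[OF cd] by blast
    also have "length (p @ q) div nu G = length p div nu G + length q div nu G"
      using nu_dvd_closed[OF x p(1)] by (simp add: div_plus_div_distrib_dvd_left)
    finally show ?thesis using \<psi>[OF x p cd(1)] \<psi>[OF x q cd(2)] by (auto simp: half_def)
  qed
  have \<psi>_\<Lambda>: "\<not> \<psi> c" if c: "c \<in> \<Lambda>" for c
  proof -
    have "cls [] = coset (\<lambda>e. 0)" by (simp add: cls_def coset_one)
    also have "\<dots> = coset c" using c additively_closedD(3)[OF \<Lambda>_closed] by (simp add: coset_eq_iff)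
    finally show ?thesis using \<psi>[OF x, of "[]" c] c \<Lambda>_H1 by auto
  qed
  have \<psi>_0: "\<not> \<psi> (\<lambda>e. 0)" using \<psi>_\<Lambda> additively_closedD(1)[OF \<Lambda>_closed] by blast
  define \<omega> where "\<omega> = (\<lambda>e. if e \<in> arcs G then half (\<psi> (cycle_of_edge (e, True))) else 0)"
  have \<omega>_forms: "\<omega> \<in> forms G" by (simp add: \<omega>_def forms_def)
  \<comment> \<open>The form is prescribed on positive edges only; for an inverse edge the sign is
    harmless, because 1/2 and -1/2 agree modulo integers.\<close>
  have edge: "form_eval G \<omega> (edge_chain a) - half (\<psi> (cycle_of_edge a)) \<in> \<int>" if a: "a \<in> OE" for a
  proof -
    obtain e b where ab: "a = (e, b)" by fastforce
    have e: "e \<in> arcs G" using a ab by (simp add: oriented_edges_def)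
    have "form_eval G \<omega> (edge_chain a) = (\<Sum>f\<in>arcs G. if f = e then (if b then \<omega> e else - \<omega> e) else 0)"
      unfolding form_eval_def ab by (rule sum.cong) (auto simp: edge_chain_def)
    then have ev: "form_eval G \<omega> (edge_chain a) = (if b then \<omega> e else - \<omega> e)" using e by simp
    show ?thesis
    proof (cases b)
      case True
      then show ?thesis using ev e ab by (simp add: \<omega>_def)
    next
      case False
      have "(\<lambda>e'. cycle_of_edge a e' + cycle_of_edge (e, True) e') = (\<lambda>e. 0)"
        using False ab edge_chain_inv[of "(e, True)"]
        by (auto simp: cycle_of_edge_def edge_inv_def initial_vertex_def terminal_vertex_def)
      then have "half False - half (\<psi> (cycle_of_edge a)) - half (\<psi> (cycle_of_edge (e, True))) \<in> \<int>"
        using \<psi>_add[OF cycle_of_edge_H1[OF a] cycle_of_edge_H1, of "(e, True)"] e \<psi>_0 by (simp add: oriented_edges_def)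
      then show ?thesis using ev e False by (simp add: \<omega>_def half_def split: if_splits)
    qed
  qed
  have walk: "form_eval G \<omega> (abelianization p) - half (\<psi> (\<lambda>e. s (ini y) e + abelianization p e - s (ini z) e)) \<in> \<int>"
    if "walk_via core_step y p z" for p y z
    using that
  proof (induction p arbitrary: y)
    case Nil
    then show ?case using \<psi>_0 by (simp add: half_def form_eval_def)
  next
    case (Cons a p)
    then obtain t where t: "a = y" "core_step y t" "walk_via core_step t p z" by auto
    then have y: "y \<in> OE" "ter y = ini t" by (auto simp: nonbacktracking_def)
    let ?K = "\<lambda>e. s (ini t) e + abelianization p e - s (ini z) e"
    have eq: "(\<lambda>e. cycle_of_edge y e + ?K e) = (\<lambda>e. s (ini y) e + abelianization (a # p) e - s (ini z) e)"
      using y(2) t(1) by (auto simp: cycle_of_edge_def)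
    have 1: "half (\<psi> (\<lambda>e. cycle_of_edge y e + ?K e)) - half (\<psi> (cycle_of_edge y)) - half (\<psi> ?K) \<in> \<int>"
      by (rule \<psi>_add[OF cycle_of_edge_H1[OF y(1)] foldr_cycle_of_edge(1)[OF t(3)]])
    note 2 = edge[OF y(1)] and 3 = Cons.IH[OF t(3)]
    have "form_eval G \<omega> (abelianization (a # p)) - half (\<psi> (\<lambda>e. cycle_of_edge y e + ?K e)) =
      (form_eval G \<omega> (edge_chain y) - half (\<psi> (cycle_of_edge y))) + (form_eval G \<omega> (abelianization p) - half (\<psi> ?K)) -
      (half (\<psi> (\<lambda>e. cycle_of_edge y e + ?K e)) - half (\<psi> (cycle_of_edge y)) - half (\<psi> ?K))"
      using t(1) by (simp add: form_eval_linear)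
    also have "\<dots> \<in> \<int>" by (intro Ints_diff[OF Ints_add] 1 2 3)
    finally show ?case unfolding eq .
  qed
  have ev: "form_eval G \<omega> c - half (\<psi> c) \<in> \<int>" if c: "c \<in> H1_int G" for c
  proof -
    have "c \<in> {c \<in> H1_int G. form_eval G \<omega> c - half (\<psi> c) \<in> \<int>}"
    proof (rule circuits_generate_H1[OF _ _ _ c])
      show "(\<lambda>e. 0) \<in> {c \<in> H1_int G. form_eval G \<omega> c - half (\<psi> c) \<in> \<int>}"
        using \<psi>_0 H1_int_closed(1) by (simp add: half_def form_eval_def)
      fix c d assume "c \<in> {c \<in> H1_int G. form_eval G \<omega> c - half (\<psi> c) \<in> \<int>}"
        "d \<in> {c \<in> H1_int G. form_eval G \<omega> c - half (\<psi> c) \<in> \<int>}"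
      then have cd: "c \<in> H1_int G" "d \<in> H1_int G" "form_eval G \<omega> c - half (\<psi> c) \<in> \<int>" "form_eval G \<omega> d - half (\<psi> d) \<in> \<int>"
        by simp_all
      have "form_eval G \<omega> (\<lambda>e. c e + d e) - half (\<psi> (\<lambda>e. c e + d e)) =
        (form_eval G \<omega> c - half (\<psi> c)) + (form_eval G \<omega> d - half (\<psi> d)) -
        (half (\<psi> (\<lambda>e. c e + d e)) - half (\<psi> c) - half (\<psi> d))" by (simp add: form_eval_linear)
      also have "\<dots> \<in> \<int>" by (intro Ints_diff[OF Ints_add] cd \<psi>_add)
      finally show "(\<lambda>e. c e + d e) \<in> {c \<in> H1_int G. form_eval G \<omega> c - half (\<psi> c) \<in> \<int>}"
        using H1_int_closed(2)[OF cd(1,2)] by simp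
    next
      fix p assume p: "circuit G p"
      then have "walk_via core_step (hd p) p (hd p)" using circuit_iff_core by blast
      from walk[OF this] show "abelianization p \<in> {c \<in> H1_int G. form_eval G \<omega> c - half (\<psi> c) \<in> \<int>}"
        using circuit_H1_int[OF p] by simp
    qed
    then show ?thesis by simp
  qed
  define \<eta> where "\<eta> = harmonic_part G \<omega>"
  note \<eta> = harmonic_part[OF \<omega>_forms, folded \<eta>_def]
  have "\<eta> \<in> dual_lattice G \<Lambda>"
    unfolding dual_lattice_def
  proof (intro CollectI conjI ballI)
    fix c assume c: "c \<in> \<Lambda>"
    then have "c \<in> H1_int G" using \<Lambda>_H1 by blast
    then show "form_eval G \<eta> c \<in> \<int>" using \<eta>(2) ev[of c] \<psi>_\<Lambda>[OF c] by (simp add: half_def)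
  qed (rule \<eta>(1))
  then have mem: "harmonic_coset G \<eta> \<in> quotient_characters G \<Lambda>" unfolding quotient_characters_def by blast
  have "harmonic_coset G \<eta> \<noteq> \<one>\<^bsub>character_group G\<^esub>"
  proof
    assume "harmonic_coset G \<eta> = \<one>\<^bsub>character_group G\<^esub>"
    then have "(\<lambda>e. \<eta> e - 0) \<in> dual_lattice G (H1_int G)" unfolding one_character_group harmonic_coset_eq_iff .
    then have int: "form_eval G \<eta> c \<in> \<int>" if "c \<in> H1_int G" for c using that by (simp add: dual_lattice_def)
    \<comment> \<open>The lengths have gcd \<open>nu G\<close>, so some closed walk is an odd
      multiple of it; there \<eta> takes the value 1/2 modulo integers.\<close>
    obtain p where p: "walk_via core_step x p x" "odd (length p div nu G)" using exists_odd_multiple[OF x] by blast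
    note H = closed_walk_H1[OF p(1)]
    have "\<psi> (abelianization p)" using \<psi>[OF x p(1) cls_closed[OF p(1)] H] p(2) by blast
    then have "form_eval G \<omega> (abelianization p) - 1 / 2 \<in> \<int>" using ev[OF H] by (simp add: half_def)
    moreover have "form_eval G \<omega> (abelianization p) \<in> \<int>" using int[OF H] \<eta>(2)[OF H] by simp
    ultimately have "form_eval G \<omega> (abelianization p) - (form_eval G \<omega> (abelianization p) - 1 / 2) \<in> \<int>" by (rule Ints_diff[rotated])
    then show False using half_Ints_iff[of 1] by simp
  qed
  moreover have "harmonic_coset G \<eta> \<otimes>\<^bsub>character_group G\<^esub> harmonic_coset G \<eta> = \<one>\<^bsub>character_group G\<^esub>"
    unfolding harmonic_coset_mult[OF \<eta>(1) \<eta>(1)] one_character_group harmonic_coset_eq_iff dual_lattice_def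
  proof (intro CollectI conjI ballI)
    show "(\<lambda>e. \<eta> e + \<eta> e - 0) \<in> harmonic_forms G"
      using additively_closedD(2)[OF additively_closed_harmonic \<eta>(1) \<eta>(1)] by simp
    fix c assume c: "c \<in> H1_int G"
    have "2 * form_eval G \<omega> c = 2 * (form_eval G \<omega> c - half (\<psi> c)) + 2 * half (\<psi> c)" by simp
    moreover have "2 * (form_eval G \<omega> c - half (\<psi> c)) \<in> \<int>" using ev[OF c] by (intro Ints_mult) simp_all
    then have "2 * (form_eval G \<omega> c - half (\<psi> c)) + 2 * half (\<psi> c) \<in> \<int>"
      by (rule Ints_add) (simp add: half_def)
    ultimately have "form_eval G \<omega> c + form_eval G \<omega> c \<in> \<int>" by (simp only: mult_2)
    then show "form_eval G (\<lambda>e. \<eta> e + \<eta> e - 0) c \<in> \<int>"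
      unfolding diff_zero form_eval_linear(1) \<eta>(2)[OF c] .
  qed
  ultimately show False using no mem by blast
qed

text \<open>
  At a vertex of degree at least 3 the cyclic class of an outgoing edge of the cover only depends on
  the vertex, since any two outgoing edges follow a common incoming one. Going along an edge and
  back then shows that the period divides 2.
\<close>

lemma cover_period_eq_nu_if_regular:
  assumes "regular_graph G" "bipartite G"
  shows "cover_period = nu G"
proof -
  have deg: "degree_at G v \<ge> 3" if "v \<in> verts G" for v using regular_degree_ge_3 assms(1) that by blast
  have core: "core = OE" using core_eq_OE deg by blast
  obtain a0 where a0: "a0 \<in> core" using core_nonempty by blast
  define \<kappa> where "\<kappa> = (\<lambda>a. coset (cycle_of_edge a))"
  \<comment> \<open>\<open>L n b q\<close> says that the point \<open>(b, q)\<close> of the cover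
    lies in phase \<open>n\<close>, counted from \<open>a0\<close> over the identity.\<close>
  define L where "L = (\<lambda>n b q. \<exists>p. walk_via core_step a0 p b \<and> cls p = q \<and> [length p = n] (mod cover_period))"
  have \<kappa>: "\<kappa> a \<in> carrier Q" if "a \<in> core" for a unfolding \<kappa>_def carrier_Q using that core_OE cycle_of_edge_H1 by blast
  have cls1: "cls [a] = \<kappa> a" if "a \<in> core" for a using \<kappa>[OF that] by (simp add: cls_def \<kappa>_def)
  have step: "L (n + 1) c (q \<otimes>\<^bsub>Q\<^esub> \<kappa> b)" if L: "L n b q" and bc: "core_step b c" for n b c q
  proof -
    obtain p where p: "walk_via core_step a0 p b" "cls p = q" "[length p = n] (mod cover_period)" using L unfolding L_def by blast
    have b: "walk_via core_step b [b] c" using bc by simp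
    have "walk_via core_step a0 (p @ [b]) c" using p(1) bc by (auto simp: walk_via_append)
    moreover have "cls (p @ [b]) = q \<otimes>\<^bsub>Q\<^esub> \<kappa> b" using cls_append[OF p(1) b] p(2) cls1 bc by simp
    moreover have "[length (p @ [b]) = n + 1] (mod cover_period)" using cong_add[OF p(3) cong_refl[of 1]] by simp
    ultimately show ?thesis unfolding L_def by blast
  qed
  have uniq: "[n = m] (mod cover_period)" if A: "L n b q" "L m b q" "b \<in> core" for n m b q
  proof -
    obtain p where p: "walk_via core_step a0 p b" "cls p = q" "[length p = n] (mod cover_period)"
      using A(1) unfolding L_def by blast
    obtain p' where p': "walk_via core_step a0 p' b" "cls p' = q" "[length p' = m] (mod cover_period)"
      using A(2) unfolding L_def by blast
    have "[length p = length p'] (mod cover_period)"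
      using walk_lengths_cong_cover_period[OF a0 A(3) p(1) p'(1)] p(2) p'(2) by (simp add: cong_def)
    then show ?thesis using p(3) p'(3) by (simp only: cong_def)
  qed
  have exL: "\<exists>n. L n b q" if bq: "b \<in> core" "q \<in> carrier Q" for b q
  proof -
    obtain p where "walk_via core_step a0 p b" "cls p = q"
      using vd.transitive[OF a0 bq] unfolding cls_def[symmetric] by blast
    then have "L (length p) b q" unfolding L_def by (intro exI[of _ p]) simp
    then show ?thesis ..
  qed
  have same: "L n c q" if L: "L n b q" and b: "b \<in> core" and c: "c \<in> core" "ini c = ini b" and q: "q \<in> carrier Q" for n b c q
  proof -
    \<comment> \<open>The third edge \<open>d\<close> at this vertex differs from \<open>b\<close>
      and from \<open>c\<close>, so its inverse is a common predecessor of both.\<close>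
    have "ini b \<in> verts G" using b core vertices_in by blast
    then obtain d where d: "d \<in> OE" "ini d = ini b" "d \<noteq> b" "d \<noteq> c" using ex_other_edge[OF deg] by blast
    define i where "i = edge_inv d"
    have i: "i \<in> core" using d core by (simp add: i_def)
    have ib: "core_step i b" "core_step i c" using d b c i core unfolding i_def nonbacktracking_def by auto
    have qi: "q \<otimes>\<^bsub>Q\<^esub> inv\<^bsub>Q\<^esub> \<kappa> i \<in> carrier Q" "(q \<otimes>\<^bsub>Q\<^esub> inv\<^bsub>Q\<^esub> \<kappa> i) \<otimes>\<^bsub>Q\<^esub> \<kappa> i = q"
      using q \<kappa>[OF i] by (simp_all add: Qg.m_assoc)
    obtain m where m: "L m i (q \<otimes>\<^bsub>Q\<^esub> inv\<^bsub>Q\<^esub> \<kappa> i)" using exL[OF i qi(1)] by blast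
    have "L (m + 1) b q" "L (m + 1) c q" using step[OF m ib(1)] step[OF m ib(2)] qi(2) by simp_all
    moreover from this have "[m + 1 = n] (mod cover_period)" using uniq[OF _ L b] by blast
    ultimately show ?thesis unfolding L_def by (blast intro: cong_trans)
  qed
  have succ: "\<exists>b. core_step a b" if "a \<in> core" for a
  proof -
    have a: "a \<in> OE" using that core by simp
    obtain b where "b \<in> OE" "ini b = ter a" "b \<noteq> edge_inv a"
      using ex_other_edge[OF deg[OF vertices_in(2)[OF a]], of "edge_inv a" "edge_inv a"] by blast
    then have "nb a b" using a by (simp add: nonbacktracking_def)
    then show ?thesis using that core nb_OE by blast
  qed
  define i where "i = edge_inv a0"
  have i: "i \<in> core" using core_inv a0 by (simp add: i_def)
  \<comment> \<open>The step from \<open>a0\<close> to its inverse \<open>i\<close> backtracks, but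
    a proper successor \<open>b\<close> starts at the same vertex as \<open>i\<close>, so
    \<open>same\<close> replaces \<open>b\<close> by \<open>i\<close>. The same exchange leads from
    a successor of \<open>i\<close> back to \<open>a0\<close>; the two voltages cancel, and phase 2
    equals phase 0.\<close>
  have "L 0 a0 \<one>\<^bsub>Q\<^esub>" unfolding L_def by (rule exI[of _ "[]"]) (simp add: cls_def)
  moreover obtain b where b: "core_step a0 b" using succ a0 by blast
  ultimately have "L 1 b (\<one>\<^bsub>Q\<^esub> \<otimes>\<^bsub>Q\<^esub> \<kappa> a0)" using step by fastforce
  then have "L 1 b (\<kappa> a0)" using \<kappa>[OF a0] by simp
  then have "L 1 i (\<kappa> a0)"
    by (rule same) (use b i \<kappa>[OF a0] in \<open>auto simp: i_def nonbacktracking_def\<close>)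
  moreover obtain c where c: "core_step i c" using succ i by blast
  ultimately have "L (1 + 1) c (\<kappa> a0 \<otimes>\<^bsub>Q\<^esub> \<kappa> i)" using step by blast
  moreover have "\<kappa> a0 \<otimes>\<^bsub>Q\<^esub> \<kappa> i = \<one>\<^bsub>Q\<^esub>"
  proof -
    have "(\<lambda>e. cycle_of_edge a0 e + cycle_of_edge i e) = (\<lambda>e. 0)"
      by (auto simp: cycle_of_edge_def i_def edge_chain_inv)
    then show ?thesis unfolding \<kappa>_def coset_one
      using coset_mult[OF cycle_of_edge_H1 cycle_of_edge_H1, of a0 i] a0 i core by simp
  qed
  ultimately have "L 2 c \<one>\<^bsub>Q\<^esub>" by (simp add: numeral_2_eq_2)
  then have "L 2 a0 \<one>\<^bsub>Q\<^esub>"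
    by (rule same) (use c a0 in \<open>auto simp: i_def nonbacktracking_def\<close>)
  then have "[2 = 0] (mod cover_period)" using uniq \<open>L 0 a0 \<one>\<^bsub>Q\<^esub>\<close> a0 by blast
  then have "cover_period dvd 2" by (simp add: cong_0_iff)
  then have "cover_period \<le> 2" by (auto dest: dvd_imp_le)
  \<comment> \<open>Being even and positive, \<open>nu G\<close> is at least 2, which excludes a
    period of \<open>2 * nu G\<close>.\<close>
  moreover have "even (nu G)" using nu_greatest[of 2] bipartite_circuit_even[OF assms(2)] by blast
  ultimately show ?thesis using cover_period_cases nu_pos by auto
qed

end

section \<open>Circuits, cycles and prime cycles\<close>

lemma abelianization_rotate:
  fixes p :: "('e \<times> bool) list"
  shows "abelianization (rotate k p) = abelianization p"
proof (induction k)
  case (Suc k)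
  have "abelianization (rotate1 q) = abelianization q" for q :: "('e \<times> bool) list"
    by (cases q) (auto simp: fun_eq_iff)
  then show ?case using Suc by simp
qed simp

lemma rotate_inverse: "rotate (length p - k mod length p) (rotate k p) = p"
proof (cases "p = []")
  case False
  have "rotate (length p - k mod length p) (rotate k p) = rotate (length p - k mod length p + k mod length p) p"
    unfolding rotate_rotate[symmetric] by (metis rotate_conv_mod)
  also have "length p - k mod length p + k mod length p = length p"
    using False by (simp add: less_imp_le)
  finally show ?thesis by simp
qed simp

text \<open>\<open>take k p\<close> and \<open>drop k p\<close> commute as words, hence are powers
  of a common word.\<close>

lemma rotate_fixed_imp_power:
  assumes "rotate k p = p" "0 < k" "k < length p"
  shows "\<exists>n q. n > 1 \<and> p = concat (replicate n q)"
proof -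
  have "drop k p @ take k p = take k p @ drop k p"
    using assms by (simp add: rotate_drop_take)
  moreover have "take k p \<noteq> []" "drop k p \<noteq> []" using assms by auto
  ultimately obtain n q where "n > 1" "concat (replicate n q) = take k p @ drop k p"
    using comm_append_is_replicate[of "take k p" "drop k p"] by auto
  then show ?thesis by (metis append_take_drop_id)
qed

text \<open>With \<open>x = y * y\<close>, each of the two linear factors is absorbed by its own
  power of \<open>y\<close>.\<close>

lemma poly_geometric_tendsto_0:
  fixes x :: real
  assumes "0 < x" "x < 1"
  shows "(\<lambda>n. real n * (real n + 1) * x ^ n) \<longlonglongrightarrow> 0"
proof -
  define y where "y = sqrt x"
  have y: "0 < y" "y < 1" "x = y * y" using assms by (simp_all add: y_def)
  have 1: "(\<lambda>n. real n * y ^ n) \<longlonglongrightarrow> 0" using powser_times_n_limit_0[of y] y by simp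
  have 2: "(\<lambda>n. y ^ n) \<longlonglongrightarrow> 0" using LIMSEQ_realpow_zero[of y] y by simp
  have "(\<lambda>n. (real n * y ^ n) * (real n * y ^ n + y ^ n)) \<longlonglongrightarrow> 0 * (0 + 0)"
    by (intro tendsto_intros 1 2)
  moreover have "(real n * y ^ n) * (real n * y ^ n + y ^ n) = real n * (real n + 1) * x ^ n" for n
    unfolding y(3) power_mult_distrib by (simp add: algebra_simps)
  ultimately show ?thesis by simp
qed

context genus2_graph
begin

lemma circuit_rotate: "circuit G p \<Longrightarrow> circuit G (rotate k p)"
proof (induction k)
  case (Suc k)
  have "circuit G (rotate1 q)" if q: "circuit G q" for q
  proof -
    obtain a q' where aq: "q = a # q'" using q by (cases q) (auto simp: circuit_def walk_def)
    then obtain z where z: "nb a z" "walk_via nb z q' a" using q unfolding circuit_iff_walk_via by auto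
    have w: "walk_via nb z (q' @ [a]) z" using z by (auto simp: walk_via_append)
    have "hd (q' @ [a]) = z" using walk_via_start[OF z(2)] by simp
    then show ?thesis using w aq unfolding circuit_iff_walk_via by simp
  qed
  then show ?case using Suc by simp
qed simp

lemma circuit_root:
  assumes p: "circuit G p" "p = concat (replicate n q)" "n > 0"
  shows "circuit G q"
proof -
  obtain m where n: "n = Suc m" using p(3) by (cases n) auto
  have pq: "p = q @ concat (replicate m q)" using p(2) n by simp
  have q: "q \<noteq> []" using p(1) p(2) by (cases q) (auto simp: circuit_def walk_def)
  have hd: "hd p = hd q" using pq q by simp
  obtain z where z: "walk_via nb (hd p) q z" "walk_via nb z (concat (replicate m q)) (hd p)"
    using p(1) unfolding circuit_iff_walk_via pq walk_via_append by blast
  have "z = hd p"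
  proof (cases m)
    case 0 then show ?thesis using z(2) by simp
  next
    case (Suc k) then show ?thesis using walk_via_start[OF z(2)] q hd by simp
  qed
  then show ?thesis unfolding circuit_iff_walk_via using z(1) hd q by simp
qed

definition rotations :: "('e \<times> bool) list \<Rightarrow> ('e \<times> bool) list set" where
  "rotations p = (\<lambda>k. rotate k p) ` {..<length p}"

lemma rotate_in_rotations: "p \<noteq> [] \<Longrightarrow> rotate k p \<in> rotations p"
  unfolding rotations_def by (subst rotate_conv_mod) auto

lemma circuit_equiv_class:
  assumes "circuit G p"
  shows "circuit_equiv G `` {p} = rotations p"
proof -
  have ne: "p \<noteq> []" using assms by (simp add: circuit_def walk_def)
  show ?thesis
  proof
    show "circuit_equiv G `` {p} \<subseteq> rotations p"
      using rotate_in_rotations[OF ne] by (auto simp: circuit_equiv_def)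
    show "rotations p \<subseteq> circuit_equiv G `` {p}"
      using circuit_rotate[OF assms] assms by (auto simp: circuit_equiv_def rotations_def)
  qed
qed

lemma rotations_eq: "q \<in> rotations p \<Longrightarrow> rotations q = rotations p"
proof -
  have sub: "rotations (rotate k p) \<subseteq> rotations p" if "p \<noteq> []" for k p
    using that rotate_in_rotations[OF that] by (auto simp: rotations_def[of "rotate k p"] rotate_rotate)
  assume q: "q \<in> rotations p"
  then obtain k where k: "q = rotate k p" "p \<noteq> []" unfolding rotations_def by (cases p) auto
  have "p = rotate (length p - k mod length p) q" using rotate_inverse[of p k] k(1) by simp
  then have "rotations p \<subseteq> rotations q" using sub[of q "length p - k mod length p"] k by simp
  then show ?thesis using sub[OF k(2), of k] k(1) by blast
qed

lemma self_in_rotations: "p \<noteq> [] \<Longrightarrow> p \<in> rotations p"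
  using rotate_in_rotations[of p 0] by simp

lemma finite_rotations: "finite (rotations p)" by (simp add: rotations_def)

text \<open>Two equal rotations yield a nontrivial rotation fixing \<open>p\<close>, so
  \<open>p\<close> would be a proper power of a word, which is then itself a circuit. This is the
  source of the factor \<open>l\<close> between circuits and prime cycles.\<close>

lemma card_rotations_prime:
  assumes p: "prime_circuit G p"
  shows "card (rotations p) = length p"
proof -
  have no: False if k: "rotate k p = p" "0 < k" "k < length p" for k
  proof -
    obtain n q where nq: "n > 1" "p = concat (replicate n q)" using rotate_fixed_imp_power[OF k] by blast
    then have "circuit G q" using circuit_root[of p n q] p by (simp add: prime_circuit_def)
    then show False using p nq unfolding prime_circuit_def by blast
  qed
  have "rotate i p \<noteq> rotate j p" if ij: "i < j" "j < length p" for i j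
  proof
    assume eq: "rotate i p = rotate j p"
    have i: "i mod length p = i" using ij by simp
    have "rotate (length p - i) (rotate j p) = p" using rotate_inverse[of p i] eq i by simp
    moreover have "rotate (length p - i) (rotate j p) = rotate (j - i) p"
    proof -
      have "rotate (length p - i) (rotate j p) = rotate (length p - i + j) p" by (simp add: rotate_rotate)
      also have "length p - i + j = length p + (j - i)" using ij by simp
      also have "rotate (length p + (j - i)) p = rotate ((length p + (j - i)) mod length p) p" by (rule rotate_conv_mod)
      also have "(length p + (j - i)) mod length p = j - i" unfolding mod_add_self1 using ij by simp
      finally show ?thesis .
    qed
    ultimately show False using no[of "j - i"] ij by (simp add: less_imp_diff_less)
  qed
  then have "inj_on (\<lambda>k. rotate k p) {..<length p}"
    by (intro linorder_inj_onI) auto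
  then show ?thesis unfolding rotations_def by (simp add: card_image)
qed

lemma cycle_sets:
  fixes l A
  defines "C \<equiv> {p. circuit G p \<and> length p = l \<and> abelianization p \<in> A}"
  shows "{Z \<in> cycles G. \<exists>p\<in>Z. length p = l \<and> abelianization p \<in> A} = rotations ` C"
    "{Z \<in> prime_cycles G. \<exists>p\<in>Z. length p = l \<and> abelianization p \<in> A} = rotations ` {p \<in> C. prime_circuit G p}"
proof -
  have inv: "(\<exists>q\<in>rotations p. length q = l \<and> abelianization q \<in> A) \<longleftrightarrow> length p = l \<and> abelianization p \<in> A"
    if "p \<noteq> []" for p
  proof
    assume "\<exists>q\<in>rotations p. length q = l \<and> abelianization q \<in> A"
    then show "length p = l \<and> abelianization p \<in> A" by (auto simp: rotations_def abelianization_rotate)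
  next
    assume "length p = l \<and> abelianization p \<in> A"
    then show "\<exists>q\<in>rotations p. length q = l \<and> abelianization q \<in> A" using self_in_rotations[OF that] by blast
  qed
  have ne: "p \<noteq> []" if "circuit G p" for p using that by (simp add: circuit_def walk_def)
  have cyc: "cycles G = rotations ` {p. circuit G p}"
    unfolding cycles_def quotient_def using circuit_equiv_class by auto
  have pcyc: "prime_cycles G = rotations ` {p. prime_circuit G p}"
    unfolding prime_cycles_def quotient_def using circuit_equiv_class by (auto simp: prime_circuit_def)
  have sel: "{Z \<in> rotations ` T. \<exists>p\<in>Z. length p = l \<and> abelianization p \<in> A} =
      rotations ` {p \<in> T. length p = l \<and> abelianization p \<in> A}" if T: "\<And>p. p \<in> T \<Longrightarrow> p \<noteq> []" for T
  proof -
    have "{Z \<in> rotations ` T. \<exists>p\<in>Z. length p = l \<and> abelianization p \<in> A} =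
      rotations ` {p \<in> T. \<exists>q\<in>rotations p. length q = l \<and> abelianization q \<in> A}" by blast
    also have "{p \<in> T. \<exists>q\<in>rotations p. length q = l \<and> abelianization q \<in> A} =
      {p \<in> T. length p = l \<and> abelianization p \<in> A}" using inv T by blast
    finally show ?thesis .
  qed
  show "{Z \<in> cycles G. \<exists>p\<in>Z. length p = l \<and> abelianization p \<in> A} = rotations ` C"
    unfolding cyc by (subst sel) (use ne in \<open>simp_all add: C_def\<close>)
  show "{Z \<in> prime_cycles G. \<exists>p\<in>Z. length p = l \<and> abelianization p \<in> A} = rotations ` {p \<in> C. prime_circuit G p}"
    unfolding pcyc
  proof (subst sel)
    show "p \<noteq> []" if "p \<in> {p. prime_circuit G p}" for p using that ne by (simp add: prime_circuit_def)
    have "{p \<in> {p. prime_circuit G p}. length p = l \<and> abelianization p \<in> A} = {p \<in> C. prime_circuit G p}"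
      unfolding C_def by (auto simp: prime_circuit_def)
    then show "rotations ` {p \<in> {p. prime_circuit G p}. length p = l \<and> abelianization p \<in> A} =
      rotations ` {p \<in> C. prime_circuit G p}" by (rule arg_cong)
  qed
qed

lemma finite_circuits_length: "finite {p. circuit G p \<and> length p = l \<and> R p}"
  by (rule finite_subset[OF _ finite_circuits[of l]]) auto

lemma counts_zero:
  assumes "circuit_count G A l = 0"
  shows "cycle_count G A l = 0" "prime_cycle_count G A l = 0"
proof -
  have e: "{p. circuit G p \<and> length p = l \<and> abelianization p \<in> A} = {}"
    using assms finite_circuits_length unfolding circuit_count_def by simp
  show "cycle_count G A l = 0" "prime_cycle_count G A l = 0"
    unfolding cycle_count_def prime_cycle_count_def cycle_sets e by simp_all
qed

text \<open>The rotation classes of prime circuits are disjoint and have exactly \<open>l\<close>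
  elements each; every remaining circuit or cycle is accounted for by one of the \<open>R\<close>
  circuits that are not prime.\<close>

lemma count_inequalities:
  fixes l A
  defines "R \<equiv> card {p. circuit G p \<and> length p = l \<and> \<not> prime_circuit G p}"
  shows "l * prime_cycle_count G A l \<le> circuit_count G A l"
    "circuit_count G A l \<le> l * prime_cycle_count G A l + R"
    "prime_cycle_count G A l \<le> cycle_count G A l"
    "cycle_count G A l \<le> prime_cycle_count G A l + R"
proof -
  define C where "C = {p. circuit G p \<and> length p = l \<and> abelianization p \<in> A}"
  define P where "P = {p \<in> C. prime_circuit G p}"
  define N where "N = {p. circuit G p \<and> length p = l \<and> \<not> prime_circuit G p}"
  have fin: "finite C" "finite P" "finite N"
    using finite_circuits_length by (simp_all add: C_def P_def N_def)
  have \<pi>: "prime_cycle_count G A l = card (rotations ` P)"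
    unfolding prime_cycle_count_def cycle_sets P_def C_def ..
  have \<pi>c: "cycle_count G A l = card (rotations ` C)"
    unfolding cycle_count_def cycle_sets C_def ..
  have ne: "p \<noteq> []" if "p \<in> C" for p using that by (simp add: C_def circuit_def walk_def)
  have "card (\<Union>(rotations ` P)) = (\<Sum>Z\<in>rotations ` P. card Z)"
  proof (rule card_Union_disjoint)
    show "pairwise disjnt (rotations ` P)"
    proof (rule pairwiseI)
      fix Z Z' assume Z: "Z \<in> rotations ` P" "Z' \<in> rotations ` P" "Z \<noteq> Z'"
      show "disjnt Z Z'" unfolding disjnt_iff
      proof (intro allI notI)
        fix q assume "q \<in> Z \<and> q \<in> Z'"
        then have "rotations q = Z" "rotations q = Z'" using Z(1,2) rotations_eq by blast+
        then show False using Z(3) by simp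
      qed
    qed
  qed (use finite_rotations in auto)
  also have "\<dots> = (\<Sum>Z\<in>rotations ` P. l)"
    by (rule sum.cong) (auto simp: P_def C_def card_rotations_prime)
  finally have U: "card (\<Union>(rotations ` P)) = l * prime_cycle_count G A l" by (simp add: \<pi>)
  have UC: "\<Union>(rotations ` P) \<subseteq> C"
    using circuit_rotate by (auto simp: P_def C_def rotations_def abelianization_rotate)
  show "l * prime_cycle_count G A l \<le> circuit_count G A l"
    unfolding U[symmetric] circuit_count_def C_def[symmetric] by (rule card_mono[OF fin(1) UC])
  have "C \<subseteq> \<Union>(rotations ` P) \<union> N"
    using self_in_rotations[OF ne] by (auto simp: P_def C_def N_def)
  then have "card C \<le> card (\<Union>(rotations ` P) \<union> N)"
    by (rule card_mono[rotated]) (use fin finite_rotations in auto)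
  also have "\<dots> \<le> l * prime_cycle_count G A l + R"
    using card_Un_le[of "\<Union>(rotations ` P)" N] by (simp add: U R_def N_def)
  finally show "circuit_count G A l \<le> l * prime_cycle_count G A l + R"
    by (simp add: circuit_count_def C_def)
  show "prime_cycle_count G A l \<le> cycle_count G A l"
    unfolding \<pi> \<pi>c using fin by (intro card_mono) (auto simp: P_def)
  have "rotations ` C \<subseteq> rotations ` P \<union> rotations ` N" by (auto simp: P_def C_def N_def)
  then have "card (rotations ` C) \<le> card (rotations ` P \<union> rotations ` N)"
    by (rule card_mono[rotated]) (use fin in auto)
  also have "\<dots> \<le> card (rotations ` P) + card (rotations ` N)" by (rule card_Un_le)
  also have "\<dots> \<le> card (rotations ` P) + card N" using card_image_le[OF fin(3)] by simp
  finally show "cycle_count G A l \<le> prime_cycle_count G A l + R" by (simp add: \<pi> \<pi>c R_def N_def)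
qed

text \<open>For fixed \<open>l\<close>, a proper power is determined by its root, and the root has
  length at most \<open>l div 2\<close>.\<close>

lemma nonprime_circuits_le:
  "card {p. circuit G p \<and> length p = l \<and> \<not> prime_circuit G p} \<le>
    (\<Sum>d\<le>l div 2. card {p. circuit G p \<and> length p = d})"
proof -
  let ?B = "\<Union>d\<in>{..l div 2}. {p. circuit G p \<and> length p = d}"
  note fin = finite_circuits
  have "{p. circuit G p \<and> length p = l \<and> \<not> prime_circuit G p} \<subseteq> (\<lambda>q. concat (replicate (l div length q) q)) ` ?B"
  proof
    fix p assume p: "p \<in> {p. circuit G p \<and> length p = l \<and> \<not> prime_circuit G p}"
    then obtain q n where q: "circuit G q" "n > 1" "p = concat (replicate n q)"
      unfolding prime_circuit_def by blast
    have len: "l = n * length q" using p q by (auto simp: length_concat sum_list_replicate)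
    have q0: "length q > 0" using q(1) by (simp add: circuit_def walk_def)
    have "2 * length q \<le> l" unfolding len using q(2) by (intro mult_le_mono1) simp
    then have "length q \<le> l div 2" by simp
    moreover have "l div length q = n" using len q0 by simp
    ultimately show "p \<in> (\<lambda>q. concat (replicate (l div length q) q)) ` ?B"
      using q by (intro image_eqI[of _ _ q]) auto
  qed
  then have "card {p. circuit G p \<and> length p = l \<and> \<not> prime_circuit G p} \<le> card ?B"
    using fin by (intro surj_card_le[of ?B]) auto
  also have "\<dots> \<le> (\<Sum>d\<le>l div 2. card {p. circuit G p \<and> length p = d})" by (rule card_UN_le) simp
  finally show ?thesis .
qed

end

section \<open>Asymptotics of the three counts\<close>

context covered_graph
begin

text \<open>Roots have at most half the length, so there are of order \<open>l * r ^ (l / 2)\<close>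
  proper powers, and \<open>r > 1\<close>. The extra factor \<open>l\<close> is included because
  cycle counts are themselves only of order \<open>r ^ l / l\<close>.\<close>

lemma nonprime_negligible:
  "(\<lambda>l. real l * real (card {p. circuit G p \<and> length p = l \<and> \<not> prime_circuit G p}) / r ^ l) \<longlonglongrightarrow> 0"
proof -
  define K where "K = real (card (carrier Q)) * real (card core)"
  define x where "x = 1 / sqrt r"
  have x: "0 < x" "x < 1" using r_gt_1 by (simp_all add: x_def)
  have sq: "sqrt r > 1" using r_gt_1 by simp
  have le: "real l * real (card {p. circuit G p \<and> length p = l \<and> \<not> prime_circuit G p}) / r ^ l \<le>
    K * (real l * (real l + 1) * x ^ l)" for l
  proof -
    have "real (card {p. circuit G p \<and> length p = l \<and> \<not> prime_circuit G p}) \<le>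
      (\<Sum>d\<le>l div 2. real (card {p. circuit G p \<and> length p = d}))"
      using of_nat_mono[OF nonprime_circuits_le[of l], where 'a = real] by simp
    also have "\<dots> \<le> (\<Sum>d\<le>l div 2. K * r ^ (l div 2))"
    proof (rule sum_mono)
      fix d assume d: "d \<in> {..l div 2}"
      have "K * r ^ d \<le> K * r ^ (l div 2)"
        using d r_gt_1 by (intro mult_left_mono power_increasing) (auto simp: K_def)
      then show "real (card {p. circuit G p \<and> length p = d}) \<le> K * r ^ (l div 2)"
        using circuit_count_total[of d] by (simp add: K_def)
    qed
    also have "\<dots> = real (l div 2 + 1) * (K * r ^ (l div 2))" by simp
    also have "\<dots> \<le> (real l + 1) * (K * sqrt r ^ l)"
    proof (rule mult_mono)
      have "r ^ (l div 2) = sqrt r ^ (2 * (l div 2))" using r_gt_1 by (simp add: power_mult)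
      also have "\<dots> \<le> sqrt r ^ l" using sq by (intro power_increasing) auto
      finally show "K * r ^ (l div 2) \<le> K * sqrt r ^ l" by (intro mult_left_mono) (auto simp: K_def)
      show "real (l div 2 + 1) \<le> real l + 1" by simp
      show "0 \<le> K * r ^ (l div 2)" using r_gt_1 by (simp add: K_def)
    qed simp
    finally have "real l * real (card {p. circuit G p \<and> length p = l \<and> \<not> prime_circuit G p}) / r ^ l \<le>
      real l * ((real l + 1) * (K * sqrt r ^ l)) / r ^ l"
      using r_gt_1 by (intro divide_right_mono mult_left_mono) auto
    also have "\<dots> = K * (real l * (real l + 1) * (sqrt r ^ l / r ^ l))" by (simp add: field_simps)
    also have "sqrt r ^ l / r ^ l = x ^ l"
    proof -
      have "sqrt r / r = x" using r_gt_1 by (simp add: x_def real_div_sqrt field_simps)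
      then show ?thesis by (simp add: power_divide[symmetric])
    qed
    finally show ?thesis .
  qed
  have "(\<lambda>l. K * (real l * (real l + 1) * x ^ l)) \<longlonglongrightarrow> K * 0"
    by (intro tendsto_mult tendsto_const poly_geometric_tendsto_0 x)
  then have lim: "(\<lambda>l. K * (real l * (real l + 1) * x ^ l)) \<longlonglongrightarrow> 0" by simp
  show ?thesis
  proof (rule tendsto_sandwich[OF _ _ tendsto_const lim])
    show "\<forall>\<^sub>F l in sequentially. 0 \<le> real l * real (card {p. circuit G p \<and> length p = l \<and> \<not> prime_circuit G p}) / r ^ l"
      using r_pos by (intro always_eventually allI) simp
    show "\<forall>\<^sub>F l in sequentially. real l * real (card {p. circuit G p \<and> length p = l \<and> \<not> prime_circuit G p}) / r ^ l
        \<le> K * (real l * (real l + 1) * x ^ l)"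
      using le by (intro always_eventually allI)
  qed
qed

lemma counts_asymptotic_if_limit:
  assumes lim: "((\<lambda>l. real (circuit_count G (coset \<alpha>) l) / r ^ l) \<longlongrightarrow> real k / real (card (carrier Q)))
      (inf sequentially (principal S))"
    and k: "k > 0"
  shows "counts_asymptotic G \<Lambda> \<alpha> S (real k)"
proof -
  define F where "F = inf sequentially (principal S)"
  define c where "c = real k / real (card (carrier Q))"
  define N where "N = (\<lambda>l. real (circuit_count G (coset \<alpha>) l))"
  define \<pi> where "\<pi> = (\<lambda>l. real (prime_cycle_count G (coset \<alpha>) l))"
  define \<pi>c where "\<pi>c = (\<lambda>l. real (cycle_count G (coset \<alpha>) l))"
  define R where "R = (\<lambda>l. real (card {p. circuit G p \<and> length p = l \<and> \<not> prime_circuit G p}))"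
  have cpos: "c > 0"
  proof -
    have "carrier Q \<noteq> {}" using Qg.one_closed by blast
    then have "card (carrier Q) > 0" using finQ by (simp add: card_gt_0_iff)
    then show ?thesis using k by (simp add: c_def)
  qed
  have rp: "r ^ l > 0" for l using r_pos by simp
  have ineq: "real l * \<pi> l \<le> N l" "N l \<le> real l * \<pi> l + R l" "\<pi> l \<le> \<pi>c l" "\<pi>c l \<le> \<pi> l + R l" for l
    using count_inequalities[where l = l and A = "coset \<alpha>"] unfolding N_def \<pi>_def \<pi>c_def R_def
    by (simp_all only: of_nat_mult[symmetric] of_nat_add[symmetric] of_nat_le_iff)
  have F: "eventually P F" if "eventually P sequentially" for P
    using that unfolding F_def by (rule filter_leD[rotated]) simp
  have pos: "\<forall>\<^sub>F l in F. l > 0" using eventually_gt_at_top by (rule F)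
  have limN: "((\<lambda>l. N l / r ^ l) \<longlongrightarrow> c) F" using lim unfolding N_def c_def F_def .
  \<comment> \<open>This stronger form is required for \<open>\<pi>c\<close>, which may exceed \<pi>
    by \<open>R\<close> before multiplication by \<open>l\<close>; for the comparison of
    \<open>N\<close> with \<open>l * \<pi>\<close> the weaker \<open>limR\<close> is enough.\<close>
  have lR: "((\<lambda>l. real l * R l / r ^ l) \<longlongrightarrow> 0) F"
    using nonprime_negligible unfolding R_def F_def by (rule tendsto_mono[rotated]) simp
  have R_le: "\<forall>\<^sub>F l in F. R l / r ^ l \<le> real l * R l / r ^ l"
    using pos
  proof eventually_elim
    case (elim l)
    then have "1 * R l \<le> real l * R l" by (intro mult_right_mono) (auto simp: R_def)
    then show ?case using rp[of l] by (simp add: divide_right_mono)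
  qed
  have limR: "((\<lambda>l. R l / r ^ l) \<longlongrightarrow> 0) F"
    by (rule tendsto_sandwich[OF _ R_le tendsto_const lR]) (use rp in \<open>auto simp: R_def less_imp_le\<close>)
  have lim\<pi>: "((\<lambda>l. \<pi> l * real l / r ^ l) \<longlongrightarrow> c) F"
  proof (rule tendsto_sandwich)
    have "N l / r ^ l - R l / r ^ l \<le> \<pi> l * real l / r ^ l" for l
      using ineq(2)[of l] rp[of l] by (simp add: diff_divide_distrib[symmetric] divide_right_mono algebra_simps)
    then show "\<forall>\<^sub>F l in F. N l / r ^ l - R l / r ^ l \<le> \<pi> l * real l / r ^ l" by (intro always_eventually allI)
    have "\<pi> l * real l / r ^ l \<le> N l / r ^ l" for l
      using ineq(1)[of l] rp[of l] by (simp add: divide_right_mono mult.commute)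
    then show "\<forall>\<^sub>F l in F. \<pi> l * real l / r ^ l \<le> N l / r ^ l" by (intro always_eventually allI)
    show "((\<lambda>l. N l / r ^ l - R l / r ^ l) \<longlongrightarrow> c) F" using tendsto_diff[OF limN limR] by simp
  qed (rule limN)
  have lim\<pi>c: "((\<lambda>l. \<pi>c l * real l / r ^ l) \<longlongrightarrow> c) F"
  proof (rule tendsto_sandwich)
    have "\<pi> l * real l / r ^ l \<le> \<pi>c l * real l / r ^ l" for l
      using ineq(3)[of l] rp[of l] by (intro divide_right_mono mult_right_mono) auto
    then show "\<forall>\<^sub>F l in F. \<pi> l * real l / r ^ l \<le> \<pi>c l * real l / r ^ l" by (intro always_eventually allI)
    have "\<pi>c l * real l / r ^ l \<le> \<pi> l * real l / r ^ l + real l * R l / r ^ l" for l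
    proof -
      have "\<pi>c l * real l / r ^ l \<le> (\<pi> l + R l) * real l / r ^ l"
        using ineq(4)[of l] rp[of l] by (intro divide_right_mono mult_right_mono) auto
      then show ?thesis by (simp add: algebra_simps add_divide_distrib)
    qed
    then show "\<forall>\<^sub>F l in F. \<pi>c l * real l / r ^ l \<le> \<pi> l * real l / r ^ l + real l * R l / r ^ l"
      by (intro always_eventually allI)
    show "((\<lambda>l. \<pi> l * real l / r ^ l + real l * R l / r ^ l) \<longlongrightarrow> c) F" using tendsto_add[OF lim\<pi> lR] by simp
  qed (rule lim\<pi>)
  define g where "g = (\<lambda>l. real k * r ^ l / (real l * real (card (carrier Q))))"
  have eqv: "h \<sim>[F] g" if h: "((\<lambda>l. h l * real l / r ^ l) \<longlongrightarrow> c) F" for h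
  proof (rule asymp_equivI')
    have "((\<lambda>l. h l * real l / r ^ l / c) \<longlongrightarrow> c / c) F" using h cpos by (intro tendsto_divide tendsto_const) auto
    moreover have "\<forall>\<^sub>F l in F. h l * real l / r ^ l / c = h l / g l"
      using pos by eventually_elim (simp add: g_def c_def mult_ac)
    ultimately have "((\<lambda>l. h l / g l) \<longlongrightarrow> c / c) F" by (rule Lim_transform_eventually)
    then show "((\<lambda>l. h l / g l) \<longlongrightarrow> 1) F" using cpos by simp
  qed
  have e1: "\<pi> \<sim>[F] g" by (rule eqv[OF lim\<pi>])
  have e2: "\<pi>c \<sim>[F] g" by (rule eqv[OF lim\<pi>c])
  have e3: "(\<lambda>l. N l / real l) \<sim>[F] g"
  proof (rule eqv)
    have "\<forall>\<^sub>F l in F. N l / r ^ l = N l / real l * real l / r ^ l" using pos by eventually_elim simp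
    then show "((\<lambda>l. N l / real l * real l / r ^ l) \<longlongrightarrow> c) F" by (rule Lim_transform_eventually[OF limN])
  qed
  have "\<pi> \<sim>[F] \<pi>c" "\<pi>c \<sim>[F] (\<lambda>l. N l / real l)"
    using e1 e2 e3 asymp_equiv_sym asymp_equiv_trans by blast+
  moreover obtain a where "a \<in> core" using core_nonempty by blast
  ultimately show ?thesis
    using e3 rho_nu(1) unfolding counts_asymptotic_def Let_def F_def N_def \<pi>_def \<pi>c_def g_def by simp
qed

lemma counts_asymptotic_nu:
  assumes D: "cover_period = nu G" and \<alpha>: "\<alpha> \<in> H1_int G"
  shows "counts_asymptotic G \<Lambda> \<alpha> {l. nu G dvd l} (real (nu G))"
proof (rule counts_asymptotic_if_limit)
  obtain x where x: "x \<in> core" using core_nonempty by blast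
  obtain p where p: "walk_via core_step x p x" "cls p = coset \<alpha>"
    using closed_walk_every_class[OF x, of "coset \<alpha>"] \<alpha> carrier_Q by blast
  have "l mod cover_period = length p mod cover_period" if "l \<in> {l. nu G dvd l}" for l
    using that nu_dvd_closed[OF x p(1)] by (simp add: D)
  then show "((\<lambda>l. real (circuit_count G (coset \<alpha>) l) / r ^ l) \<longlongrightarrow> real (nu G) / real (card (carrier Q)))
      (inf sequentially (principal {l. nu G dvd l}))"
    using circuit_count_limit[OF \<alpha> x p, of "{l. nu G dvd l}"] by (simp only: D)
qed (rule nu_pos)

text \<open>Since \<open>nu G\<close> is odd, a residue modulo \<open>2 * nu G\<close> amounts to
  divisibility by \<open>nu G\<close> together with a parity. The parity of the class is that of
  \<open>edge_sum \<alpha>\<close>, so \<open>S\<close> is exactly the residue class that carries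
  its circuits.\<close>

lemma counts_asymptotic_twice_nu:
  assumes nb: "\<not> bipartite G" and \<theta>: "canonical_character G \<in> quotient_characters G \<Lambda>" and \<alpha>: "\<alpha> \<in> H1_int G"
    and S: "S = {l. nu G dvd l \<and> (even l \<longleftrightarrow> edge_sum \<alpha> / 2 \<in> \<int>)}"
  shows "counts_asymptotic G \<Lambda> \<alpha> S (2 * real (nu G))"
proof -
  have D: "cover_period = 2 * nu G" using cover_period_eq_twice_nu[OF nb \<theta>] .
  obtain x where x: "x \<in> core" using core_nonempty by blast
  obtain p where p: "walk_via core_step x p x" "cls p = coset \<alpha>"
    using closed_walk_every_class[OF x, of "coset \<alpha>"] \<alpha> carrier_Q by blast
  have par: "even (length p) \<longleftrightarrow> edge_sum \<alpha> / 2 \<in> \<int>"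
    using half_diff_Ints_iff[OF even_cover_period_class_parity[OF _ \<alpha> x p]] half_of_nat_Ints_iff D by simp
  have "l mod cover_period = length p mod cover_period" if "l \<in> S" for l
  proof -
    have "nu G dvd l" "nu G dvd length p" using that nu_dvd_closed[OF x p(1)] by (simp_all add: S)
    then have "[l = length p] (mod nu G)" by (simp add: cong_def)
    moreover have "[l = length p] (mod 2)" using that par by (simp add: S cong_def mod2_eq_if)
    moreover have "coprime 2 (nu G)" using odd_nu_if_not_bipartite[OF nb] by simp
    ultimately have "[l = length p] (mod (2 * nu G))" by (intro coprime_cong_mult_nat)
    then show ?thesis by (simp add: D cong_def)
  qed
  then have "((\<lambda>l. real (circuit_count G (coset \<alpha>) l) / r ^ l) \<longlongrightarrow> real (2 * nu G) / real (card (carrier Q)))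
      (inf sequentially (principal S))"
    using circuit_count_limit[OF \<alpha> x p, of S] by (simp only: D)
  from counts_asymptotic_if_limit[OF this] show ?thesis using nu_pos by simp
qed

lemma no_circuits:
  assumes "\<And>p. circuit G p \<Longrightarrow> length p = l \<Longrightarrow> abelianization p \<in> A \<Longrightarrow> False"
  shows "prime_cycle_count G A l = 0 \<and> cycle_count G A l = 0 \<and> circuit_count G A l = 0"
proof -
  have "{p. circuit G p \<and> length p = l \<and> abelianization p \<in> A} = {}" using assms by blast
  then have "circuit_count G A l = 0" by (simp only: circuit_count_def card.empty)
  then show ?thesis using counts_zero by simp
qed

end

lemma (in genus2_graph) covered_graph_exists:
  assumes "subgroup \<Lambda> (homology_group G)" "finite (carrier (quotient_group G \<Lambda>))"
  shows "\<exists>s r u v0. covered_graph G \<Lambda> s r u v0"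
proof -
  obtain v0 where v0: "v0 \<in> verts G" using verts_nonempty by blast
  obtain s where s: "\<forall>v\<in>verts G. s v \<in> chains G \<and> (\<forall>e. s v e \<in> \<int>) \<and>
     (\<forall>w. boundary G (s v) w = of_bool (v = w) - of_bool (v0 = w))"
    using potential_exists[OF v0] by blast
  have irr: "(a, b) \<in> {(a, b). a \<in> core \<and> b \<in> core \<and> nb a b}\<^sup>+" if "a \<in> core" "b \<in> core" for a b
    using core_step_tranclp[OF that]
    by (induction rule: tranclp_induct) (auto intro: trancl_into_trancl)
  have fin: "finite core" using core_OE finite_OE finite_subset by blast
  obtain r u where "r > (0::real)" "\<forall>a\<in>core. u a > 0" "\<forall>a\<in>core. r * u a = (\<Sum>b\<in>{b\<in>core. nb a b}. u b)"
    using perron_eigenvector[OF fin core_nonempty irr] by blast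
  then have "covered_graph_axioms G \<Lambda> s r u v0" using s assms by (simp add: covered_graph_axioms_def)
  then have "covered_graph G \<Lambda> s r u v0" by (rule covered_graph.intro[OF genus2_graph_axioms])
  then show ?thesis by blast
qed

theorem theorem3p17:
  fixes G :: "('v, 'e) pre_digraph"
    and \<Lambda> :: "('e \<Rightarrow> real) set"
    and \<alpha> :: "'e \<Rightarrow> real"
  assumes "fin_digraph G" and "Digraph_Component.connected G"
    and "genus G \<ge> 2"
    and "subgroup \<Lambda> (homology_group G)"
    and "finite (carrier (quotient_group G \<Lambda>))"
    and "\<alpha> \<in> H1_int G"
  defines "A \<equiv> homology_coset G \<Lambda> \<alpha>"
    and "\<theta> \<equiv> canonical_character G"
    and "Q' \<equiv> quotient_characters G \<Lambda>"
  shows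
    \<comment> \<open>(a)\<close>
    "(\<forall>l. (\<not> nu G dvd l) \<or>
          (\<theta> \<in> Q' \<and> chi_coset G \<theta> A = 1 \<and> odd l) \<or>
          (\<theta> \<in> Q' \<and> chi_coset G \<theta> A = - 1 \<and> even l) \<longrightarrow>
        prime_cycle_count G A l = 0 \<and> cycle_count G A l = 0 \<and> circuit_count G A l = 0) \<and>
     \<comment> \<open>(b)\<close>
     (\<theta> \<notin> Q' \<or>
      (bipartite G \<and>
        (\<forall>x \<in> Q'. x \<noteq> \<one>\<^bsub>character_group G\<^esub> \<longrightarrow>
           x \<otimes>\<^bsub>character_group G\<^esub> x \<noteq> \<one>\<^bsub>character_group G\<^esub>)) \<or>
      (regular_graph G \<and> bipartite G) \<longrightarrow>
        counts_asymptotic G \<Lambda> \<alpha> {l. nu G dvd l} (real (nu G))) \<and>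
     \<comment> \<open>(c)\<close>
     (\<not> bipartite G \<and> \<theta> \<in> Q' \<and> chi_coset G \<theta> A = 1 \<longrightarrow>
        counts_asymptotic G \<Lambda> \<alpha> {l. nu G dvd l \<and> even l} (2 * real (nu G))) \<and>
     (\<not> bipartite G \<and> \<theta> \<in> Q' \<and> chi_coset G \<theta> A = - 1 \<longrightarrow>
        counts_asymptotic G \<Lambda> \<alpha> {l. nu G dvd l \<and> odd l} (2 * real (nu G)))"
proof -
  interpret genus2_graph G
    using assms(1-3) by (simp add: genus2_graph_def genus2_graph_axioms_def)
  obtain s r u v0 where "covered_graph G \<Lambda> s r u v0"
    using covered_graph_exists[OF assms(4,5)] by blast
  then interpret covered_graph G \<Lambda> s r u v0 .
  \<comment> \<open>From here on the value of \<theta> only encodes the parity of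
    \<open>edge_sum \<alpha>\<close>, which by \<open>parity\<close> is the parity of the length of
    every circuit in the class.\<close>
  have chi: "chi_coset G \<theta> A = (if edge_sum \<alpha> / 2 \<in> \<int> then 1 else - 1)" if "\<theta> \<in> Q'"
    using chi_canonical_character assms(6) that unfolding A_def \<theta>_def Q'_def by blast
  have parity: "even (length p) \<longleftrightarrow> edge_sum \<alpha> / 2 \<in> \<int>"
    if "\<theta> \<in> Q'" "circuit G p" "abelianization p \<in> A" for p
    using circuit_class_parity that unfolding A_def \<theta>_def Q'_def by blast
  have a: "prime_cycle_count G A l = 0 \<and> cycle_count G A l = 0 \<and> circuit_count G A l = 0"
    if "\<not> nu G dvd l \<or> (\<theta> \<in> Q' \<and> chi_coset G \<theta> A = 1 \<and> odd l) \<or> (\<theta> \<in> Q' \<and> chi_coset G \<theta> A = - 1 \<and> even l)" for l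
  proof (rule no_circuits)
    fix p assume p: "circuit G p" "length p = l" "abelianization p \<in> A"
    show False using that
    proof (elim disjE conjE)
      assume "\<not> nu G dvd l" then show False using nu_dvd_circuit p by blast
    next
      assume "\<theta> \<in> Q'" "chi_coset G \<theta> A = 1" "odd l"
      then show False using chi parity[OF _ p(1,3)] p(2) by (auto split: if_splits)
    next
      assume "\<theta> \<in> Q'" "chi_coset G \<theta> A = - 1" "even l"
      then show False using chi parity[OF _ p(1,3)] p(2) by (auto split: if_splits)
    qed
  qed
  have b: "counts_asymptotic G \<Lambda> \<alpha> {l. nu G dvd l} (real (nu G))"
    if "\<theta> \<notin> Q' \<or> (bipartite G \<and> (\<forall>x \<in> Q'. x \<noteq> \<one>\<^bsub>character_group G\<^esub> \<longrightarrow>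
         x \<otimes>\<^bsub>character_group G\<^esub> x \<noteq> \<one>\<^bsub>character_group G\<^esub>)) \<or> (regular_graph G \<and> bipartite G)"
    using that cover_period_eq_nu_if_not_theta cover_period_eq_nu_if_no_two_torsion cover_period_eq_nu_if_regular
      counts_asymptotic_nu[OF _ assms(6)] unfolding \<theta>_def Q'_def by blast
  have c1: "counts_asymptotic G \<Lambda> \<alpha> {l. nu G dvd l \<and> even l} (2 * real (nu G))"
    if c: "\<not> bipartite G" "\<theta> \<in> Q'" "chi_coset G \<theta> A = 1"
  proof (rule counts_asymptotic_twice_nu[OF c(1) _ assms(6)])
    have "edge_sum \<alpha> / 2 \<in> \<int>" using chi[OF c(2)] c(3) by (auto split: if_splits)
    then show "{l. nu G dvd l \<and> even l} = {l. nu G dvd l \<and> (even l \<longleftrightarrow> edge_sum \<alpha> / 2 \<in> \<int>)}" by simp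
  qed (use c(2) in \<open>simp add: \<theta>_def Q'_def\<close>)
  have c2: "counts_asymptotic G \<Lambda> \<alpha> {l. nu G dvd l \<and> odd l} (2 * real (nu G))"
    if c: "\<not> bipartite G" "\<theta> \<in> Q'" "chi_coset G \<theta> A = - 1"
  proof (rule counts_asymptotic_twice_nu[OF c(1) _ assms(6)])
    have "edge_sum \<alpha> / 2 \<notin> \<int>" using chi[OF c(2)] c(3) by (auto split: if_splits)
    then show "{l. nu G dvd l \<and> odd l} = {l. nu G dvd l \<and> (even l \<longleftrightarrow> edge_sum \<alpha> / 2 \<in> \<int>)}" by simp
  qed (use c(2) in \<open>simp add: \<theta>_def Q'_def\<close>)
  show ?thesis using a b c1 c2 by blast
qed

end
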